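(* Every BPW complete local operator algebra of functions on a set $X$ is weak*-RFD.
   Context: An (abstract, unital) operator algebra is a unital algebra with a norm on each matrix level satisfying the Blecher–Ruan–Sinclair (BRS) axioms: $\|LGM\|\le\|L\|\|G\|\|M\|$ for scalar matrices $L,M$; $\|G\oplus H\|=\max\{\|G\|,\|H\|\}$; $\|GH\|\le\|G\|\|H\|$; $\|1\|=1$. An operator algebra of functions on $X$ is a subalgebra $\mathcal A$ of the algebra of all complex-valued functions on $X$ which separates the points of $X$ and contains the constants, is equipped with norms on all $M_n(\mathcal A)$ satisfying the BRS axioms, and has every evaluation functional $f\mapsto f(x)$, $x\in X$, bounded. For finite $F\subseteq X$ let $I_F=\{f\in\mathcal A:f|_F=0\}$ and give $M_n(\mathcal A/I_F)=M_n(\mathcal A)/M_n(I_F)$ the quotient norm. $\mathcal A$ is local if $\|(f_{ij})\|=\sup_F\|(f_{ij}+I_F)\|$ for all $n$ and $(f_{ij})\in M_n(\mathcal A)$, the supremum being over finite $F\subseteq X$. $\mathcal A$ is BPW complete if it contains every function that is the pointwise limit on $X$ of a norm-bounded net in $\mathcal A$. Weak*-topology: for a BPW complete local operator algebra of functions $\mathcal A$ there is a positive definite function $K:X\times X\to B(\mathfrak C)$, $\mathfrak C$ a Hilbert space, such that $\mathcal A=\mathcal M(K)$ completely isometrically, where $\mathcal M(K)\subseteq B(\mathcal L)$ is the algebra of (scalar) multipliers $f\mapsto M_f$ of the reproducing kernel Hilbert space $\mathcal L$ of $\mathfrak C$-valued functions on $X$ with kernel $K$; $\mathcal M(K)$ is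 weak*-closed in $B(\mathcal L)$, so $\mathcal A$ is a dual operator algebra, and its weak*-topology is the one inherited from $B(\mathcal L)$. On bounded nets in $\mathcal A$, weak*-convergence coincides with pointwise convergence on $X$. A dual operator algebra $\mathcal B$ is weak*-RFD (residually finite dimensional) if for every $n$ and every $(b_{ij})\in M_n(\mathcal B)$, $\|(b_{ij})\|=\sup\|(\pi(b_{ij}))\|$, the supremum being over all weak*-continuous completely contractive homomorphisms $\pi:\mathcal B\to M_k$ and all positive integers $k$. *)

theory Defs
  imports
    "HOL-Analysis.Analysis"
    "HOL-Library.Function_Algebras"
    "Jordan_Normal_Form.Matrix"
begin

unbundle no vec_syntax
hide_const (open) Finite_Cartesian_Product.vec
hide_type (open) Finite_Cartesian_Product.vec

section \<open>Operator norm of complex matrices\<close>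

definition vec_norm2 :: "complex vec \<Rightarrow> real" where
  "vec_norm2 v = L2_set (\<lambda>i. cmod (vec_index v i)) {..<dim_vec v}"

definition op_norm :: "complex mat \<Rightarrow> real" where
  "op_norm L = Sup {vec_norm2 (L *\<^sub>v v) | v. v \<in> carrier_vec (dim_col L) \<and> vec_norm2 v \<le> 1}"

section \<open>Operator algebras of functions\<close>

text \<open>
  The underlying set \<open>X\<close> is the type \<open>'x\<close>; the algebra operations on \<open>'x \<Rightarrow> complex\<close> are the
  pointwise ones of \<open>Function_Algebras\<close>. The norms of all the \<open>M_n(A)\<close> are collected in one function
  \<open>nrm\<close> on matrices, since a matrix carries its size; only its values on \<open>Mat A n\<close> with \<open>n > 0\<close>
  are ever used.
\<close>

definition Mat :: "'a set \<Rightarrow> nat \<Rightarrow> 'a mat set" where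
  "Mat A n = {G \<in> carrier_mat n n. elements_mat G \<subseteq> A}"

definition scalar_matrix :: "complex mat \<Rightarrow> ('x \<Rightarrow> complex) mat" where
  "scalar_matrix L = map_mat (\<lambda>c _. c) L"

definition direct_sum :: "'a::zero mat \<Rightarrow> 'a mat \<Rightarrow> 'a mat" where
  "direct_sum G H =
     four_block_mat G (0\<^sub>m (dim_row G) (dim_col H)) (0\<^sub>m (dim_row H) (dim_col G)) H"

definition singleton_mat :: "'a \<Rightarrow> 'a mat" where
  "singleton_mat f = mat 1 1 (\<lambda>_. f)"

definition function_algebra :: "('x \<Rightarrow> complex) set \<Rightarrow> bool" where
  "function_algebra A \<longleftrightarrow>
     (\<forall>c. (\<lambda>_. c) \<in> A) \<and>
     (\<forall>f\<in>A. \<forall>g\<in>A. f + g \<in> A \<and> f * g \<in> A) \<and>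
     (\<forall>x y. x \<noteq> y \<longrightarrow> (\<exists>f\<in>A. f x \<noteq> f y))"

definition matrix_norms :: "('x \<Rightarrow> complex) set \<Rightarrow> (('x \<Rightarrow> complex) mat \<Rightarrow> real) \<Rightarrow> bool" where
  "matrix_norms A nrm \<longleftrightarrow>
     (\<forall>n>0. \<forall>G\<in>Mat A n.
        0 \<le> nrm G \<and> (nrm G = 0 \<longleftrightarrow> G = 0\<^sub>m n n) \<and>
        (\<forall>c. nrm ((\<lambda>_. c) \<cdot>\<^sub>m G) = cmod c * nrm G) \<and>
        (\<forall>H\<in>Mat A n. nrm (G + H) \<le> nrm G + nrm H))"

definition BRS_axioms :: "('x \<Rightarrow> complex) set \<Rightarrow> (('x \<Rightarrow> complex) mat \<Rightarrow> real) \<Rightarrow> bool" where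
  "BRS_axioms A nrm \<longleftrightarrow>
     (\<forall>m>0. \<forall>n>0. \<forall>G\<in>Mat A n. \<forall>L\<in>carrier_mat m n. \<forall>M\<in>carrier_mat n m.
        nrm (scalar_matrix L * G * scalar_matrix M) \<le> op_norm L * nrm G * op_norm M) \<and>
     (\<forall>m>0. \<forall>n>0. \<forall>G\<in>Mat A m. \<forall>H\<in>Mat A n. nrm (direct_sum G H) = max (nrm G) (nrm H)) \<and>
     (\<forall>n>0. \<forall>G\<in>Mat A n. \<forall>H\<in>Mat A n. nrm (G * H) \<le> nrm G * nrm H) \<and>
     nrm (singleton_mat 1) = 1"

definition operator_algebra_of_functions ::
    "('x \<Rightarrow> complex) set \<Rightarrow> (('x \<Rightarrow> complex) mat \<Rightarrow> real) \<Rightarrow> bool" where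
  "operator_algebra_of_functions A nrm \<longleftrightarrow>
     function_algebra A \<and> matrix_norms A nrm \<and> BRS_axioms A nrm \<and>
     (\<forall>x. \<exists>C. \<forall>f\<in>A. cmod (f x) \<le> C * nrm (singleton_mat f))"

definition vanishing_ideal :: "('x \<Rightarrow> complex) set \<Rightarrow> 'x set \<Rightarrow> ('x \<Rightarrow> complex) set" where
  "vanishing_ideal A F = {f \<in> A. \<forall>x\<in>F. f x = 0}"

definition quotient_norm ::
    "('x \<Rightarrow> complex) set \<Rightarrow> (('x \<Rightarrow> complex) mat \<Rightarrow> real) \<Rightarrow> 'x set \<Rightarrow> ('x \<Rightarrow> complex) mat \<Rightarrow> real" where
  "quotient_norm A nrm F G = Inf {nrm (G + H) | H. H \<in> Mat (vanishing_ideal A F) (dim_row G)}"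

definition local_algebra ::
    "('x \<Rightarrow> complex) set \<Rightarrow> (('x \<Rightarrow> complex) mat \<Rightarrow> real) \<Rightarrow> bool" where
  "local_algebra A nrm \<longleftrightarrow>
     (\<forall>n>0. \<forall>G\<in>Mat A n. nrm G = (SUP F\<in>{F. finite F}. quotient_norm A nrm F G))"

text \<open>Bounded nets in \<open>A\<close> are represented by proper filters that contain a bounded subset of \<open>A\<close>.\<close>

definition BPW_complete ::
    "('x \<Rightarrow> complex) set \<Rightarrow> (('x \<Rightarrow> complex) mat \<Rightarrow> real) \<Rightarrow> bool" where
  "BPW_complete A nrm \<longleftrightarrow>
     (\<forall>\<F> C f. \<F> \<noteq> bot \<longrightarrow>
        (\<forall>\<^sub>F g in \<F>. g \<in> A \<and> nrm (singleton_mat g) \<le> C) \<longrightarrow>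
        (\<forall>x. ((\<lambda>g. g x) \<longlongrightarrow> f x) \<F>) \<longrightarrow> f \<in> A)"

section \<open>Complex Hilbert spaces and their weak* topology\<close>

class complex_vector = ab_group_add +
  fixes scaleC :: "complex \<Rightarrow> 'a \<Rightarrow> 'a" (infixr \<open>*\<^sub>C\<close> 75)
  assumes scaleC_add_right: "a *\<^sub>C (u + v) = a *\<^sub>C u + a *\<^sub>C v"
    and scaleC_add_left: "(a + b) *\<^sub>C v = a *\<^sub>C v + b *\<^sub>C v"
    and scaleC_scaleC: "a *\<^sub>C b *\<^sub>C v = (a * b) *\<^sub>C v"
    and scaleC_one: "1 *\<^sub>C v = v"

instantiation complex :: complex_vector
begin
definition "scaleC_complex (a :: complex) (v :: complex) = a * v"
instance
  by standard (simp_all add: scaleC_complex_def algebra_simps)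
end

instantiation "fun" :: (type, complex_vector) complex_vector
begin
definition "scaleC_fun a (f :: 'a \<Rightarrow> 'b) = (\<lambda>x. a *\<^sub>C f x)"
instance
  by standard
    (simp_all add: scaleC_fun_def fun_eq_iff scaleC_add_right scaleC_add_left scaleC_scaleC scaleC_one)
end

text \<open>
  A Hilbert space is a subspace \<open>H\<close> of a complex vector space type, with an inner product
  \<open>ip\<close> (linear in the first argument) whose values matter only on \<open>H\<close>. No topology on the ambient
  type is involved, so spaces of functions are covered.
\<close>

definition ip_norm :: "('v \<Rightarrow> 'v \<Rightarrow> complex) \<Rightarrow> 'v \<Rightarrow> real" where
  "ip_norm ip u = sqrt (Re (ip u u))"

locale hilbert =
  fixes H :: "'v::complex_vector set" and ip :: "'v \<Rightarrow> 'v \<Rightarrow> complex"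
  assumes zero_mem: "0 \<in> H"
    and add_mem: "u \<in> H \<Longrightarrow> v \<in> H \<Longrightarrow> u + v \<in> H"
    and scaleC_mem: "u \<in> H \<Longrightarrow> c *\<^sub>C u \<in> H"
    and ip_add_left: "u \<in> H \<Longrightarrow> v \<in> H \<Longrightarrow> w \<in> H \<Longrightarrow> ip (u + v) w = ip u w + ip v w"
    and ip_scaleC_left: "u \<in> H \<Longrightarrow> v \<in> H \<Longrightarrow> ip (c *\<^sub>C u) v = c * ip u v"
    and ip_commute: "u \<in> H \<Longrightarrow> v \<in> H \<Longrightarrow> ip v u = cnj (ip u v)"
    and ip_ge_zero: "u \<in> H \<Longrightarrow> 0 \<le> Re (ip u u)"
    and ip_definite: "u \<in> H \<Longrightarrow> ip u u = 0 \<Longrightarrow> u = 0"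
    and complete: "(\<And>n. s n \<in> H) \<Longrightarrow>
      (\<And>e. e > 0 \<Longrightarrow> \<exists>N. \<forall>m\<ge>N. \<forall>n\<ge>N. ip_norm ip (s m - s n) < e) \<Longrightarrow>
      \<exists>l\<in>H. (\<lambda>n. ip_norm ip (s n - l)) \<longlonglongrightarrow> 0"

text \<open>
  Operators are functions on the ambient type of which only the restriction to \<open>H\<close> is meaningful.
\<close>

definition bounded_ops ::
    "'v::complex_vector set \<Rightarrow> ('v \<Rightarrow> 'v \<Rightarrow> complex) \<Rightarrow> ('v \<Rightarrow> 'v) set" where
  "bounded_ops H ip = {T.
     (\<forall>u\<in>H. T u \<in> H) \<and>
     (\<forall>u\<in>H. \<forall>v\<in>H. T (u + v) = T u + T v) \<and>
     (\<forall>c. \<forall>u\<in>H. T (c *\<^sub>C u) = c *\<^sub>C T u) \<and>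
     (\<exists>C. \<forall>u\<in>H. ip_norm ip (T u) \<le> C * ip_norm ip u)}"

text \<open>
  The predual of \<open>B(H)\<close> is the trace class; its elements act on \<open>B(H)\<close> as the functionals
  \<open>T \<mapsto> \<Sum>k. \<langle>T u\<^sub>k, v\<^sub>k\<rangle>\<close> with square summable sequences \<open>u\<close>, \<open>v\<close> in \<open>H\<close>.
\<close>

definition normal_functionals ::
    "'v::complex_vector set \<Rightarrow> ('v \<Rightarrow> 'v \<Rightarrow> complex) \<Rightarrow> (('v \<Rightarrow> 'v) \<Rightarrow> complex) set" where
  "normal_functionals H ip = {\<lambda>T. \<Sum>k. ip (T (u k)) (v k) | u v.
     (\<forall>k::nat. u k \<in> H \<and> v k \<in> H) \<and>
     summable (\<lambda>k. (ip_norm ip (u k))\<^sup>2) \<and> summable (\<lambda>k. (ip_norm ip (v k))\<^sup>2)}"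

definition weakstar_topology ::
    "'v::complex_vector set \<Rightarrow> ('v \<Rightarrow> 'v \<Rightarrow> complex) \<Rightarrow> ('v \<Rightarrow> 'v) topology" where
  "weakstar_topology H ip = topology_generated_by
     {{T \<in> bounded_ops H ip. \<phi> T \<in> U} | \<phi> U. \<phi> \<in> normal_functionals H ip \<and> open U}"

section \<open>Multiplier algebras of reproducing kernel Hilbert spaces\<close>

definition positive_definite_kernel ::
    "'v::complex_vector set \<Rightarrow> ('v \<Rightarrow> 'v \<Rightarrow> complex) \<Rightarrow> ('x \<Rightarrow> 'x \<Rightarrow> 'v \<Rightarrow> 'v) \<Rightarrow> bool" where
  "positive_definite_kernel C ipC K \<longleftrightarrow>
     (\<forall>x y. K x y \<in> bounded_ops C ipC) \<and>
     (\<forall>(n::nat) x v. (\<forall>i<n. v i \<in> C) \<longrightarrow>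
        (\<Sum>i<n. \<Sum>j<n. ipC (K (x i) (x j) (v j)) (v i)) \<in> \<real> \<and>
        0 \<le> Re (\<Sum>i<n. \<Sum>j<n. ipC (K (x i) (x j) (v j)) (v i)))"

definition rkhs ::
    "'v::complex_vector set \<Rightarrow> ('v \<Rightarrow> 'v \<Rightarrow> complex) \<Rightarrow> ('x \<Rightarrow> 'x \<Rightarrow> 'v \<Rightarrow> 'v) \<Rightarrow>
     ('x \<Rightarrow> 'v) set \<Rightarrow> (('x \<Rightarrow> 'v) \<Rightarrow> ('x \<Rightarrow> 'v) \<Rightarrow> complex) \<Rightarrow> bool" where
  "rkhs C ipC K L ipL \<longleftrightarrow>
     hilbert L ipL \<and>
     (\<forall>g\<in>L. \<forall>x. g x \<in> C) \<and>
     (\<forall>y. \<forall>v\<in>C. (\<lambda>x. K x y v) \<in> L \<and> (\<forall>g\<in>L. ipL g (\<lambda>x. K x y v) = ipC (g y) v))"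

definition mult_op :: "('x \<Rightarrow> complex) \<Rightarrow> ('x \<Rightarrow> 'v::complex_vector) \<Rightarrow> 'x \<Rightarrow> 'v" where
  "mult_op f g = (\<lambda>x. f x *\<^sub>C g x)"

definition multipliers ::
    "('x \<Rightarrow> 'v::complex_vector) set \<Rightarrow> (('x \<Rightarrow> 'v) \<Rightarrow> ('x \<Rightarrow> 'v) \<Rightarrow> complex) \<Rightarrow>
     ('x \<Rightarrow> complex) set" where
  "multipliers L ipL = {f. mult_op f \<in> bounded_ops L ipL}"

text \<open>The norm of the operator matrix \<open>(mult_op (G\<^sub>i\<^sub>j))\<close> on the \<open>n\<close>-fold Hilbert space direct sum of \<open>L\<close>.\<close>

definition multiplier_norm ::
    "('x \<Rightarrow> 'v::complex_vector) set \<Rightarrow> (('x \<Rightarrow> 'v) \<Rightarrow> ('x \<Rightarrow> 'v) \<Rightarrow> complex) \<Rightarrow>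
     ('x \<Rightarrow> complex) mat \<Rightarrow> real" where
  "multiplier_norm L ipL G = Sup
     {L2_set (\<lambda>i. ip_norm ipL (\<Sum>j<dim_col G. mult_op (G $$ (i, j)) (g j))) {..<dim_row G} | g.
        (\<forall>j<dim_col G. g j \<in> L) \<and> L2_set (\<lambda>j. ip_norm ipL (g j)) {..<dim_col G} \<le> 1}"

text \<open>
  \<open>A = M(K)\<close> completely isometrically, \<open>K\<close> being a positive definite \<open>B(C)\<close>-valued
  function with reproducing kernel Hilbert space \<open>L\<close>.
\<close>

definition represented_by_kernel ::
    "('x \<Rightarrow> complex) set \<Rightarrow> (('x \<Rightarrow> complex) mat \<Rightarrow> real) \<Rightarrow>
     'v::complex_vector set \<Rightarrow> ('v \<Rightarrow> 'v \<Rightarrow> complex) \<Rightarrow> ('x \<Rightarrow> 'x \<Rightarrow> 'v \<Rightarrow> 'v) \<Rightarrow>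
     ('x \<Rightarrow> 'v) set \<Rightarrow> (('x \<Rightarrow> 'v) \<Rightarrow> ('x \<Rightarrow> 'v) \<Rightarrow> complex) \<Rightarrow> bool" where
  "represented_by_kernel A nrm C ipC K L ipL \<longleftrightarrow>
     hilbert C ipC \<and> positive_definite_kernel C ipC K \<and> rkhs C ipC K L ipL \<and>
     A = multipliers L ipL \<and>
     (\<forall>n>0. \<forall>G\<in>Mat A n. nrm G = multiplier_norm L ipL G)"

definition inherited_weakstar ::
    "('x \<Rightarrow> complex) set \<Rightarrow> ('x \<Rightarrow> 'v::complex_vector) set \<Rightarrow>
     (('x \<Rightarrow> 'v) \<Rightarrow> ('x \<Rightarrow> 'v) \<Rightarrow> complex) \<Rightarrow> ('x \<Rightarrow> complex) topology" where
  "inherited_weakstar A L ipL = pullback_topology A mult_op (weakstar_topology L ipL)"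

section \<open>Weak*-residual finite dimensionality\<close>

definition algebra_hom :: "('x \<Rightarrow> complex) set \<Rightarrow> nat \<Rightarrow> (('x \<Rightarrow> complex) \<Rightarrow> complex mat) \<Rightarrow> bool" where
  "algebra_hom A k \<pi> \<longleftrightarrow>
     (\<forall>f\<in>A. \<pi> f \<in> carrier_mat k k) \<and>
     (\<forall>f\<in>A. \<forall>g\<in>A. \<pi> (f + g) = \<pi> f + \<pi> g \<and> \<pi> (f * g) = \<pi> f * \<pi> g) \<and>
     (\<forall>c. \<forall>f\<in>A. \<pi> ((\<lambda>_. c) * f) = c \<cdot>\<^sub>m \<pi> f)"

text \<open>\<open>(\<pi>(G\<^sub>i\<^sub>j))\<close>, an element of \<open>M_n(M_k)\<close>, as a complex \<open>n k \<times> n k\<close> matrix.\<close>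

definition amplification ::
    "nat \<Rightarrow> ('b \<Rightarrow> complex mat) \<Rightarrow> 'b mat \<Rightarrow> complex mat" where
  "amplification k \<pi> G = mat (dim_row G * k) (dim_col G * k)
     (\<lambda>(i, j). \<pi> (G $$ (i div k, j div k)) $$ (i mod k, j mod k))"

definition completely_contractive ::
    "('x \<Rightarrow> complex) set \<Rightarrow> (('x \<Rightarrow> complex) mat \<Rightarrow> real) \<Rightarrow> nat \<Rightarrow>
     (('x \<Rightarrow> complex) \<Rightarrow> complex mat) \<Rightarrow> bool" where
  "completely_contractive A nrm k \<pi> \<longleftrightarrow>
     (\<forall>n>0. \<forall>G\<in>Mat A n. op_norm (amplification k \<pi> G) \<le> nrm G)"

text \<open>Continuity into \<open>M_k\<close>, a finite dimensional space, is continuity of all matrix entries.\<close>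

definition weakstar_continuous ::
    "('x \<Rightarrow> complex) topology \<Rightarrow> nat \<Rightarrow> (('x \<Rightarrow> complex) \<Rightarrow> complex mat) \<Rightarrow> bool" where
  "weakstar_continuous \<tau> k \<pi> \<longleftrightarrow>
     (\<forall>i<k. \<forall>j<k. continuous_map \<tau> euclidean (\<lambda>f. \<pi> f $$ (i, j)))"

definition weakstar_RFD ::
    "('x \<Rightarrow> complex) set \<Rightarrow> (('x \<Rightarrow> complex) mat \<Rightarrow> real) \<Rightarrow> ('x \<Rightarrow> complex) topology \<Rightarrow> bool" where
  "weakstar_RFD A nrm \<tau> \<longleftrightarrow>
     (\<forall>n>0. \<forall>G\<in>Mat A n.
        nrm G = Sup {op_norm (amplification k \<pi> G) | k \<pi>.
          k > 0 \<and> algebra_hom A k \<pi> \<and> completely_contractive A nrm k \<pi> \<and>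
          weakstar_continuous \<tau> k \<pi>})"

text \<open>
  An index type \<open>I\<close> large enough that, for every algebra of functions on \<open>'x\<close>, a Hilbert space
  \<open>C\<close> carrying a representing kernel exists inside \<open>I \<Rightarrow> complex\<close>: a direct sum of
  finite dimensional spaces indexed by pairs of a size \<open>k\<close> and a \<open>k \<times> k\<close> matrix of functions on
  \<open>'x\<close>, the last component being the coordinate. It is needed because HOL cannot quantify
  existentially over types.
\<close>

type_synonym 'x kernel_index = "nat \<times> (nat \<Rightarrow> nat \<Rightarrow> 'x \<Rightarrow> complex) \<times> nat"

end

theory Submission
  imports Defs
begin

text \<open>
  For finite \<open>F\<close> the quotient \<open>A / I_F\<close> is represented without recourse to the
  Blecher--Ruan--Sinclair theorem. A Hilbert module generated by \<open>n\<close> vectors is a positive form \<open>Q\<close>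
  on the row vectors \<open>(A / I_F)\<^sup>n\<close>, and complete contractivity says that \<open>Q\<close> is nonnegative on a cone of
  tensors. By a separation argument a form with \<open>r\<^sup>2 \<Sum> Q(e\<^sub>j) \<le> \<Sum> Q(G e\<^sub>j)\<close> exists unless
  \<open>r\<^sup>2 \<Sum> e\<^sub>j \<otimes> e\<^sub>j - \<Sum> G e\<^sub>j \<otimes> G e\<^sub>j\<close> lies in the cone. In that case the column \<open>G\<close> can be replaced by
  the column \<open>r 1\<close>, without decreasing norms, in the presence of a fixed column \<open>b\<close>; using \<open>N\<close> copies,
  \<open>N \<parallel>G\<parallel>\<^sup>2 \<le> N r\<^sup>2 + \<parallel>b\<parallel>\<^sup>2\<close>, so \<open>\<parallel>G\<parallel> \<le> r\<close>.

  Evaluations are completely contractive, so \<open>Q\<close> may be taken to dominate the standard inner product on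
  \<open>F\<close>. The module then is a space of functions on \<open>F\<close>, and the Hilbert sum of such modules is a
  reproducing kernel Hilbert space whose multipliers are, by locality and BPW completeness, the elements
  of \<open>A\<close>, isometrically. The modules themselves yield finite-dimensional representations whose matrix
  entries are linear combinations of evaluations at points of \<open>F\<close>, and evaluations are weak*-continuous
  in every kernel representation.
\<close>

section \<open>Positive semidefinite forms\<close>

text \<open>A column enters only through its Gram matrix, the sum of the x \<otimes> x over its
  rows: columns with equal Gram matrices are carried to each other by contractive scalar matrices on
  the left, so their norms agree. Hence the wanted form can be sought as a functional on Hermitian
  matrices, and the module condition becomes positivity on a cone, where separation over the reals
  applies. A member of that cone is a difference of two tensors, and common terms cannot be
  cancelled from columns under a norm; this is the origin of the extra column b.

  Separation yields a form that is only semidefinite. The gap between r and the norm of G pays for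
  adding the standard inner product to a large multiple of it.

  All modules have to live over one fixed index type, so the Hilbert sum runs over codes of a size,
  an accuracy, a matrix and a finite set. The finite-dimensional representations use a single module
  each and know nothing of the sum; therefore the weak*-RFD property can be proved for every
  representing kernel and not only for the constructed one.\<close>

lemma scaleC_zero_left [simp]: "0 *\<^sub>C v = (0 :: 'v::complex_vector)"
  by (metis add.right_neutral add_cancel_right_right scaleC_add_left)

lemma scaleC_zero_right [simp]: "c *\<^sub>C (0 :: 'v::complex_vector) = 0"
  by (metis add.right_neutral add_cancel_right_right scaleC_add_right)

lemma scaleC_minus_one: "(-1) *\<^sub>C v = - (v :: 'v::complex_vector)"
  by (metis add_eq_0_iff scaleC_add_left scaleC_one scaleC_zero_left add.right_inverse)

lemma scaleC_minus_left: "(- c) *\<^sub>C v = - (c *\<^sub>C (v :: 'v::complex_vector))"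
  by (metis mult_minus1 scaleC_minus_one scaleC_scaleC)

lemma scaleC_minus_right: "c *\<^sub>C (- v) = - (c *\<^sub>C (v :: 'v::complex_vector))"
  by (metis mult_minus1_right scaleC_minus_left scaleC_minus_one scaleC_scaleC)

lemma scaleC_diff_right: "c *\<^sub>C (u - v) = c *\<^sub>C u - c *\<^sub>C (v :: 'v::complex_vector)"
  by (metis add_uminus_conv_diff scaleC_add_right scaleC_minus_right)

lemma scaleC_diff_left: "(a - b) *\<^sub>C v = a *\<^sub>C v - b *\<^sub>C (v :: 'v::complex_vector)"
  by (metis add_uminus_conv_diff scaleC_add_left scaleC_minus_left)

lemma scaleC_sum_right: "c *\<^sub>C (\<Sum>i\<in>I. f i) = (\<Sum>i\<in>I. c *\<^sub>C (f i :: 'v::complex_vector))"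
  by (induction I rule: infinite_finite_induct) (simp_all add: scaleC_add_right)

lemma scaleC_apply: "(c *\<^sub>C f) x = c *\<^sub>C f x"
  by (simp add: scaleC_fun_def)

lemma scaleC_complex [simp]: "c *\<^sub>C z = c * (z :: complex)"
  by (simp add: scaleC_complex_def)

lemma sum_fun_apply: "(\<Sum>i\<in>I. f i) x = (\<Sum>i\<in>I. f i x)"
  for f :: "'i \<Rightarrow> 'x \<Rightarrow> 'v::comm_monoid_add"
  by (induction I rule: infinite_finite_induct) simp_all

text \<open>Definiteness and completeness are left out because the forms produced by separation have
  neither; the locale \<open>hilbert\<close> inherits all that is proved here.\<close>

locale psd_form =
  fixes H :: "'v::complex_vector set" and ip :: "'v \<Rightarrow> 'v \<Rightarrow> complex"
  assumes zero_mem: "0 \<in> H"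
    and add_mem: "u \<in> H \<Longrightarrow> v \<in> H \<Longrightarrow> u + v \<in> H"
    and scaleC_mem: "u \<in> H \<Longrightarrow> c *\<^sub>C u \<in> H"
    and ip_add_left: "u \<in> H \<Longrightarrow> v \<in> H \<Longrightarrow> w \<in> H \<Longrightarrow> ip (u + v) w = ip u w + ip v w"
    and ip_scaleC_left: "u \<in> H \<Longrightarrow> v \<in> H \<Longrightarrow> ip (c *\<^sub>C u) v = c * ip u v"
    and ip_commute: "u \<in> H \<Longrightarrow> v \<in> H \<Longrightarrow> ip v u = cnj (ip u v)"
    and ip_ge_zero: "u \<in> H \<Longrightarrow> 0 \<le> Re (ip u u)"
begin

lemma uminus_mem: "u \<in> H \<Longrightarrow> - u \<in> H"
  by (metis scaleC_mem scaleC_minus_one)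

lemma diff_mem: "u \<in> H \<Longrightarrow> v \<in> H \<Longrightarrow> u - v \<in> H"
  by (metis add_mem uminus_mem add_uminus_conv_diff)

lemma sum_mem: "(\<And>i. i \<in> I \<Longrightarrow> f i \<in> H) \<Longrightarrow> (\<Sum>i\<in>I. f i) \<in> H"
  by (induction I rule: infinite_finite_induct) (simp_all add: zero_mem add_mem)

lemma ip_add_right: "u \<in> H \<Longrightarrow> v \<in> H \<Longrightarrow> w \<in> H \<Longrightarrow> ip w (u + v) = ip w u + ip w v"
  using ip_commute[of "u + v" w] ip_commute[of u w] ip_commute[of v w] ip_add_left add_mem
  by simp

lemma ip_scaleC_right: "u \<in> H \<Longrightarrow> v \<in> H \<Longrightarrow> ip v (c *\<^sub>C u) = cnj c * ip v u"
  using ip_commute[of "c *\<^sub>C u" v] ip_commute[of u v] ip_scaleC_left scaleC_mem by simp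

lemma ip_zero_left: "v \<in> H \<Longrightarrow> ip 0 v = 0"
  using ip_scaleC_left[of 0 v 0] zero_mem by simp

lemma ip_zero_right: "v \<in> H \<Longrightarrow> ip v 0 = 0"
  using ip_scaleC_right[of 0 v 0] zero_mem by simp

lemma ip_minus_left: "u \<in> H \<Longrightarrow> v \<in> H \<Longrightarrow> ip (- u) v = - ip u v"
  using ip_scaleC_left[of u v "-1"] by (simp add: scaleC_minus_one)

lemma ip_minus_right: "u \<in> H \<Longrightarrow> v \<in> H \<Longrightarrow> ip v (- u) = - ip v u"
  using ip_scaleC_right[of u v "-1"] by (simp add: scaleC_minus_one)

lemma ip_diff_left: "u \<in> H \<Longrightarrow> v \<in> H \<Longrightarrow> w \<in> H \<Longrightarrow> ip (u - v) w = ip u w - ip v w"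
  using ip_add_left[of u "- v" w] ip_minus_left uminus_mem by simp

lemma ip_diff_right: "u \<in> H \<Longrightarrow> v \<in> H \<Longrightarrow> w \<in> H \<Longrightarrow> ip w (u - v) = ip w u - ip w v"
  using ip_add_right[of u "- v" w] ip_minus_right uminus_mem by simp

lemma ip_sum_left:
  "(\<And>i. i \<in> I \<Longrightarrow> f i \<in> H) \<Longrightarrow> w \<in> H \<Longrightarrow> ip (\<Sum>i\<in>I. f i) w = (\<Sum>i\<in>I. ip (f i) w)"
  by (induction I rule: infinite_finite_induct) (simp_all add: ip_zero_left ip_add_left sum_mem)

lemma ip_sum_right:
  "(\<And>i. i \<in> I \<Longrightarrow> f i \<in> H) \<Longrightarrow> w \<in> H \<Longrightarrow> ip w (\<Sum>i\<in>I. f i) = (\<Sum>i\<in>I. ip w (f i))"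
  by (induction I rule: infinite_finite_induct) (simp_all add: ip_zero_right ip_add_right sum_mem)

lemma ip_self: "u \<in> H \<Longrightarrow> ip u u = complex_of_real (Re (ip u u))"
  using ip_commute[of u u] by (simp add: complex_eq_iff)

lemma ip_norm_sq: "u \<in> H \<Longrightarrow> (ip_norm ip u)\<^sup>2 = Re (ip u u)"
  by (simp add: ip_norm_def ip_ge_zero)

lemma ip_norm_nonneg: "u \<in> H \<Longrightarrow> 0 \<le> ip_norm ip u"
  by (simp add: ip_norm_def ip_ge_zero)

lemma Re_ip_scaleC: "u \<in> H \<Longrightarrow> Re (ip (c *\<^sub>C u) (c *\<^sub>C u)) = (cmod c)\<^sup>2 * Re (ip u u)"
proof -
  assume u: "u \<in> H"
  have "ip (c *\<^sub>C u) (c *\<^sub>C u) = (c * cnj c) * ip u u"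
    using u by (simp add: ip_scaleC_left ip_scaleC_right scaleC_mem)
  also have "c * cnj c = complex_of_real ((cmod c)\<^sup>2)"
    by (metis complex_norm_square)
  finally show ?thesis
    by simp
qed

lemma ip_norm_scaleC: "u \<in> H \<Longrightarrow> ip_norm ip (c *\<^sub>C u) = cmod c * ip_norm ip u"
  by (simp add: ip_norm_def Re_ip_scaleC real_sqrt_mult)

lemma ip_norm_zero: "ip_norm ip 0 = 0"
  by (simp add: ip_norm_def ip_zero_left zero_mem)

lemma ip_norm_minus_commute: "u \<in> H \<Longrightarrow> v \<in> H \<Longrightarrow> ip_norm ip (u - v) = ip_norm ip (v - u)"
  using ip_norm_scaleC[of "u - v" "-1"] by (simp add: scaleC_minus_one diff_mem)

lemma Re_ip_add:
  "u \<in> H \<Longrightarrow> v \<in> H \<Longrightarrow> Re (ip (u + v) (u + v)) = Re (ip u u) + 2 * Re (ip u v) + Re (ip v v)"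
  using ip_commute[of u v] by (simp add: ip_add_left ip_add_right add_mem)

lemma Re_ip_diff:
  "u \<in> H \<Longrightarrow> v \<in> H \<Longrightarrow> Re (ip (u - v) (u - v)) = Re (ip u u) - 2 * Re (ip u v) + Re (ip v v)"
  using ip_commute[of u v] by (simp add: ip_diff_left ip_diff_right diff_mem)

lemma parallelogram:
  "u \<in> H \<Longrightarrow> v \<in> H \<Longrightarrow>
    Re (ip (u + v) (u + v)) + Re (ip (u - v) (u - v)) = 2 * Re (ip u u) + 2 * Re (ip v v)"
  by (simp add: Re_ip_add Re_ip_diff)

lemma cauchy_schwarz_sq:
  assumes u: "u \<in> H" and v: "v \<in> H"
  shows "(cmod (ip u v))\<^sup>2 \<le> Re (ip u u) * Re (ip v v)"
proof -
  define a b m where "a = Re (ip u u)" and "b = Re (ip v v)" and "m = (cmod (ip u v))\<^sup>2"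
  have ineq: "0 \<le> a - 2 * t * m + t\<^sup>2 * m * b" for t :: real
  proof -
    \<comment> \<open>The phase of \<open>ip u v\<close> is put into the scalar, so that one real
      variable t suffices.\<close>
    define c where "c = complex_of_real t * ip u v"
    have "Re (ip u (c *\<^sub>C v)) = Re (cnj c * ip u v)"
      using u v by (simp add: ip_scaleC_right)
    also have "cnj c * ip u v = of_real (t * m)"
      by (simp only: c_def m_def complex_norm_square of_real_mult complex_cnj_mult
          complex_cnj_complex_of_real mult.assoc mult.commute mult.left_commute)
    finally have 1: "Re (ip u (c *\<^sub>C v)) = t * m"
      by simp
    have "Re (ip (c *\<^sub>C v) (c *\<^sub>C v)) = t\<^sup>2 * m * b"
      using v by (simp add: Re_ip_scaleC c_def norm_mult power_mult_distrib m_def b_def)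
    moreover have "0 \<le> Re (ip (u - c *\<^sub>C v) (u - c *\<^sub>C v))"
      using u v by (simp add: ip_ge_zero diff_mem scaleC_mem)
    ultimately show ?thesis
      using u v 1 by (simp add: Re_ip_diff scaleC_mem a_def)
  qed
  have ab: "a \<ge> 0" "b \<ge> 0" "m \<ge> 0"
    using u v by (auto simp: a_def b_def m_def ip_ge_zero)
  have "m \<le> a * b"
  proof (cases "b = 0")
    case True
    show ?thesis
    proof (cases "m = 0")
      case False
      then show ?thesis
        \<comment> \<open>For b = 0 the inequality is linear in t, and at this t it reads 0 <=
          -1.\<close>
        using ineq[of "(a + 1) / (2 * m)"] True ab by simp
    qed (use True in simp)
  next
    case False
    then have "b > 0"
      using ab by simp
    then show ?thesis
      using ineq[of "1 / b"] by (simp add: field_simps power2_eq_square)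
  qed
  then show ?thesis
    by (simp add: a_def b_def m_def)
qed

lemma cauchy_schwarz:
  assumes "u \<in> H" and "v \<in> H"
  shows "cmod (ip u v) \<le> ip_norm ip u * ip_norm ip v"
proof (rule power2_le_imp_le)
  show "(cmod (ip u v))\<^sup>2 \<le> (ip_norm ip u * ip_norm ip v)\<^sup>2"
    using assms cauchy_schwarz_sq[of u v] by (simp add: power_mult_distrib ip_norm_sq)
qed (simp add: assms ip_norm_nonneg)

lemma ip_null_left: "u \<in> H \<Longrightarrow> v \<in> H \<Longrightarrow> Re (ip u u) = 0 \<Longrightarrow> ip u v = 0"
  using cauchy_schwarz_sq[of u v] by simp

lemma ip_norm_triangle: "u \<in> H \<Longrightarrow> v \<in> H \<Longrightarrow> ip_norm ip (u + v) \<le> ip_norm ip u + ip_norm ip v"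
proof -
  assume uv: "u \<in> H" "v \<in> H"
  have "Re (ip u v) \<le> ip_norm ip u * ip_norm ip v"
    using cauchy_schwarz[OF uv] complex_Re_le_cmod order_trans by blast
  then have "(ip_norm ip (u + v))\<^sup>2 \<le> (ip_norm ip u + ip_norm ip v)\<^sup>2"
    using uv by (simp add: ip_norm_sq add_mem Re_ip_add power2_sum)
  then show ?thesis
    by (rule power2_le_imp_le) (simp add: uv ip_norm_nonneg)
qed

lemma ip_norm_triangle_diff:
  "u \<in> H \<Longrightarrow> v \<in> H \<Longrightarrow> \<bar>ip_norm ip u - ip_norm ip v\<bar> \<le> ip_norm ip (u - v)"
  using ip_norm_triangle[of "u - v" v] ip_norm_triangle[of "v - u" u] ip_norm_minus_commute[of u v]
  by (simp add: diff_mem)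

definition orthonormal :: "nat \<Rightarrow> (nat \<Rightarrow> 'v) \<Rightarrow> bool" where
  "orthonormal k u \<longleftrightarrow> (\<forall>a<k. u a \<in> H) \<and> (\<forall>a<k. \<forall>b<k. ip (u a) (u b) = (if a = b then 1 else 0))"

lemma ip_orthonormal_expansion:
  assumes "orthonormal k u" and "b < k"
  shows "ip (\<Sum>a<k. c a *\<^sub>C u a) (u b) = c b"
proof -
  have "ip (\<Sum>a<k. c a *\<^sub>C u a) (u b) = (\<Sum>a<k. c a * ip (u a) (u b))"
    using assms by (subst ip_sum_left) (auto simp: orthonormal_def scaleC_mem ip_scaleC_left)
  also have "\<dots> = (\<Sum>a<k. if a = b then c a else 0)"
    using assms by (intro sum.cong) (auto simp: orthonormal_def)
  finally show ?thesis
    using assms by simp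
qed

lemma Re_ip_orthonormal_expansion:
  assumes "orthonormal k u"
  shows "Re (ip (\<Sum>a<k. c a *\<^sub>C u a) (\<Sum>a<k. c a *\<^sub>C u a)) = (\<Sum>a<k. (cmod (c a))\<^sup>2)"
proof -
  define w where "w = (\<Sum>a<k. c a *\<^sub>C u a)"
  have w: "w \<in> H"
    unfolding w_def using assms by (intro sum_mem) (auto simp: orthonormal_def scaleC_mem)
  have "ip w w = (\<Sum>a<k. ip w (c a *\<^sub>C u a))"
    using assms w by (subst (2) w_def, subst ip_sum_right) (auto simp: orthonormal_def scaleC_mem)
  also have "\<dots> = (\<Sum>a<k. cnj (c a) * c a)"
    using assms w ip_orthonormal_expansion[OF assms, of _ c]
    by (intro sum.cong) (auto simp: orthonormal_def ip_scaleC_right w_def)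
  also have "\<dots> = (\<Sum>a<k. complex_of_real ((cmod (c a))\<^sup>2))"
    by (intro sum.cong) (simp_all only: complex_norm_square mult.commute)
  finally show ?thesis
    by (simp add: w_def)
qed

lemma bessel:
  assumes u: "orthonormal k u" and w: "w \<in> H"
  shows "(\<Sum>a<k. (cmod (ip w (u a)))\<^sup>2) \<le> Re (ip w w)"
proof -
  define p where "p = (\<Sum>a<k. ip w (u a) *\<^sub>C u a)"
  have p: "p \<in> H"
    unfolding p_def using u by (intro sum_mem) (auto simp: orthonormal_def scaleC_mem)
  have "ip w p = (\<Sum>a<k. ip w (ip w (u a) *\<^sub>C u a))"
    unfolding p_def using u w by (subst ip_sum_right) (auto simp: orthonormal_def scaleC_mem)
  also have "\<dots> = (\<Sum>a<k. complex_of_real ((cmod (ip w (u a)))\<^sup>2))"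
    using u w by (intro sum.cong) (simp_all only: complex_norm_square mult.commute ip_scaleC_right
        orthonormal_def lessThan_iff)
  finally have "Re (ip w p) = (\<Sum>a<k. (cmod (ip w (u a)))\<^sup>2)"
    by simp
  moreover have "Re (ip p p) = (\<Sum>a<k. (cmod (ip w (u a)))\<^sup>2)"
    unfolding p_def by (rule Re_ip_orthonormal_expansion[OF u])
  moreover have "0 \<le> Re (ip (w - p) (w - p))"
    using w p by (simp add: ip_ge_zero diff_mem)
  ultimately show ?thesis
    using w p by (simp add: Re_ip_diff)
qed

text \<open>Vectors whose residual has length zero contribute no new basis vector. The form may be
  degenerate, so such a residual need not vanish, and the conclusion speaks of its length
  only.\<close>

lemma gram_schmidt:
  assumes "finite E" and "E \<subseteq> H"
  shows "\<exists>k u. orthonormal k u \<and>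
    (\<forall>e\<in>E. Re (ip (e - (\<Sum>a<k. ip e (u a) *\<^sub>C u a)) (e - (\<Sum>a<k. ip e (u a) *\<^sub>C u a))) = 0)"
  using assms
proof (induction E rule: finite_induct)
  case empty
  show ?case
    by (rule exI[of _ 0]) (simp add: orthonormal_def)
next
  case (insert e E)
  then obtain k u where u: "orthonormal k u"
    and E: "\<And>x. x \<in> E \<Longrightarrow>
      Re (ip (x - (\<Sum>a<k. ip x (u a) *\<^sub>C u a)) (x - (\<Sum>a<k. ip x (u a) *\<^sub>C u a))) = 0"
    by auto
  have uH: "u a \<in> H" if "a < k" for a
    using u that by (simp add: orthonormal_def)
  define res where "res x = x - (\<Sum>a<k. ip x (u a) *\<^sub>C u a)" for x
  have pH: "(\<Sum>a<k. ip x (u a) *\<^sub>C u a) \<in> H" for x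
    by (intro sum_mem) (simp add: uH scaleC_mem)
  have resH: "res x \<in> H" if "x \<in> H" for x
    using that pH by (simp add: res_def diff_mem)
  have res_orth: "ip (res x) (u b) = 0" if "x \<in> H" "b < k" for x b
    using ip_orthonormal_expansion[OF u that(2)] that pH by (simp add: res_def ip_diff_left uH)
  have eH: "e \<in> H"
    using insert by simp
  show ?case
  proof (cases "Re (ip (res e) (res e)) = 0")
    case True
    then show ?thesis
      using u E by (intro exI[of _ k] exI[of _ u]) (auto simp: res_def)
  next
    case False
    define N where "N = Re (ip (res e) (res e))"
    have N: "N > 0"
      using False ip_ge_zero[OF resH[OF eH]] by (simp add: N_def)
    define v where "v = complex_of_real (1 / sqrt N) *\<^sub>C res e"
    define u' where "u' = u(k := v)"
    have vH: "v \<in> H"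
      by (simp add: v_def scaleC_mem resH eH)
    have vv: "ip v v = 1"
    proof -
      have "ip v v = complex_of_real (Re (ip v v))"
        by (rule ip_self[OF vH])
      also have "Re (ip v v) = 1"
        using N by (simp add: v_def Re_ip_scaleC resH eH norm_divide power_divide flip: N_def)
      finally show ?thesis by simp
    qed
    have vu: "ip v (u b) = 0" if "b < k" for b
      using that by (simp add: v_def ip_scaleC_left resH eH uH res_orth)
    have uv: "ip (u b) v = 0" if "b < k" for b
      using ip_commute[OF vH uH[OF that]] vu[OF that] by simp
    have u': "orthonormal (Suc k) u'"
      using u vv vu uv vH by (auto simp: orthonormal_def u'_def less_Suc_eq)
    have new: "x - (\<Sum>a<Suc k. ip x (u' a) *\<^sub>C u' a) = res x - ip x v *\<^sub>C v" for x
      by (simp add: u'_def res_def algebra_simps)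
    \<comment> \<open>As v is orthogonal to the old basis, only the residual of x meets v. For x in
      E that residual is null, so by Cauchy-Schwarz \<open>ip x v\<close> is 0 and nothing changes
      for x.\<close>
    have ipv: "ip x v = ip (res x) v" if "x \<in> H" for x
    proof -
      have "ip (\<Sum>a<k. ip x (u a) *\<^sub>C u a) v = 0"
        by (subst ip_sum_left) (auto simp: uH scaleC_mem vH ip_scaleC_left uv)
      then show ?thesis
        using that pH vH by (simp add: res_def ip_diff_left)
    qed
    have "Re (ip (res x - ip x v *\<^sub>C v) (res x - ip x v *\<^sub>C v)) = 0" if "x \<in> insert e E" for x
    proof (cases "x = e")
      case True
      have "ip e v = complex_of_real (sqrt N)"
      proof -
        have "ip e v = complex_of_real (1 / sqrt N) * ip (res e) (res e)"
          by (simp add: ipv eH) (simp add: v_def ip_scaleC_right resH eH)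
        also have "ip (res e) (res e) = complex_of_real N"
          unfolding N_def by (rule ip_self[OF resH[OF eH]])
        also have "complex_of_real (1 / sqrt N) * complex_of_real N = complex_of_real (sqrt N)"
          using N by (simp add: real_div_sqrt flip: of_real_mult of_real_divide)
        finally show ?thesis .
      qed
      then have "res e - ip e v *\<^sub>C v = 0"
        using N by (simp add: v_def scaleC_scaleC scaleC_one flip: of_real_mult)
      then show ?thesis
        using True by (simp add: ip_zero_left zero_mem)
    next
      case False
      then have "x \<in> E" "x \<in> H"
        using that insert by auto
      then have "Re (ip (res x) (res x)) = 0" "ip x v = 0"
        using E ip_null_left[OF resH vH] by (auto simp: ipv res_def)
      then show ?thesis by simp
    qed
    then show ?thesis
      using u' by (intro exI[of _ "Suc k"] exI[of _ u']) (simp only: new, blast)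
  qed
qed

end

sublocale hilbert \<subseteq> psd_form
  by standard (fact zero_mem add_mem scaleC_mem ip_add_left ip_scaleC_left ip_commute ip_ge_zero)+

section \<open>Forms on a whole space and factorization of Gram matrices\<close>

lemma psd_form_UNIV_I:
  assumes "\<And>u v w. ip (u + v) w = ip u w + ip v w"
    and "\<And>c u v. ip (c *\<^sub>C u) v = c * ip u v"
    and "\<And>u v. ip v u = cnj (ip u v)"
    and "\<And>u. 0 \<le> Re (ip u u)"
  shows "psd_form UNIV ip"
  by unfold_locales (simp_all add: assms(1,2,4), rule assms(3))

lemma psd_form_standard: "psd_form UNIV (\<lambda>v w :: 'z \<Rightarrow> complex. \<Sum>z\<in>Z. v z * cnj (w z))"
proof (rule psd_form_UNIV_I)
  fix v :: "'z \<Rightarrow> complex"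
  show "0 \<le> Re (\<Sum>z\<in>Z. v z * cnj (v z))"
    by (simp add: sum_nonneg)
qed (simp_all add: scaleC_fun_def sum.distrib sum_distrib_left algebra_simps)

lemma psd_form_pullback:
  fixes ip :: "'v::complex_vector \<Rightarrow> 'v \<Rightarrow> complex" and L :: "'w::complex_vector \<Rightarrow> 'v"
  assumes "psd_form UNIV ip" and "\<And>u v. L (u + v) = L u + L v"
    and "\<And>c v. L (c *\<^sub>C v) = c *\<^sub>C L v"
  shows "psd_form UNIV (\<lambda>s t. ip (L s) (L t))"
proof -
  interpret psd_form UNIV ip by fact
  show ?thesis
    by (rule psd_form_UNIV_I)
      (simp_all add: assms(2,3) ip_add_left ip_scaleC_left ip_ge_zero, rule ip_commute, simp_all)
qed

text \<open>Operator norm at most 1, without a supremum. Entries outside the m x n rectangle do not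
  matter, which makes padding easy.\<close>

definition contractive :: "nat \<Rightarrow> nat \<Rightarrow> (nat \<Rightarrow> nat \<Rightarrow> complex) \<Rightarrow> bool" where
  "contractive m n L \<longleftrightarrow>
     (\<forall>\<xi>. (\<Sum>i<m. (cmod (\<Sum>k<n. L i k * \<xi> k))\<^sup>2) \<le> (\<Sum>k<n. (cmod (\<xi> k))\<^sup>2))"

text \<open>Equal Gram matrices make the map from combinations of the vectors X z to the same
  combinations of the Y z well defined and isometric; U extends it by 0 to the orthogonal
  complement.\<close>

lemma gram_factorization:
  fixes X Y :: "nat \<Rightarrow> 'z \<Rightarrow> complex"
  assumes Z: "finite Z"
    and gram: "\<And>z z'. z \<in> Z \<Longrightarrow> z' \<in> Z \<Longrightarrow>
      (\<Sum>i<p. X i z * cnj (X i z')) = (\<Sum>i<q. Y i z * cnj (Y i z'))"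
  shows "\<exists>U. contractive q p U \<and> (\<forall>i<q. \<forall>z\<in>Z. Y i z = (\<Sum>k<p. U i k * X k z))"
proof -
  define lin :: "(nat \<Rightarrow> 'z \<Rightarrow> complex) \<Rightarrow> ('z \<Rightarrow> complex) \<Rightarrow> nat \<Rightarrow> complex"
    where "lin = (\<lambda>X s i. \<Sum>z\<in>Z. s z * X i z)"
  have lin_add: "lin W (s + t) = lin W s + lin W t" and lin_scale: "lin W (c *\<^sub>C s) = c *\<^sub>C lin W s"
    for W s t c
    by (simp_all add: lin_def fun_eq_iff scaleC_fun_def sum.distrib sum_distrib_left algebra_simps)
  have lin_zero: "lin W 0 = 0" for W
    by (simp add: lin_def fun_eq_iff)
  have lin_sum: "lin W (\<Sum>a<(K::nat). c a *\<^sub>C s a) = (\<Sum>a<K. c a *\<^sub>C lin W (s a))" for W K c s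
    by (induction K) (simp_all only: lin_zero lin_add lin_scale sum.lessThan_Suc lessThan_0 sum.empty)
  \<comment> \<open>The common inner product of both systems of vectors, on coefficient vectors. It
    is degenerate when the vectors are linearly dependent.\<close>
  define \<gamma> where "\<gamma> s t = (\<Sum>i<p. lin X s i * cnj (lin X t i))" for s t
  have \<gamma>_expand: "(\<Sum>i<m. lin W s i * cnj (lin W t i)) =
      (\<Sum>z\<in>Z. \<Sum>z'\<in>Z. s z * cnj (t z') * (\<Sum>i<m. W i z * cnj (W i z')))" for m W s t
  proof -
    have "(\<Sum>i<m. lin W s i * cnj (lin W t i)) =
        (\<Sum>i<m. \<Sum>z\<in>Z. \<Sum>z'\<in>Z. s z * cnj (t z') * (W i z * cnj (W i z')))"
      by (simp add: lin_def sum_product algebra_simps)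
    also have "\<dots> = (\<Sum>z\<in>Z. \<Sum>i<m. \<Sum>z'\<in>Z. s z * cnj (t z') * (W i z * cnj (W i z')))"
      by (rule sum.swap)
    also have "\<dots> = (\<Sum>z\<in>Z. \<Sum>z'\<in>Z. \<Sum>i<m. s z * cnj (t z') * (W i z * cnj (W i z')))"
      by (intro sum.cong refl, rule sum.swap)
    finally show ?thesis
      by (simp add: sum_distrib_left)
  qed
  have \<gamma>_Y: "\<gamma> s t = (\<Sum>i<q. lin Y s i * cnj (lin Y t i))" for s t
    unfolding \<gamma>_def \<gamma>_expand by (intro sum.cong refl) (simp add: gram)
  interpret \<gamma>: psd_form UNIV \<gamma>
    unfolding \<gamma>_def
    by (rule psd_form_pullback[where L = "lin X" and ip = "\<lambda>v w. \<Sum>i<p. v i * cnj (w i)"])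
      (rule psd_form_standard lin_add lin_scale)+
  interpret st: psd_form UNIV "\<lambda>v w :: nat \<Rightarrow> complex. \<Sum>i<p. v i * cnj (w i)"
    by (rule psd_form_standard)
  define \<delta> :: "'z \<Rightarrow> 'z \<Rightarrow> complex" where "\<delta> z = (\<lambda>y. if y = z then 1 else 0)" for z
  obtain K u where u: "\<gamma>.orthonormal K u" and null: "\<And>z. z \<in> Z \<Longrightarrow>
      Re (\<gamma> (\<delta> z - (\<Sum>a<K. \<gamma> (\<delta> z) (u a) *\<^sub>C u a)) (\<delta> z - (\<Sum>a<K. \<gamma> (\<delta> z) (u a) *\<^sub>C u a))) = 0"
    using \<gamma>.gram_schmidt[of "\<delta> ` Z"] Z by auto
  have lin_\<delta>: "lin W (\<delta> z) i = W i z" if "z \<in> Z" for W z i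
    using that Z by (simp add: lin_def \<delta>_def if_distrib[of "\<lambda>t. t * _"] cong: if_cong)
  have u': "st.orthonormal K (\<lambda>a. lin X (u a))"
    using u by (simp add: st.orthonormal_def \<gamma>.orthonormal_def \<gamma>_def)
  \<comment> \<open>The partial isometry that takes the orthonormal vectors
    \<open>lin X (u a)\<close> to the orthonormal vectors \<open>lin Y (u a)\<close>.\<close>
  define U where "U i k = (\<Sum>a<K. lin Y (u a) i * cnj (lin X (u a) k))" for i k
  have U_apply: "(\<Sum>k<p. U i k * \<xi> k) =
      lin Y (\<Sum>a<K. (\<Sum>k<p. \<xi> k * cnj (lin X (u a) k)) *\<^sub>C u a) i" for i \<xi>
  proof -
    have "(\<Sum>k<p. U i k * \<xi> k) = (\<Sum>k<p. \<Sum>a<K. lin Y (u a) i * (\<xi> k * cnj (lin X (u a) k)))"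
      by (simp add: U_def sum_distrib_left sum_distrib_right algebra_simps)
    also have "\<dots> = (\<Sum>a<K. \<Sum>k<p. lin Y (u a) i * (\<xi> k * cnj (lin X (u a) k)))"
      by (rule sum.swap)
    also have "\<dots> = (\<Sum>a<K. ((\<Sum>k<p. \<xi> k * cnj (lin X (u a) k)) *\<^sub>C lin Y (u a)) i)"
      by (simp add: scaleC_fun_def sum_distrib_left sum_distrib_right algebra_simps)
    finally show ?thesis
      by (simp only: lin_sum sum_fun_apply)
  qed
  have "contractive q p U"
    unfolding contractive_def
  proof
    fix \<xi> :: "nat \<Rightarrow> complex"
    define c where "c a = (\<Sum>k<p. \<xi> k * cnj (lin X (u a) k))" for a
    define s where "s = (\<Sum>a<K. c a *\<^sub>C u a)"
    have "(\<Sum>i<q. (cmod (\<Sum>k<p. U i k * \<xi> k))\<^sup>2) = Re (\<gamma> s s)"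
      by (simp add: U_apply \<gamma>_Y s_def c_def flip: complex_norm_square of_real_sum)
    also have "\<dots> = (\<Sum>a<K. (cmod (c a))\<^sup>2)"
      unfolding s_def by (rule \<gamma>.Re_ip_orthonormal_expansion[OF u])
    also have "\<dots> \<le> Re (\<Sum>k<p. \<xi> k * cnj (\<xi> k))"
      using st.bessel[OF u', of \<xi>] by (simp add: c_def)
    also have "\<dots> = (\<Sum>k<p. (cmod (\<xi> k))\<^sup>2)"
      by (simp flip: complex_norm_square of_real_sum)
    finally show "(\<Sum>i<q. (cmod (\<Sum>k<p. U i k * \<xi> k))\<^sup>2) \<le> (\<Sum>k<p. (cmod (\<xi> k))\<^sup>2)" .
  qed
  moreover have "Y i z = (\<Sum>k<p. U i k * X k z)" if i: "i < q" and z: "z \<in> Z" for i z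
  proof -
    define s where "s = (\<Sum>a<K. \<gamma> (\<delta> z) (u a) *\<^sub>C u a)"
    define r where "r = \<delta> z - s"
    \<comment> \<open>The residual r is null for \<gamma>, and \<gamma> may be computed with Y as
      well, so Y annihilates r.\<close>
    have "Re (\<gamma> r r) = 0"
      using null[OF z] by (simp add: r_def s_def)
    then have "(\<Sum>i<q. (cmod (lin Y r i))\<^sup>2) = 0"
      by (simp add: \<gamma>_Y flip: complex_norm_square of_real_sum)
    then have "lin Y r i = 0"
      using i by (simp add: sum_nonneg_eq_0_iff)
    moreover have "lin Y (\<delta> z) = lin Y r + lin Y s"
      unfolding lin_add[symmetric] by (simp add: r_def)
    ultimately have "Y i z = lin Y s i"
      using z by (metis lin_\<delta> plus_fun_apply add_0)
    moreover have "s = (\<Sum>a<K. (\<Sum>k<p. X k z * cnj (lin X (u a) k)) *\<^sub>C u a)"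
      using z by (simp add: s_def \<gamma>_def lin_\<delta>)
    ultimately show ?thesis
      by (simp add: U_apply)
  qed
  ultimately show ?thesis by blast
qed

section \<open>Positive functionals on ordered vector spaces\<close>

abbreviation scaleR_C :: "real \<Rightarrow> 'v::complex_vector \<Rightarrow> 'v" (infixr \<open>*\<^sub>r\<close> 75) where
  "t *\<^sub>r v \<equiv> complex_of_real t *\<^sub>C v"

definition convex_cone_on :: "'w::complex_vector set \<Rightarrow> bool" where
  "convex_cone_on P \<longleftrightarrow> 0 \<in> P \<and> (\<forall>u\<in>P. \<forall>v\<in>P. u + v \<in> P) \<and> (\<forall>t\<ge>0. \<forall>w\<in>P. t *\<^sub>r w \<in> P)"

text \<open>The real subspace on which e is an order unit; only there does positivity control a
  functional.\<close>

definition order_bounded :: "'w::complex_vector set \<Rightarrow> 'w \<Rightarrow> 'w set" where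
  "order_bounded P e = {w. \<exists>t\<ge>0. t *\<^sub>r e - w \<in> P \<and> t *\<^sub>r e + w \<in> P}"

lemma order_bounded_add:
  assumes "convex_cone_on P" and "u \<in> order_bounded P e" and "v \<in> order_bounded P e"
  shows "u + v \<in> order_bounded P e"
proof -
  obtain s t where "s \<ge> 0" "s *\<^sub>r e - u \<in> P" "s *\<^sub>r e + u \<in> P"
    and "t \<ge> 0" "t *\<^sub>r e - v \<in> P" "t *\<^sub>r e + v \<in> P"
    using assms by (auto simp: order_bounded_def)
  then have "(s *\<^sub>r e - u) + (t *\<^sub>r e - v) \<in> P" "(s *\<^sub>r e + u) + (t *\<^sub>r e + v) \<in> P" "s + t \<ge> 0"
    using assms(1) unfolding convex_cone_on_def by (blast, blast, simp)
  then have "(s + t) *\<^sub>r e - (u + v) \<in> P" "(s + t) *\<^sub>r e + (u + v) \<in> P" "s + t \<ge> 0"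
    by (simp_all add: scaleC_add_left algebra_simps)
  then show ?thesis
    unfolding order_bounded_def by blast
qed

lemma order_bounded_minus: "u \<in> order_bounded P e \<Longrightarrow> - u \<in> order_bounded P e"
  by (auto simp: order_bounded_def)

lemma order_bounded_scale_pos:
  assumes P: "convex_cone_on P" and u: "u \<in> order_bounded P e" and c: "c \<ge> 0"
  shows "c *\<^sub>r u \<in> order_bounded P e"
proof -
  obtain s where s: "s \<ge> 0" "s *\<^sub>r e - u \<in> P" "s *\<^sub>r e + u \<in> P"
    using u by (auto simp: order_bounded_def)
  then have "c *\<^sub>r (s *\<^sub>r e - u) \<in> P" "c *\<^sub>r (s *\<^sub>r e + u) \<in> P"
    using P c by (auto simp: convex_cone_on_def)
  then have "(c * s) *\<^sub>r e - c *\<^sub>r u \<in> P" "(c * s) *\<^sub>r e + c *\<^sub>r u \<in> P"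
    by (simp_all add: scaleC_diff_right scaleC_add_right scaleC_scaleC)
  then show ?thesis
    using c s by (auto simp: order_bounded_def intro!: exI[of _ "c * s"])
qed

lemma order_bounded_scale:
  assumes "convex_cone_on P" and "u \<in> order_bounded P e"
  shows "c *\<^sub>r u \<in> order_bounded P e"
proof (cases "c \<ge> 0")
  case False
  then have "- ((- c) *\<^sub>r u) \<in> order_bounded P e"
    using assms by (intro order_bounded_minus order_bounded_scale_pos) auto
  then show ?thesis
    by (simp add: scaleC_minus_left)
qed (use assms order_bounded_scale_pos in blast)

text \<open>By Zorn's lemma some cone is maximal among those that contain P and -p but not -e. It is
  total, since adjoining a missing w must produce -e.\<close>

lemma total_cone_exists:
  fixes P :: "'w::complex_vector set"
  assumes P: "convex_cone_on P" and e: "e \<in> P" and p: "p \<notin> P" "p \<in> order_bounded P e"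
  shows "\<exists>M. convex_cone_on M \<and> P \<subseteq> M \<and> - p \<in> M \<and> - e \<notin> M \<and> (\<forall>w. w \<notin> M \<longrightarrow> - w \<in> M)"
proof -
  have ray: "convex_cone_on {m + t *\<^sub>r w | m t. m \<in> M \<and> t \<ge> 0}" (is "convex_cone_on ?R")
    if M: "convex_cone_on M" for M and w :: 'w
  proof -
    have I: "x \<in> ?R" if "x = m + t *\<^sub>r w" "m \<in> M" "t \<ge> 0" for x m t
      using that by blast
    have "0 \<in> ?R"
      by (rule I[of _ 0 0]) (use M in \<open>auto simp: convex_cone_on_def\<close>)
    moreover have "u + v \<in> ?R" if uv: "u \<in> ?R" "v \<in> ?R" for u v
    proof -
      obtain m s where u: "u = m + s *\<^sub>r w" "m \<in> M" "s \<ge> 0"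
        using uv by blast
      obtain n t where v: "v = n + t *\<^sub>r w" "n \<in> M" "t \<ge> 0"
        using uv by blast
      show ?thesis
        by (rule I[of _ "m + n" "s + t"])
          (use M u v in \<open>auto simp: convex_cone_on_def scaleC_add_left\<close>)
    qed
    moreover have "c *\<^sub>r u \<in> ?R" if c: "c \<ge> 0" and "u \<in> ?R" for c u
    proof -
      obtain m s where u: "u = m + s *\<^sub>r w" "m \<in> M" "s \<ge> 0"
        using \<open>u \<in> ?R\<close> by blast
      show ?thesis
        by (rule I[of _ "c *\<^sub>r m" "c * s"])
          (use M u c in \<open>auto simp: convex_cone_on_def scaleC_add_right scaleC_scaleC\<close>)
    qed
    ultimately show ?thesis
      unfolding convex_cone_on_def by (intro conjI ballI allI impI)
  qed
  have ray_sub: "M \<subseteq> {m + t *\<^sub>r w | m t. m \<in> M \<and> t \<ge> 0}" for M and w :: 'w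
  proof
    fix m assume "m \<in> M"
    then show "m \<in> {m + t *\<^sub>r w | m t. m \<in> M \<and> t \<ge> 0}"
      by (intro CollectI exI[of _ m] exI[of _ 0]) simp
  qed
  have ray_mem: "w \<in> {m + t *\<^sub>r w | m t. m \<in> M \<and> t \<ge> 0}" if "convex_cone_on M" for M and w :: 'w
    using that by (intro CollectI exI[of _ 0] exI[of _ 1]) (simp add: convex_cone_on_def scaleC_one)
  \<comment> \<open>If -e = m + t w, then t > 0 because -e is not in M, and -w = (m + e) / t lies in
    M. This yields totality; for w = -p it shows that -p can be adjoined to P.\<close>
  have solve: "- w \<in> M" if M: "convex_cone_on M" "e \<in> M" "- e \<notin> M"
    and R: "- e \<in> {m + t *\<^sub>r w | m t. m \<in> M \<and> t \<ge> 0}" for M and w :: 'w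
  proof -
    obtain m t where mt: "- e = m + t *\<^sub>r w" "m \<in> M" "t \<ge> 0"
      using R by blast
    have "t \<noteq> 0"
      using mt M by auto
    have "e = - (m + t *\<^sub>r w)"
      by (metis mt(1) minus_minus)
    then have "t *\<^sub>r (- w) = m + e"
      by (simp add: scaleC_minus_right)
    moreover have "m + e \<in> M"
      using M mt by (auto simp: convex_cone_on_def)
    moreover have "0 \<le> 1 / t"
      using mt by simp
    ultimately have "(1 / t) *\<^sub>r (t *\<^sub>r (- w)) \<in> M"
      using M(1) unfolding convex_cone_on_def by metis
    then show ?thesis
      using \<open>t \<noteq> 0\<close> by (simp add: scaleC_scaleC scaleC_one flip: of_real_mult)
  qed
  \<comment> \<open>Otherwise P would absorb every element bounded by e, in particular p.\<close>
  have "- e \<notin> P"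
  proof
    assume neg: "- e \<in> P"
    obtain t where t: "t \<ge> 0" "t *\<^sub>r e + p \<in> P"
      using p by (auto simp: order_bounded_def)
    then have "t *\<^sub>r (- e) + (t *\<^sub>r e + p) \<in> P"
      using neg P by (auto simp: convex_cone_on_def)
    then show False
      using p by (simp add: scaleC_minus_right)
  qed
  define \<A> where "\<A> = {M. convex_cone_on M \<and> P \<subseteq> M \<and> - p \<in> M \<and> - e \<notin> M}"
  define P0 where "P0 = {m + t *\<^sub>r (- p) | m t. m \<in> P \<and> t \<ge> 0}"
  have "P0 \<in> \<A>"
    using ray[OF P, of "- p"] ray_sub[of P "- p"] ray_mem[OF P, of "- p"]
      solve[OF P e \<open>- e \<notin> P\<close>, of "- p"] p by (auto simp: \<A>_def P0_def)
  moreover have "\<Union>\<C> \<in> \<A>" if "\<C> \<noteq> {}" "subset.chain \<A> \<C>" for \<C>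
  proof -
    have sub: "\<C> \<subseteq> \<A>"
      using that by (simp add: subset_chain_def)
    have "u + v \<in> \<Union>\<C>" if uv: "u \<in> \<Union>\<C>" "v \<in> \<Union>\<C>" for u v
    proof -
      obtain M N where "u \<in> M" "v \<in> N" "M \<in> \<C>" "N \<in> \<C>"
        using uv by auto
      moreover from this have "M \<subseteq> N \<or> N \<subseteq> M"
        using \<open>subset.chain \<A> \<C>\<close> by (simp add: subset_chain_def)
      moreover have "convex_cone_on M" "convex_cone_on N"
        using calculation sub by (auto simp: \<A>_def)
      ultimately show ?thesis
        unfolding convex_cone_on_def by (meson UnionI subsetD)
    qed
    moreover have "0 \<in> \<Union>\<C>" "P \<subseteq> \<Union>\<C>" "- p \<in> \<Union>\<C>"
      using \<open>\<C> \<noteq> {}\<close> sub by (auto simp: \<A>_def convex_cone_on_def)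
    moreover have "t *\<^sub>r w \<in> \<Union>\<C>" if tw: "t \<ge> 0" "w \<in> \<Union>\<C>" for t w
    proof -
      obtain M where "w \<in> M" "M \<in> \<C>"
        using tw by auto
      moreover from this have "convex_cone_on M"
        using sub by (auto simp: \<A>_def)
      ultimately show ?thesis
        using tw unfolding convex_cone_on_def by (meson UnionI)
    qed
    moreover have "- e \<notin> \<Union>\<C>"
      using sub by (auto simp: \<A>_def)
    ultimately show ?thesis
      by (simp add: \<A>_def convex_cone_on_def)
  qed
  ultimately obtain M where M: "M \<in> \<A>" and max: "\<And>N. N \<in> \<A> \<Longrightarrow> M \<subseteq> N \<Longrightarrow> N = M"
    using subset_Zorn_nonempty[of \<A>] by blast
  have "- w \<in> M" if "w \<notin> M" for w
  proof (rule solve)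
    show M': "convex_cone_on M" "e \<in> M" "- e \<notin> M"
      using M e by (auto simp: \<A>_def)
    show "- e \<in> {m + t *\<^sub>r w | m t. m \<in> M \<and> t \<ge> 0}" (is "_ \<in> ?R")
    proof (rule ccontr)
      assume "- e \<notin> ?R"
      then have "?R \<in> \<A>"
        using ray[OF M'(1), of w] ray_sub[of M w] M by (auto simp: \<A>_def)
      then have "?R = M"
        by (rule max[OF _ ray_sub])
      then show False
        using ray_mem[OF M'(1), of w] that by (simp only:)
    qed
  qed
  then show ?thesis
    using M by (auto simp: \<A>_def)
qed

text \<open>A total cone M without -e compares every w with the multiples of e. The resulting
  Dedekind cut is a real number that depends linearly on w. As M need not be closed, -p in M only
  gives \<phi> p <= 0.\<close>

lemma positive_functional_exists:
  fixes P :: "'w::complex_vector set"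
  assumes P: "convex_cone_on P" and e: "e \<in> P" and p: "p \<notin> P" "p \<in> order_bounded P e"
  shows "\<exists>\<phi> :: 'w \<Rightarrow> real.
    (\<forall>u\<in>order_bounded P e. \<forall>v\<in>order_bounded P e. \<phi> (u + v) = \<phi> u + \<phi> v) \<and>
    (\<forall>t. \<forall>w\<in>order_bounded P e. \<phi> (t *\<^sub>r w) = t * \<phi> w) \<and>
    (\<forall>w\<in>P \<inter> order_bounded P e. 0 \<le> \<phi> w) \<and> \<phi> e = 1 \<and> \<phi> p \<le> 0"
proof -
  define D where "D = order_bounded P e"
  obtain M where M: "convex_cone_on M" "P \<subseteq> M" "- p \<in> M" and eM: "- e \<notin> M"
    and total: "\<And>w. w \<notin> M \<Longrightarrow> - w \<in> M"
    using total_cone_exists[OF assms] by blast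
  have M_add: "u + v \<in> M" if "u \<in> M" "v \<in> M" for u v
    using that M by (simp add: convex_cone_on_def)
  have M_scale: "t *\<^sub>r u \<in> M" if "u \<in> M" "t \<ge> 0" for u t
    using that M by (simp add: convex_cone_on_def)
  have e_mem: "t *\<^sub>r e \<in> M \<longleftrightarrow> t \<ge> 0" for t
  proof
    assume t: "t *\<^sub>r e \<in> M"
    show "t \<ge> 0"
    proof (rule ccontr)
      assume "\<not> t \<ge> 0"
      moreover from this have "(1 / (- t)) *\<^sub>r (t *\<^sub>r e) \<in> M"
        using M_scale[OF t, of "1 / (- t)"] by (simp only: divide_nonneg_nonpos not_le less_imp_le
            zero_le_divide_iff) simp
      moreover have "(1 / (- t)) * t = - 1"
        using \<open>\<not> t \<ge> 0\<close> by simp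
      ultimately show False
        using eM by (simp only: scaleC_scaleC flip: of_real_mult) (simp add: scaleC_minus_one)
    qed
  qed (use M_scale e M in auto)
  \<comment> \<open>F w x says that w is cut at x. Nothing is required at a = x itself, because M
    need not be closed.\<close>
  define F where "F w x \<longleftrightarrow> (\<forall>a>x. a *\<^sub>r e - w \<in> M) \<and> (\<forall>a<x. w - a *\<^sub>r e \<in> M)" for w x
  have F_upper: "a *\<^sub>r e - w \<in> M" if "F w x" "x < a" for w x a
    using that by (simp only: F_def)
  have F_lower: "w - a *\<^sub>r e \<in> M" if "F w x" "a < x" for w x a
    using that by (simp only: F_def)
  have le: "a \<le> b" if "w - a *\<^sub>r e \<in> M" "b *\<^sub>r e - w \<in> M" for a b w
    using M_add[OF that] e_mem[of "b - a"] by (simp add: scaleC_diff_left algebra_simps)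
  have F_unique: "x = y" if "F w x" "F w y" for w x y
  proof (rule ccontr)
    have *: False if "x < y" "F w x" "F w y" for x y
    proof -
      \<comment> \<open>Two points strictly between x and y, which the two cuts force into the wrong
        order.\<close>
      have "(2 * y + x) / 3 \<le> (2 * x + y) / 3"
        by (rule le[OF F_lower[OF that(3)] F_upper[OF that(2)]]) (use that in auto)
      then show False
        using that by simp
    qed
    assume "x \<noteq> y"
    then show False
      using *[of x y] *[of y x] that by (meson linorder_neqE)
  qed
  have F_exists: "\<exists>x. F w x" if w: "w \<in> D" for w
  proof -
    obtain t where t: "t *\<^sub>r e - w \<in> M" "t *\<^sub>r e + w \<in> M"
      using w M by (auto simp: D_def order_bounded_def)
    define S where "S = {a. a *\<^sub>r e - w \<in> M}"
    have lower: "- t \<le> a" if "a \<in> S" for a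
      using le[of w "- t" a] t that by (simp add: S_def scaleC_minus_left add.commute)
    have ne: "S \<noteq> {}"
      using t by (auto simp: S_def)
    have bdd: "bdd_below S"
      using lower by (auto simp: bdd_below_def)
    have "a *\<^sub>r e - w \<in> M" if a: "a > Inf S" for a
    proof -
      obtain b where "b \<in> S" "b < a"
        using a cInf_less_iff[OF ne bdd] by auto
      moreover from this have "(a - b) *\<^sub>r e \<in> M"
        by (simp only: e_mem)
      ultimately have "(b *\<^sub>r e - w) + (a - b) *\<^sub>r e \<in> M"
        by (intro M_add) (simp add: S_def)
      then show ?thesis
        by (simp add: scaleC_diff_left)
    qed
    moreover have "w - a *\<^sub>r e \<in> M" if "a < Inf S" for a
    proof -
      \<comment> \<open>Totality enters here: what does not lie in M has its negative in M.\<close>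
      have "a \<notin> S"
        using that cInf_lower[OF _ bdd] by fastforce
      then show ?thesis
        using total[of "a *\<^sub>r e - w"] by (simp add: S_def)
    qed
    ultimately show ?thesis
      by (auto simp: F_def)
  qed
  define \<phi> where "\<phi> w = (THE x. F w x)" for w
  have \<phi>_eqI: "\<phi> w = x" if "F w x" for w x
    unfolding \<phi>_def using that F_unique by (intro the_equality) auto
  have F_\<phi>: "F w (\<phi> w)" if "w \<in> D" for w
    using F_exists[OF that] \<phi>_eqI by auto
  have F_add: "F (u + v) (x + y)" if "F u x" "F v y" for u v x y
    unfolding F_def
  proof (intro conjI allI impI)
    fix a assume a: "a > x + y"
    \<comment> \<open>The excess of a over x + y is shared equally between u and v.\<close>
    have "((a + x - y) / 2) *\<^sub>r e - u \<in> M" "((a - x + y) / 2) *\<^sub>r e - v \<in> M"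
      by (rule F_upper[OF that(1)], use a in simp) (rule F_upper[OF that(2)], use a in simp)
    from M_add[OF this] have "((a + x - y) / 2 + (a - x + y) / 2) *\<^sub>r e - (u + v) \<in> M"
      by (simp only: of_real_add scaleC_add_left) (simp add: algebra_simps)
    moreover have "(a + x - y) / 2 + (a - x + y) / 2 = a"
      by (simp add: field_simps)
    ultimately show "a *\<^sub>r e - (u + v) \<in> M"
      by simp
  next
    fix a assume a: "a < x + y"
    have "u - ((a + x - y) / 2) *\<^sub>r e \<in> M" "v - ((a - x + y) / 2) *\<^sub>r e \<in> M"
      by (rule F_lower[OF that(1)], use a in simp) (rule F_lower[OF that(2)], use a in simp)
    from M_add[OF this] have "(u + v) - ((a + x - y) / 2 + (a - x + y) / 2) *\<^sub>r e \<in> M"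
      by (simp only: of_real_add scaleC_add_left) (simp add: algebra_simps)
    moreover have "(a + x - y) / 2 + (a - x + y) / 2 = a"
      by (simp add: field_simps)
    ultimately show "u + v - a *\<^sub>r e \<in> M"
      by simp
  qed
  have F_minus: "F (- u) (- x)" if "F u x" for u x
    unfolding F_def
  proof (intro conjI allI impI)
    fix a assume "a > - x"
    then have "u - (- a) *\<^sub>r e \<in> M"
      by (intro F_lower[OF that]) simp
    then show "a *\<^sub>r e - - u \<in> M"
      by (simp add: scaleC_minus_left add.commute)
  next
    fix a assume "a < - x"
    then have "(- a) *\<^sub>r e - u \<in> M"
      by (intro F_upper[OF that]) simp
    then show "- u - a *\<^sub>r e \<in> M"
      by (simp add: scaleC_minus_left minus_diff_commute)
  qed
  have F_scale_pos: "F (t *\<^sub>r u) (t * x)" if "F u x" "t > 0" for u x t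
    unfolding F_def
  proof (intro conjI allI impI)
    fix a assume "a > t * x"
    then have "(a / t) *\<^sub>r e - u \<in> M"
      by (intro F_upper[OF that(1)]) (use that in \<open>simp add: field_simps\<close>)
    from M_scale[OF this, of t] show "a *\<^sub>r e - t *\<^sub>r u \<in> M"
      using that by (simp add: scaleC_diff_right scaleC_scaleC)
  next
    fix a assume "a < t * x"
    then have "u - (a / t) *\<^sub>r e \<in> M"
      by (intro F_lower[OF that(1)]) (use that in \<open>simp add: field_simps\<close>)
    from M_scale[OF this, of t] show "t *\<^sub>r u - a *\<^sub>r e \<in> M"
      using that by (simp add: scaleC_diff_right scaleC_scaleC)
  qed
  have F_zero: "F 0 0"
    using e_mem by (auto simp: F_def simp flip: scaleC_minus_left of_real_minus)
  have F_scale: "F (t *\<^sub>r u) (t * x)" if "F u x" for u x t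
  proof -
    consider "t > 0" | "t = 0" | "t < 0"
      by linarith
    then show ?thesis
    proof cases
      case 3
      then show ?thesis
        using F_minus[OF F_scale_pos[OF that, of "- t"]] by (simp add: scaleC_minus_left)
    qed (use F_scale_pos[OF that] F_zero in auto)
  qed
  have "0 \<le> \<phi> w" if w: "w \<in> P" "w \<in> D" for w
  proof (rule ccontr)
    assume "\<not> 0 \<le> \<phi> w"
    then have "(\<phi> w / 2) *\<^sub>r e - w \<in> M"
      by (intro F_upper[OF F_\<phi>[OF w(2)]]) simp
    then show False
      using le[of w 0 "\<phi> w / 2"] \<open>\<not> 0 \<le> \<phi> w\<close> w M by auto
  qed
  moreover have "\<phi> p \<le> 0"
  proof (rule ccontr)
    assume "\<not> \<phi> p \<le> 0"
    then have "p - (\<phi> p / 2) *\<^sub>r e \<in> M"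
      by (intro F_lower[OF F_\<phi>[of p]]) (use p in \<open>simp_all add: D_def\<close>)
    then show False
      using le[of p "\<phi> p / 2" 0] \<open>\<not> \<phi> p \<le> 0\<close> M by auto
  qed
  moreover have "F e 1"
    unfolding F_def
  proof (intro conjI allI impI)
    fix a :: real assume "a > 1"
    then show "a *\<^sub>r e - e \<in> M"
      using e_mem[of "a - 1"] by (simp add: scaleC_diff_left scaleC_one)
  next
    fix a :: real assume "a < 1"
    then show "e - a *\<^sub>r e \<in> M"
      using e_mem[of "1 - a"] by (simp add: scaleC_diff_left scaleC_one)
  qed
  ultimately show ?thesis
    by (intro exI[of _ \<phi>] conjI ballI allI)
      (auto simp flip: D_def intro!: \<phi>_eqI F_add F_scale F_\<phi>)
qed

section \<open>Norms of columns of row vectors\<close>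

text \<open>The Gram matrix of the column with rows xs. It is cut off outside Z, so that equality of
  functions means equality of Gram matrices over Z.\<close>

definition tensor :: "'z set \<Rightarrow> ('z \<Rightarrow> complex) list \<Rightarrow> 'z \<times> 'z \<Rightarrow> complex" where
  "tensor Z xs = (\<lambda>(z, z'). if z \<in> Z \<and> z' \<in> Z then \<Sum>x\<leftarrow>xs. x z * cnj (x z') else 0)"

definition scale_list :: "real \<Rightarrow> ('z \<Rightarrow> complex) list \<Rightarrow> ('z \<Rightarrow> complex) list" where
  "scale_list t xs = map (\<lambda>x. t *\<^sub>r x) xs"

lemma tensor_Nil: "tensor Z [] = 0"
  by (auto simp: tensor_def fun_eq_iff)

lemma tensor_append: "tensor Z (xs @ ys) = tensor Z xs + tensor Z ys"
  by (auto simp: tensor_def fun_eq_iff)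

lemma tensor_Cons: "tensor Z (x # xs) = tensor Z [x] + tensor Z xs"
  using tensor_append[of Z "[x]" xs] by (simp only: append_Cons append_Nil)

lemma tensor_scale: "tensor Z (scale_list t xs) = (t\<^sup>2) *\<^sub>r tensor Z xs"
proof -
  have "(\<Sum>x\<leftarrow>scale_list t xs. x z * cnj (x z')) = complex_of_real (t\<^sup>2) * (\<Sum>x\<leftarrow>xs. x z * cnj (x z'))"
    for z z'
    by (induction xs) (auto simp: scale_list_def scaleC_fun_def algebra_simps power2_eq_square)
  then show ?thesis
    by (auto simp: tensor_def fun_eq_iff scaleC_fun_def)
qed

lemma tensor_concat_replicate: "tensor Z (concat (replicate k xs)) = real k *\<^sub>r tensor Z xs"
  by (induction k) (simp_all add: tensor_Nil tensor_append scaleC_add_left scaleC_one)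

text \<open>\<open>c_tensor\<close> abstracts invariance under isometries from the left.
  \<open>c_append\<close> is the estimate for a column of two blocks that in operator terms reads
  |X'X + Y'Y| <= |X'X| + |Y'Y|, the prime denoting adjoints.\<close>

locale column_norm =
  fixes Z :: "'z set" and c :: "('z \<Rightarrow> complex) list \<Rightarrow> real"
  assumes c_nonneg: "0 \<le> c xs"
    and c_tensor: "tensor Z xs = tensor Z ys \<Longrightarrow> c xs = c ys"
    and c_append: "(c (xs @ ys))\<^sup>2 \<le> (c xs)\<^sup>2 + (c ys)\<^sup>2"
    and c_scale: "t \<ge> 0 \<Longrightarrow> c (scale_list t xs) \<le> t * c xs"
    and c_mono: "c xs \<le> c (xs @ ys)"
begin

text \<open>The quantifier over all contexts us makes the relation stable under appending, which a
  comparison of the norms of xs and ys alone would not be.\<close>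

definition dominated :: "('z \<Rightarrow> complex) list \<Rightarrow> ('z \<Rightarrow> complex) list \<Rightarrow> bool" where
  "dominated ys xs \<longleftrightarrow> (\<forall>us. c (us @ ys) \<le> c (us @ xs))"

text \<open>A member is a difference of tensors in many ways, and dominance is known for only some
  pair that represents it.\<close>

definition cone :: "('z \<times> 'z \<Rightarrow> complex) set" where
  "cone = {tensor Z xs - tensor Z ys | xs ys. dominated ys xs}"

lemma c_scale_eq: "t > 0 \<Longrightarrow> c (scale_list t xs) = t * c xs"
proof (rule antisym)
  assume t: "t > 0"
  have "c xs = c (scale_list (1 / t) (scale_list t xs))"
  proof (rule c_tensor)
    have "(1 / t)\<^sup>2 * t\<^sup>2 = 1"
      using t by (simp flip: power_mult_distrib)
    then show "tensor Z xs = tensor Z (scale_list (1 / t) (scale_list t xs))"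
      by (simp only: tensor_scale scaleC_scaleC scaleC_one of_real_1 flip: of_real_mult)
  qed
  also have "\<dots> \<le> 1 / t * c (scale_list t xs)"
    using t by (intro c_scale) simp
  finally show "t * c xs \<le> c (scale_list t xs)"
    using t by (simp add: field_simps)
qed (simp add: c_scale)

lemma dominated_append:
  assumes "dominated ys xs" and "dominated ys' xs'"
  shows "dominated (ys @ ys') (xs @ xs')"
  unfolding dominated_def
proof
  fix us
  have "c (us @ ys @ ys') = c ((us @ ys) @ ys')"
    by simp
  also have "\<dots> \<le> c ((us @ ys) @ xs')"
    using assms(2) unfolding dominated_def by blast
  also have "\<dots> = c ((us @ xs') @ ys)"
    by (rule c_tensor) (simp add: tensor_append add_ac)
  also have "\<dots> \<le> c ((us @ xs') @ xs)"
    using assms(1) unfolding dominated_def by blast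
  also have "\<dots> = c (us @ xs @ xs')"
    by (rule c_tensor) (simp add: tensor_append add_ac)
  finally show "c (us @ ys @ ys') \<le> c (us @ xs @ xs')" .
qed

lemma dominated_scale:
  assumes "dominated ys xs" and "t \<ge> 0"
  shows "dominated (scale_list t ys) (scale_list t xs)"
  unfolding dominated_def
proof
  fix us
  show "c (us @ scale_list t ys) \<le> c (us @ scale_list t xs)"
  proof (cases "t = 0")
    case True
    then have "c (us @ scale_list t ys) = c (us @ scale_list t xs)"
      by (intro c_tensor) (simp add: tensor_append tensor_scale)
    then show ?thesis by simp
  next
    case False
    with assms have t: "t > 0" by simp
    have "(1 / t)\<^sup>2 * t\<^sup>2 = 1"
      using t by (simp flip: power_mult_distrib)
    \<comment> \<open>The factor t is traded for a factor 1 / t on the context, and dominance holds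
      in every context.\<close>
    then have *: "c (us @ scale_list t zs) = t * c (scale_list (1 / t) us @ zs)" for zs
      unfolding c_scale_eq[OF t, symmetric]
      by (intro c_tensor)
        (simp only: tensor_append tensor_scale scaleC_add_right scaleC_scaleC scaleC_one of_real_1
          mult.commute flip: of_real_mult)
    show ?thesis
      unfolding * using assms(1) t by (simp add: dominated_def)
  qed
qed

lemma convex_cone: "convex_cone_on cone"
  unfolding convex_cone_on_def
proof (intro conjI ballI allI impI)
  have "dominated [] []"
    by (simp add: dominated_def)
  then show "0 \<in> cone"
    unfolding cone_def by (intro CollectI exI[of _ "[]"]) simp
  fix u v assume "u \<in> cone" "v \<in> cone"
  then obtain xs ys xs' ys' where "u = tensor Z xs - tensor Z ys" "dominated ys xs"
    "v = tensor Z xs' - tensor Z ys'" "dominated ys' xs'"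
    unfolding cone_def by blast
  then show "u + v \<in> cone"
    unfolding cone_def using dominated_append
    by (intro CollectI exI[of _ "xs @ xs'"] exI[of _ "ys @ ys'"]) (simp add: tensor_append)
next
  fix t :: real and u assume t: "0 \<le> t" and "u \<in> cone"
  then obtain xs ys where "u = tensor Z xs - tensor Z ys" "dominated ys xs"
    unfolding cone_def by blast
  then show "t *\<^sub>r u \<in> cone"
    \<comment> \<open>The square root compensates for the quadratic behaviour of
      \<open>tensor\<close>.\<close>
    unfolding cone_def using t dominated_scale[of ys xs "sqrt t"]
    by (intro CollectI exI[of _ "scale_list (sqrt t) xs"] exI[of _ "scale_list (sqrt t) ys"])
      (simp add: tensor_scale scaleC_diff_right)
qed

lemma tensor_mem_cone: "tensor Z xs \<in> cone"
proof -
  have "dominated [] xs"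
    by (simp add: dominated_def c_mono)
  then show ?thesis
    unfolding cone_def by (intro CollectI exI[of _ xs] exI[of _ "[]"]) (simp add: tensor_Nil)
qed

text \<open>
  Replacing one copy of \<open>gs\<close> by \<open>rs\<close> does not decrease the norm as long as the catalyst \<open>xs\<close> is
  present; with \<open>k\<close> copies the contribution of the catalyst becomes negligible as \<open>k \<longrightarrow> \<infinity>\<close>.
\<close>

lemma catalyst_bound:
  assumes dom: "dominated ys xs" and eq: "tensor Z (gs @ xs) = tensor Z (rs @ ys)"
  shows "c gs \<le> c rs"
proof -
  have step: "c (us @ gs @ xs) \<le> c (us @ rs @ xs)" for us
  proof -
    have "c (us @ gs @ xs) = c ((us @ rs) @ ys)"
      using eq by (intro c_tensor) (simp add: tensor_append add_ac)
    also have "\<dots> \<le> c ((us @ rs) @ xs)"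
      using dom unfolding dominated_def by blast
    finally show ?thesis by simp
  qed
  have iter: "c (us @ concat (replicate k gs) @ xs) \<le> c (us @ concat (replicate k rs) @ xs)" for k us
  proof (induction k arbitrary: us)
    case (Suc k)
    have "c (us @ concat (replicate (Suc k) gs) @ xs) = c ((us @ concat (replicate k gs)) @ gs @ xs)"
      by (intro c_tensor) (simp add: tensor_append add_ac)
    also have "\<dots> \<le> c ((us @ concat (replicate k gs)) @ rs @ xs)"
      by (rule step)
    also have "\<dots> = c ((us @ rs) @ concat (replicate k gs) @ xs)"
      by (intro c_tensor) (simp add: tensor_append add_ac)
    also have "\<dots> \<le> c ((us @ rs) @ concat (replicate k rs) @ xs)"
      by (rule Suc.IH)
    finally show ?case by simp
  qed simp
  \<comment> \<open>k copies of hs have the same Gram matrix as hs scaled by the square root of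
    k.\<close>
  have copies: "(c (concat (replicate k hs)))\<^sup>2 = real k * (c hs)\<^sup>2" if "k > 0" for k hs
  proof -
    have "c (concat (replicate k hs)) = c (scale_list (sqrt (real k)) hs)"
      by (intro c_tensor) (simp add: tensor_scale tensor_concat_replicate)
    then show ?thesis
      using that by (simp add: c_scale_eq power_mult_distrib)
  qed
  have pos: "real k * ((c gs)\<^sup>2 - (c rs)\<^sup>2) \<le> (c xs)\<^sup>2" if "k > 0" for k
  proof -
    have "c (concat (replicate k gs)) \<le> c (concat (replicate k rs) @ xs)"
      using iter[of "[]" k] c_mono[of "concat (replicate k gs)" xs] by simp
    then have "(c (concat (replicate k gs)))\<^sup>2 \<le> (c (concat (replicate k rs) @ xs))\<^sup>2"
      by (intro power_mono c_nonneg)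
    also have "\<dots> \<le> (c (concat (replicate k rs)))\<^sup>2 + (c xs)\<^sup>2"
      by (rule c_append)
    finally show ?thesis
      using that by (simp add: copies algebra_simps)
  qed
  have bound: "real (Suc k) * ((c gs)\<^sup>2 - (c rs)\<^sup>2) \<le> (c xs)\<^sup>2" for k
    by (rule pos) simp
  have "(c gs)\<^sup>2 \<le> (c rs)\<^sup>2"
  proof (rule ccontr)
    assume "\<not> (c gs)\<^sup>2 \<le> (c rs)\<^sup>2"
    then obtain k where "(c xs)\<^sup>2 < real k * ((c gs)\<^sup>2 - (c rs)\<^sup>2)"
      using reals_Archimedean3[of "(c gs)\<^sup>2 - (c rs)\<^sup>2"] by auto
    also have "\<dots> \<le> real (Suc k) * ((c gs)\<^sup>2 - (c rs)\<^sup>2)"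
      using \<open>\<not> (c gs)\<^sup>2 \<le> (c rs)\<^sup>2\<close> by (intro mult_right_mono) auto
    finally show False
      using bound[of k] by simp
  qed
  then show ?thesis
    by (rule power2_le_imp_le) (rule c_nonneg)
qed

text \<open>If p = r^2 e - \<open>tensor Z gs\<close> were in the cone, the catalyst bound would
  give c gs <= r. So there is a positive functional with \<phi> e = 1 and \<phi> p <= 0, and q is
  its polarization. The assumption \<open>unit\<close> makes e an order unit for all tensors, so
  that \<phi> is linear on them.\<close>

lemma separating_form:
  assumes es: "c es \<le> 1" and unit: "\<And>x. \<exists>t\<ge>0. dominated [x] (scale_list t es)"
    and r: "0 \<le> r" "r < c gs"
  shows "\<exists>q. psd_form UNIV q \<and>
    (\<forall>xs ys. dominated ys xs \<longrightarrow> (\<Sum>y\<leftarrow>ys. Re (q y y)) \<le> (\<Sum>x\<leftarrow>xs. Re (q x x))) \<and>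
    (\<Sum>e\<leftarrow>es. Re (q e e)) = 1 \<and> r\<^sup>2 \<le> (\<Sum>g\<leftarrow>gs. Re (q g g)) \<and>
    (\<forall>v v' w. (\<forall>z\<in>Z. v z = v' z) \<longrightarrow> q v w = q v' w)"
proof -
  define e where "e = tensor Z es"
  define p where "p = (r\<^sup>2) *\<^sub>r e - tensor Z gs"
  define D where "D = order_bounded cone e"
  have D_add: "u + v \<in> D" if "u \<in> D" "v \<in> D" for u v
    using that convex_cone order_bounded_add by (auto simp: D_def)
  have D_scale: "t *\<^sub>r u \<in> D" if "u \<in> D" for u t
    using that convex_cone order_bounded_scale by (auto simp: D_def)
  have D_single: "tensor Z [x] \<in> D" for x
  proof -
    obtain t where t: "t \<ge> 0" "dominated [x] (scale_list t es)"
      using unit by blast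
    then have "tensor Z (scale_list t es) - tensor Z [x] \<in> cone"
      unfolding cone_def by blast
    moreover have "tensor Z (scale_list t es @ [x]) \<in> cone"
      by (rule tensor_mem_cone)
    ultimately have "t\<^sup>2 *\<^sub>r e - tensor Z [x] \<in> cone" "t\<^sup>2 *\<^sub>r e + tensor Z [x] \<in> cone"
      by (simp_all only: e_def tensor_append tensor_scale)
    then show ?thesis
      unfolding D_def order_bounded_def by (intro CollectI exI[of _ "t\<^sup>2"]) auto
  qed
  have D_zero: "0 \<in> D"
    using D_scale[OF D_single, of 0] by simp
  have D_tensor: "tensor Z xs \<in> D" for xs
  proof (induction xs)
    case Nil
    show ?case
      unfolding tensor_Nil by (rule D_zero)
  next
    case (Cons x xs)
    then show ?case
      unfolding tensor_Cons[of Z x xs] by (intro D_add D_single)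
  qed
  have p_D: "p \<in> D"
  proof -
    have "(r\<^sup>2) *\<^sub>r e + (- 1) *\<^sub>r tensor Z gs \<in> D"
      by (intro D_add D_scale) (simp_all add: e_def D_tensor)
    then show ?thesis
      by (simp add: p_def scaleC_minus_one)
  qed
  have "p \<notin> cone"
  proof
    assume "p \<in> cone"
    then obtain xs ys where xy: "p = tensor Z xs - tensor Z ys" "dominated ys xs"
      unfolding cone_def by blast
    have "tensor Z (gs @ xs) = tensor Z (scale_list r es @ ys)"
      using xy(1) by (simp add: tensor_append tensor_scale p_def e_def algebra_simps)
    then have "c gs \<le> c (scale_list r es)"
      using catalyst_bound xy(2) by blast
    also have "\<dots> \<le> r * c es"
      using r(1) by (rule c_scale)
    also have "\<dots> \<le> r"
      using es r by (simp add: mult_left_le)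
    finally show False
      using r by simp
  qed
  moreover have "e \<in> cone"
    by (simp add: e_def tensor_mem_cone)
  ultimately obtain \<phi> :: "('z \<times> 'z \<Rightarrow> complex) \<Rightarrow> real" where
    \<phi>_add: "\<And>u v. u \<in> D \<Longrightarrow> v \<in> D \<Longrightarrow> \<phi> (u + v) = \<phi> u + \<phi> v" and
    \<phi>_scale: "\<And>t u. u \<in> D \<Longrightarrow> \<phi> (t *\<^sub>r u) = t * \<phi> u" and
    \<phi>_pos: "\<And>w. w \<in> cone \<Longrightarrow> w \<in> D \<Longrightarrow> 0 \<le> \<phi> w" and
    \<phi>_e: "\<phi> e = 1" and \<phi>_p: "\<phi> p \<le> 0"
    using positive_functional_exists[OF convex_cone, of e p] p_D unfolding D_def by blast
  have \<phi>_diff: "\<phi> (u - v) = \<phi> u - \<phi> v" if "u \<in> D" "v \<in> D" for u v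
    using \<phi>_add[of u "(- 1) *\<^sub>r v"] \<phi>_scale[of v "- 1"] D_scale[OF that(2), of "- 1"] that
    by (simp add: scaleC_minus_one)
  \<comment> \<open>The Hermitian part of the rank one matrix of v and w. By polarization it is a
    real combination of two tensors and so lies in the domain D of \<phi>.\<close>
  define B where "B v w = (\<lambda>(z, z'). if z \<in> Z \<and> z' \<in> Z
      then (v z * cnj (w z') + w z * cnj (v z')) / 2 else 0)" for v w :: "'z \<Rightarrow> complex"
  have B_polar: "B v w = (1 / 4) *\<^sub>r tensor Z [v + w] + (- (1 / 4)) *\<^sub>r tensor Z [v - w]" for v w
    by (auto simp: B_def tensor_def fun_eq_iff scaleC_fun_def field_simps)
  have B_D: "B v w \<in> D" for v w
    unfolding B_polar by (intro D_add D_scale D_tensor)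
  have B_add: "B (u + v) w = B u w + B v w" for u v w
    by (auto simp: B_def fun_eq_iff field_simps)
  have B_scale: "B (t *\<^sub>r v) w = t *\<^sub>r B v w" for t v w
    by (auto simp: B_def fun_eq_iff scaleC_fun_def field_simps)
  have B_sym: "B v w = B w v" for v w
    by (auto simp: B_def fun_eq_iff field_simps)
  have B_i: "B (\<i> *\<^sub>C v) w = (- 1) *\<^sub>r B v (\<i> *\<^sub>C w)" for v w
    by (auto simp: B_def fun_eq_iff scaleC_fun_def field_simps)
  have B_ii: "B (\<i> *\<^sub>C v) (\<i> *\<^sub>C w) = B v w" for v w
    by (auto simp: B_def fun_eq_iff scaleC_fun_def field_simps)
  have B_self: "B v v = tensor Z [v]" for v
    by (auto simp: B_def tensor_def fun_eq_iff)
  \<comment> \<open>\<phi> supplies only the real part of the form; the imaginary part follows from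
    Im (q v w) = Re (q v (i w)), q being conjugate linear in w.\<close>
  define q where "q v w = Complex (\<phi> (B v w)) (\<phi> (B v (\<i> *\<^sub>C w)))" for v w
  have \<phi>B_add: "\<phi> (B (u + v) w) = \<phi> (B u w) + \<phi> (B v w)" for u v w
    by (simp only: B_add \<phi>_add[OF B_D B_D])
  have \<phi>B_scale: "\<phi> (B (t *\<^sub>r v) w) = t * \<phi> (B v w)" for t v w
    by (simp only: B_scale \<phi>_scale[OF B_D])
  have \<phi>B_i: "\<phi> (B (\<i> *\<^sub>C v) w) = - \<phi> (B v (\<i> *\<^sub>C w))" for v w
    by (simp only: B_i \<phi>_scale[OF B_D])
  have q_self: "Re (q v v) = \<phi> (tensor Z [v])" for v
    by (simp add: q_def B_self)
  have "psd_form UNIV q"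
  proof (rule psd_form_UNIV_I)
    fix u v w :: "'z \<Rightarrow> complex" and a :: complex
    show "q (u + v) w = q u w + q v w"
      by (simp add: q_def \<phi>B_add complex_eq_iff)
    show "q v u = cnj (q u v)"
      using \<phi>B_i[of u v] B_sym[of v u] B_sym[of v "\<i> *\<^sub>C u"] by (simp add: q_def complex_eq_iff)
    show "0 \<le> Re (q u u)"
      unfolding q_self by (intro \<phi>_pos tensor_mem_cone D_tensor)
    have "a *\<^sub>C u = Re a *\<^sub>r u + Im a *\<^sub>r (\<i> *\<^sub>C u)"
      by (simp add: scaleC_scaleC flip: scaleC_add_left) (metis complex_eq mult.commute)
    then have *: "\<phi> (B (a *\<^sub>C u) w) = Re a * \<phi> (B u w) - Im a * \<phi> (B u (\<i> *\<^sub>C w))" for w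
      by (simp add: \<phi>B_add \<phi>B_scale \<phi>B_i)
    show "q (a *\<^sub>C u) v = a * q u v"
    proof -
      have "B u (\<i> *\<^sub>C \<i> *\<^sub>C v) = (- 1) *\<^sub>r B u v"
        by (auto simp: B_def fun_eq_iff scaleC_fun_def field_simps)
      then have "\<phi> (B u (\<i> *\<^sub>C \<i> *\<^sub>C v)) = - \<phi> (B u v)"
        by (simp only: \<phi>_scale[OF B_D])
      then show ?thesis
        by (simp add: q_def complex_eq_iff * algebra_simps)
    qed
  qed
  moreover have q_list: "(\<Sum>x\<leftarrow>xs. Re (q x x)) = \<phi> (tensor Z xs)" for xs
  proof (induction xs)
    case Nil
    have "0 *\<^sub>r tensor Z [] = tensor Z []"
      by (simp only: tensor_Nil scaleC_zero_right)
    then have "\<phi> (tensor Z []) = 0"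
      using \<phi>_scale[OF D_tensor, of 0 "[]"] by (simp only: mult_zero_left)
    then show ?case
      by (simp only: list.map sum_list.Nil)
  next
    case (Cons x xs)
    then show ?case
      by (simp only: tensor_Cons[of Z x xs] \<phi>_add[OF D_single[of x] D_tensor[of xs]]
          list.map sum_list.Cons q_self)
  qed
  moreover have "\<phi> (tensor Z ys) \<le> \<phi> (tensor Z xs)" if dom: "dominated ys xs" for xs ys
  proof -
    have "tensor Z xs - tensor Z ys \<in> cone"
      unfolding cone_def using dom by blast
    moreover have "tensor Z xs - tensor Z ys \<in> D"
      using D_add[OF D_tensor D_scale[OF D_tensor], of xs "- 1" ys]
      by (simp add: scaleC_minus_one)
    ultimately have "0 \<le> \<phi> (tensor Z xs - tensor Z ys)"
      by (rule \<phi>_pos)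
    then show ?thesis
      by (simp add: \<phi>_diff D_tensor)
  qed
  moreover have "r\<^sup>2 \<le> \<phi> (tensor Z gs)"
  proof -
    have "\<phi> p = r\<^sup>2 * \<phi> e - \<phi> (tensor Z gs)"
      using D_scale[OF D_tensor, of "r\<^sup>2" es] \<phi>_scale[OF D_tensor, of "r\<^sup>2" es] D_tensor[of gs]
      by (simp only: p_def e_def \<phi>_diff)
    then show ?thesis
      using \<phi>_p \<phi>_e by simp
  qed
  moreover have "q v w = q v' w" if "\<forall>z\<in>Z. v z = v' z" for v v' w
  proof -
    have "B v w = B v' w" for w
      using that by (auto simp: B_def fun_eq_iff)
    then show ?thesis
      by (simp add: q_def)
  qed
  ultimately show ?thesis
    using \<phi>_e by (intro exI[of _ q]) (simp add: e_def)
qed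

end

section \<open>Contractive scalar matrices\<close>

lemma contractive_pad:
  assumes U: "contractive m n U" and "m \<le> m'" and "n \<le> n'"
  shows "contractive m' n' (\<lambda>i k. if i < m \<and> k < n then U i k else 0)"
  unfolding contractive_def
proof
  fix \<xi> :: "nat \<Rightarrow> complex"
  have inner: "(\<Sum>k<n'. (if i < m \<and> k < n then U i k else 0) * \<xi> k) =
      (if i < m then \<Sum>k<n. U i k * \<xi> k else 0)" for i
  proof (cases "i < m")
    case True
    have "(\<Sum>k<n'. (if i < m \<and> k < n then U i k else 0) * \<xi> k) = (\<Sum>k<n. U i k * \<xi> k)"
      using assms(3) True by (intro sum.mono_neutral_cong_right) auto
    then show ?thesis
      using True by simp
  qed simp
  have "(\<Sum>i<m'. (cmod (\<Sum>k<n'. (if i < m \<and> k < n then U i k else 0) * \<xi> k))\<^sup>2) =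
      (\<Sum>i<m. (cmod (\<Sum>k<n. U i k * \<xi> k))\<^sup>2)"
    unfolding inner using assms(2) by (intro sum.mono_neutral_cong_right) auto
  also have "\<dots> \<le> (\<Sum>k<n. (cmod (\<xi> k))\<^sup>2)"
    using U by (simp add: contractive_def)
  also have "\<dots> \<le> (\<Sum>k<n'. (cmod (\<xi> k))\<^sup>2)"
    using assms(3) by (intro sum_mono2) auto
  finally show "(\<Sum>i<m'. (cmod (\<Sum>k<n'. (if i < m \<and> k < n then U i k else 0) * \<xi> k))\<^sup>2) \<le>
      (\<Sum>k<n'. (cmod (\<xi> k))\<^sup>2)" .
qed

text \<open>Injectivity of f makes this a partial permutation matrix: coordinates are moved or
  dropped, never repeated.\<close>

lemma contractive_select:
  assumes "inj_on f {..<m}" and "f ` {..<m} \<subseteq> {..<n}" and "m \<le> m'"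
  shows "contractive m' n (\<lambda>i k. if i < m \<and> k = f i then 1 else 0)"
  unfolding contractive_def
proof
  fix \<xi> :: "nat \<Rightarrow> complex"
  have inner: "(\<Sum>k<n. (if i < m \<and> k = f i then 1 else 0) * \<xi> k) = (if i < m then \<xi> (f i) else 0)" for i
  proof (cases "i < m")
    case True
    then have "f i < n"
      using assms by auto
    then show ?thesis
      using True by (simp add: if_distrib[of "\<lambda>t. t * _"] cong: if_cong)
  qed simp
  have "(\<Sum>i<m'. (cmod (\<Sum>k<n. (if i < m \<and> k = f i then 1 else 0) * \<xi> k))\<^sup>2) =
      (\<Sum>i<m. (cmod (\<xi> (f i)))\<^sup>2)"
    unfolding inner using assms(3) by (intro sum.mono_neutral_cong_right) auto
  also have "\<dots> = (\<Sum>k\<in>f ` {..<m}. (cmod (\<xi> k))\<^sup>2)"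
    using assms(1) by (simp add: sum.reindex)
  also have "\<dots> \<le> (\<Sum>k<n. (cmod (\<xi> k))\<^sup>2)"
    using assms(2) by (intro sum_mono2) auto
  finally show "(\<Sum>i<m'. (cmod (\<Sum>k<n. (if i < m \<and> k = f i then 1 else 0) * \<xi> k))\<^sup>2) \<le>
      (\<Sum>k<n. (cmod (\<xi> k))\<^sup>2)" .
qed

lemma contractive_diag:
  assumes "p \<le> m" and "p \<le> n"
  shows "contractive m n (\<lambda>l j. if l = j \<and> j < p then 1 else 0)"
proof -
  have "(\<lambda>l j. if l = j \<and> j < p then 1 else 0) = (\<lambda>l j. if l < p \<and> j = l then 1 else (0 :: complex))"
    by (auto simp: fun_eq_iff)
  then show ?thesis
    using contractive_select[of "\<lambda>l. l" p n m] assms by auto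
qed

lemma contractive_row:
  assumes "(\<Sum>k<n. (cmod (a k))\<^sup>2) \<le> 1"
  shows "contractive 1 n (\<lambda>i k. a k)"
  unfolding contractive_def
proof
  fix \<xi> :: "nat \<Rightarrow> complex"
  interpret st: psd_form UNIV "\<lambda>v w :: nat \<Rightarrow> complex. \<Sum>k<n. v k * cnj (w k)"
    by (rule psd_form_standard)
  have sq: "Re (\<Sum>k<n. v k * cnj (v k)) = (\<Sum>k<n. (cmod (v k))\<^sup>2)" for v
    by (simp flip: complex_norm_square of_real_sum)
  have "(cmod (\<Sum>k<n. a k * \<xi> k))\<^sup>2 \<le> (\<Sum>k<n. (cmod (a k))\<^sup>2) * (\<Sum>k<n. (cmod (\<xi> k))\<^sup>2)"
    using st.cauchy_schwarz_sq[of a "\<lambda>k. cnj (\<xi> k)"] unfolding sq by simp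
  also have "\<dots> \<le> 1 * (\<Sum>k<n. (cmod (\<xi> k))\<^sup>2)"
    using assms by (intro mult_right_mono) (auto intro: sum_nonneg)
  finally show "(\<Sum>i<(1::nat). (cmod (\<Sum>k<n. a k * \<xi> k))\<^sup>2) \<le> (\<Sum>k<n. (cmod (\<xi> k))\<^sup>2)"
    by simp
qed

lemma contractive_column:
  assumes "(\<Sum>l<n. (cmod (b l))\<^sup>2) \<le> 1"
  shows "contractive n 1 (\<lambda>l j. b l)"
  unfolding contractive_def
proof
  fix \<xi> :: "nat \<Rightarrow> complex"
  have "(\<Sum>i<n. (cmod (\<Sum>k<1. b i * \<xi> k))\<^sup>2) = (\<Sum>i<n. (cmod (b i))\<^sup>2) * (cmod (\<xi> 0))\<^sup>2"
    by (simp add: norm_mult power_mult_distrib sum_distrib_right)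
  also have "\<dots> \<le> 1 * (cmod (\<xi> 0))\<^sup>2"
    using assms by (intro mult_right_mono) auto
  finally show "(\<Sum>i<n. (cmod (\<Sum>k<1. b i * \<xi> k))\<^sup>2) \<le> (\<Sum>k<1. (cmod (\<xi> k))\<^sup>2)"
    by simp
qed

section \<open>Contractive matrices and the operator norm\<close>

lemma vec_norm2_sq: "(vec_norm2 v)\<^sup>2 = (\<Sum>i<dim_vec v. (cmod (vec_index v i))\<^sup>2)"
  by (simp add: vec_norm2_def L2_set_def sum_nonneg)

lemma vec_norm2_nonneg: "0 \<le> vec_norm2 v"
  by (simp add: vec_norm2_def)

lemma index_mult_mat_vec_sum:
  "i < dim_row L \<Longrightarrow> dim_vec v = dim_col L \<Longrightarrow>
    vec_index (L *\<^sub>v v) i = (\<Sum>k<dim_col L. L $$ (i, k) * vec_index v k)"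
  by (simp add: scalar_prod_def lessThan_atLeast0)

lemma op_norm_le:
  assumes "0 \<le> t" and "\<And>v. v \<in> carrier_vec (dim_col L) \<Longrightarrow> vec_norm2 (L *\<^sub>v v) \<le> t * vec_norm2 v"
  shows "op_norm L \<le> t"
  unfolding op_norm_def
proof (rule cSup_least)
  show "{vec_norm2 (L *\<^sub>v v) |v. v \<in> carrier_vec (dim_col L) \<and> vec_norm2 v \<le> 1} \<noteq> {}"
    using zero_carrier_vec[of "dim_col L"]
    by (auto simp: vec_norm2_def L2_set_def intro!: exI[of _ "0\<^sub>v (dim_col L)"])
  fix x assume "x \<in> {vec_norm2 (L *\<^sub>v v) |v. v \<in> carrier_vec (dim_col L) \<and> vec_norm2 v \<le> 1}"
  then obtain v where v: "x = vec_norm2 (L *\<^sub>v v)" "v \<in> carrier_vec (dim_col L)" "vec_norm2 v \<le> 1"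
    by blast
  then have "x \<le> t * vec_norm2 v"
    using assms(2) by simp
  also have "\<dots> \<le> t"
    using v assms(1) by (simp add: mult_left_le)
  finally show "x \<le> t" .
qed

text \<open>The a priori bound t makes the set of values bounded above; without such a bound a real
  \<open>Sup\<close> carries no information.\<close>

lemma op_norm_ge:
  assumes t: "0 \<le> t" "\<And>v. v \<in> carrier_vec (dim_col L) \<Longrightarrow> vec_norm2 (L *\<^sub>v v) \<le> t * vec_norm2 v"
    and v: "v \<in> carrier_vec (dim_col L)" "vec_norm2 v \<le> 1"
  shows "vec_norm2 (L *\<^sub>v v) \<le> op_norm L"
  unfolding op_norm_def
proof (rule cSup_upper)
  show "bdd_above {vec_norm2 (L *\<^sub>v v) |v. v \<in> carrier_vec (dim_col L) \<and> vec_norm2 v \<le> 1}"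
  proof (rule bdd_aboveI[of _ t])
    fix x assume "x \<in> {vec_norm2 (L *\<^sub>v v) |v. v \<in> carrier_vec (dim_col L) \<and> vec_norm2 v \<le> 1}"
    then obtain v where v: "x = vec_norm2 (L *\<^sub>v v)" "v \<in> carrier_vec (dim_col L)" "vec_norm2 v \<le> 1"
      by blast
    then have "x \<le> t * vec_norm2 v"
      using t(2) by simp
    also have "\<dots> \<le> t"
      using v t(1) by (simp add: mult_left_le)
    finally show "x \<le> t" .
  qed
qed (use v in blast)

lemma contractive_vec_norm2:
  assumes "contractive m n L" and v: "v \<in> carrier_vec n"
  shows "vec_norm2 (mat m n (\<lambda>(i, j). L i j) *\<^sub>v v) \<le> vec_norm2 v"
proof (rule power2_le_imp_le)
  let ?L = "mat m n (\<lambda>(i, j). L i j)"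
  have "(vec_norm2 (?L *\<^sub>v v))\<^sup>2 = (\<Sum>i<m. (cmod (\<Sum>k<n. L i k * vec_index v k))\<^sup>2)"
    unfolding vec_norm2_sq using v
    by (intro sum.cong) (auto simp: index_mult_mat_vec_sum simp del: index_mult_mat_vec)
  also have "\<dots> \<le> (vec_norm2 v)\<^sup>2"
    using assms by (simp add: contractive_def vec_norm2_sq)
  finally show "(vec_norm2 (?L *\<^sub>v v))\<^sup>2 \<le> (vec_norm2 v)\<^sup>2" .
qed (rule vec_norm2_nonneg)

lemma contractive_op_norm:
  assumes "contractive m n L"
  shows "0 \<le> op_norm (mat m n (\<lambda>(i, j). L i j))" "op_norm (mat m n (\<lambda>(i, j). L i j)) \<le> 1"
proof -
  let ?L = "mat m n (\<lambda>(i, j). L i j)"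
  have le: "vec_norm2 (?L *\<^sub>v v) \<le> 1 * vec_norm2 v" if "v \<in> carrier_vec (dim_col ?L)" for v
    using contractive_vec_norm2[OF assms, of v] that by simp
  show "op_norm ?L \<le> 1"
    by (rule op_norm_le[OF zero_le_one le])
  have "vec_norm2 (?L *\<^sub>v 0\<^sub>v n) \<le> op_norm ?L"
    by (rule op_norm_ge[OF zero_le_one le]) (auto simp: vec_norm2_def L2_set_def)
  then show "0 \<le> op_norm ?L"
    using vec_norm2_nonneg order_trans by blast
qed

section \<open>Quotient norms\<close>

lemma Mat_iff: "G \<in> Mat A n \<longleftrightarrow> G \<in> carrier_mat n n \<and> (\<forall>i<n. \<forall>j<n. G $$ (i, j) \<in> A)"
  by (auto simp: Mat_def dest!: elements_matD)

lemma Mat_matI: "(\<And>i j. i < n \<Longrightarrow> j < n \<Longrightarrow> f (i, j) \<in> A) \<Longrightarrow> mat n n f \<in> Mat A n"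
  by (simp add: Mat_iff)

lemma index_mult_mat_sum:
  assumes "G \<in> carrier_mat m n" "H \<in> carrier_mat n p" "i < m" "j < p"
  shows "(G * H) $$ (i, j) = (\<Sum>k<n. G $$ (i, k) * H $$ (k, j))"
  using assms by (simp add: scalar_prod_def lessThan_atLeast0)

definition block_sum ::
    "nat \<Rightarrow> (nat \<Rightarrow> nat \<Rightarrow> 'x \<Rightarrow> complex) \<Rightarrow> (nat \<Rightarrow> nat \<Rightarrow> 'x \<Rightarrow> complex) \<Rightarrow> nat \<Rightarrow> nat \<Rightarrow> 'x \<Rightarrow> complex"
  where "block_sum m G H i j =
    (if i < m \<and> j < m then G i j else if \<not> i < m \<and> \<not> j < m then H (i - m) (j - m) else 0)"

definition lifts ::
    "('x \<Rightarrow> complex) set \<Rightarrow> 'x set \<Rightarrow> nat \<Rightarrow> (nat \<Rightarrow> nat \<Rightarrow> 'x \<Rightarrow> complex) \<Rightarrow> ('x \<Rightarrow> complex) mat set"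
  where "lifts A F n G = {H \<in> Mat A n. \<forall>i<n. \<forall>j<n. \<forall>x\<in>F. (H $$ (i, j)) x = G i j x}"

text \<open>The quotient norm of M_n(A / I_F), for matrices with arbitrary functions as entries: by
  interpolation every function on a finite F is the restriction of an element of A, so a lift always
  exists, and only the values on F count.\<close>

definition restr_norm ::
    "('x \<Rightarrow> complex) set \<Rightarrow> (('x \<Rightarrow> complex) mat \<Rightarrow> real) \<Rightarrow> 'x set \<Rightarrow> nat \<Rightarrow>
     (nat \<Rightarrow> nat \<Rightarrow> 'x \<Rightarrow> complex) \<Rightarrow> real"
  where "restr_norm A nrm F n G = Inf (nrm ` lifts A F n G)"

section \<open>Interpolation and consequences of the axioms\<close>

locale function_operator_algebra =
  fixes A :: "('x \<Rightarrow> complex) set" and nrm :: "('x \<Rightarrow> complex) mat \<Rightarrow> real"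
  assumes operator_algebra: "operator_algebra_of_functions A nrm"
begin

lemma const_mem: "(\<lambda>_. c) \<in> A"
  and add_mem: "f \<in> A \<Longrightarrow> g \<in> A \<Longrightarrow> f + g \<in> A"
  and mult_mem: "f \<in> A \<Longrightarrow> g \<in> A \<Longrightarrow> f * g \<in> A"
  and separates: "x \<noteq> y \<Longrightarrow> \<exists>f\<in>A. f x \<noteq> f y"
  using operator_algebra
  by (auto simp: operator_algebra_of_functions_def function_algebra_def)

lemma zero_mem: "0 \<in> A" and one_mem: "1 \<in> A"
  using const_mem[of 0] const_mem[of 1] by (simp_all add: zero_fun_def one_fun_def)

lemma minus_mem: "f \<in> A \<Longrightarrow> - f \<in> A"
  using mult_mem[OF const_mem[of "-1"], of f] by (simp add: times_fun_def fun_Compl_def)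

lemma diff_mem: "f \<in> A \<Longrightarrow> g \<in> A \<Longrightarrow> f - g \<in> A"
  using add_mem[OF _ minus_mem, of f g] by simp

lemma sum_mem: "(\<And>i. i \<in> I \<Longrightarrow> f i \<in> A) \<Longrightarrow> (\<Sum>i\<in>I. f i) \<in> A"
  by (induction I rule: infinite_finite_induct) (simp_all add: zero_mem add_mem)

lemma power_mem: "f \<in> A \<Longrightarrow> f ^ n \<in> A"
  by (induction n) (simp_all add: one_mem mult_mem)

text \<open>Lagrange interpolation: for each z in F a separating g gives the factor (g - g z) / (g y
  - g z), which is 1 at y and 0 at z.\<close>

lemma interpolation_one:
  assumes "finite F" and "y \<notin> F"
  shows "\<exists>f\<in>A. f y = 1 \<and> (\<forall>x\<in>F. f x = 0)"
  using assms
proof (induction F rule: finite_induct)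
  case empty
  show ?case
    using const_mem[of 1] by force
next
  case (insert z F)
  then obtain f where f: "f \<in> A" "f y = 1" "\<forall>x\<in>F. f x = 0"
    by auto
  have "z \<noteq> y"
    using insert by auto
  then obtain g where g: "g \<in> A" "g z \<noteq> g y"
    using separates by blast
  define h where "h = (\<lambda>_. 1 / (g y - g z)) * (g - (\<lambda>_. g z))"
  have "h \<in> A"
    unfolding h_def by (intro mult_mem diff_mem const_mem g)
  moreover have "h y = 1" "h z = 0"
    using g by (simp_all add: h_def)
  ultimately show ?case
    using f by (intro bexI[of _ "f * h"]) (auto intro: mult_mem)
qed

lemma interpolation:
  assumes "finite F"
  shows "\<exists>f\<in>A. \<forall>x\<in>F. f x = h x"
proof -
  have "\<exists>f\<in>A. f y = 1 \<and> (\<forall>x\<in>F - {y}. f x = 0)" for y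
    using interpolation_one[of "F - {y}" y] assms by auto
  then obtain \<chi> where \<chi>: "\<And>y. \<chi> y \<in> A" "\<And>y. \<chi> y y = 1" "\<And>y x. x \<in> F - {y} \<Longrightarrow> \<chi> y x = 0"
    by metis
  define f where "f = (\<Sum>y\<in>F. (\<lambda>_. h y) * \<chi> y)"
  have "f \<in> A"
    unfolding f_def by (intro sum_mem mult_mem const_mem \<chi>)
  moreover have "f x = h x" if "x \<in> F" for x
  proof -
    have "f x = (\<Sum>y\<in>F. if y = x then h y else 0)"
      unfolding f_def sum_fun_apply using \<chi> that by (intro sum.cong) auto
    then show ?thesis
      using assms that by simp
  qed
  ultimately show ?thesis by blast
qed

lemma nrm_nonneg: "n > 0 \<Longrightarrow> G \<in> Mat A n \<Longrightarrow> 0 \<le> nrm G"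
  and nrm_eq_0: "n > 0 \<Longrightarrow> G \<in> Mat A n \<Longrightarrow> nrm G = 0 \<longleftrightarrow> G = 0\<^sub>m n n"
  and nrm_smult: "n > 0 \<Longrightarrow> G \<in> Mat A n \<Longrightarrow> nrm ((\<lambda>_. c) \<cdot>\<^sub>m G) = cmod c * nrm G"
  using operator_algebra by (auto simp: operator_algebra_of_functions_def matrix_norms_def)

lemma nrm_scalar: "m > 0 \<Longrightarrow> n > 0 \<Longrightarrow> G \<in> Mat A n \<Longrightarrow> L \<in> carrier_mat m n \<Longrightarrow> M \<in> carrier_mat n m \<Longrightarrow>
    nrm (scalar_matrix L * G * scalar_matrix M) \<le> op_norm L * nrm G * op_norm M"
  and nrm_direct_sum: "m > 0 \<Longrightarrow> n > 0 \<Longrightarrow> G \<in> Mat A m \<Longrightarrow> H \<in> Mat A n \<Longrightarrow>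
    nrm (direct_sum G H) = max (nrm G) (nrm H)"
  and nrm_mult: "n > 0 \<Longrightarrow> G \<in> Mat A n \<Longrightarrow> H \<in> Mat A n \<Longrightarrow> nrm (G * H) \<le> nrm G * nrm H"
  and nrm_one: "nrm (singleton_mat 1) = 1"
  using operator_algebra by (auto simp: operator_algebra_of_functions_def BRS_axioms_def)

lemma evaluation_bounded: "\<exists>C. \<forall>f\<in>A. cmod (f x) \<le> C * nrm (singleton_mat f)"
  using operator_algebra by (auto simp: operator_algebra_of_functions_def)

lemma scalar_sandwich_index:
  assumes "H \<in> Mat A n" "i < m" "j < m"
  shows "((scalar_matrix (mat m n (\<lambda>(i, j). L i j)) * H * scalar_matrix (mat n m (\<lambda>(i, j). M i j)))
      $$ (i, j)) x = (\<Sum>k<n. \<Sum>l<n. L i k * (H $$ (k, l)) x * M l j)"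
    (is "((?L * H * ?M) $$ _) x = _")
proof -
  have c: "?L \<in> carrier_mat m n" "H \<in> carrier_mat n n" "?M \<in> carrier_mat n m"
    using assms by (auto simp: scalar_matrix_def Mat_iff)
  have LH: "?L * H \<in> carrier_mat m n"
    using c by auto
  have "((?L * H * ?M) $$ (i, j)) x = (\<Sum>l<n. (\<Sum>k<n. (?L $$ (i, k)) x * (H $$ (k, l)) x) * (?M $$ (l, j)) x)"
    unfolding index_mult_mat_sum[OF LH c(3) assms(2,3)] sum_fun_apply times_fun_apply
    using index_mult_mat_sum[OF c(1,2) assms(2)] by (intro sum.cong) (simp_all add: sum_fun_apply)
  also have "\<dots> = (\<Sum>l<n. (\<Sum>k<n. L i k * (H $$ (k, l)) x) * M l j)"
    using assms by (intro sum.cong arg_cong2[where f = "(*)"]) (auto simp: scalar_matrix_def)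
  also have "\<dots> = (\<Sum>l<n. \<Sum>k<n. L i k * (H $$ (k, l)) x * M l j)"
    by (simp add: sum_distrib_right)
  also have "\<dots> = (\<Sum>k<n. \<Sum>l<n. L i k * (H $$ (k, l)) x * M l j)"
    by (rule sum.swap)
  finally show ?thesis .
qed

text \<open>Compressing, padding and permuting rows or columns are all instances of this two-sided
  multiplication, which is why rectangular L and M are allowed.\<close>

lemma nrm_contractive:
  assumes "m > 0" "n > 0" and H: "H \<in> Mat A n" and L: "contractive m n L" and M: "contractive n m M"
  shows "\<exists>H'\<in>Mat A m. nrm H' \<le> nrm H \<and>
    (\<forall>i<m. \<forall>j<m. \<forall>x. (H' $$ (i, j)) x = (\<Sum>k<n. \<Sum>l<n. L i k * (H $$ (k, l)) x * M l j))"
proof -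
  define L' where "L' = mat m n (\<lambda>(i, j). L i j)"
  define M' where "M' = mat n m (\<lambda>(i, j). M i j)"
  define H' where "H' = scalar_matrix L' * H * scalar_matrix M'"
  have ix: "(H' $$ (i, j)) x = (\<Sum>k<n. \<Sum>l<n. L i k * (H $$ (k, l)) x * M l j)"
    if "i < m" "j < m" for i j x
    unfolding H'_def L'_def M'_def using scalar_sandwich_index[OF H that] .
  have "H' $$ (i, j) \<in> A" if "i < m" "j < m" for i j
  proof -
    have "H' $$ (i, j) = (\<Sum>k<n. \<Sum>l<n. (\<lambda>_. L i k) * H $$ (k, l) * (\<lambda>_. M l j))"
      using that by (simp add: fun_eq_iff ix sum_fun_apply)
    then show ?thesis
      using H by (auto intro!: sum_mem mult_mem const_mem simp: Mat_iff)
  qed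
  moreover have "H' \<in> carrier_mat m m"
    using H by (auto simp: H'_def L'_def M'_def scalar_matrix_def Mat_iff)
  ultimately have mem: "H' \<in> Mat A m"
    by (simp add: Mat_iff)
  have "nrm H' \<le> op_norm L' * nrm H * op_norm M'"
    unfolding H'_def using assms by (intro nrm_scalar) (auto simp: L'_def M'_def)
  also have "\<dots> \<le> 1 * nrm H * 1"
    using contractive_op_norm[OF L] contractive_op_norm[OF M] nrm_nonneg[OF assms(2) H]
    by (intro mult_mono) (auto simp: L'_def M'_def)
  finally show ?thesis
    using mem ix by auto
qed

lemma direct_sum_index:
  assumes "G \<in> carrier_mat m m" "H \<in> carrier_mat n n" "i < m + n" "j < m + n"
  shows "(direct_sum G H $$ (i, j)) x = block_sum m (\<lambda>i j. G $$ (i, j)) (\<lambda>i j. H $$ (i, j)) i j x"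
  using assms by (auto simp: direct_sum_def block_sum_def)

lemma direct_sum_mem:
  assumes G: "G \<in> Mat A m" and H: "H \<in> Mat A n"
  shows "direct_sum G H \<in> Mat A (m + n)"
proof -
  have c: "G \<in> carrier_mat m m" "H \<in> carrier_mat n n"
    using assms by (auto simp: Mat_iff)
  have "direct_sum G H $$ (i, j) \<in> A" if "i < m + n" "j < m + n" for i j
  proof -
    have "direct_sum G H $$ (i, j) = block_sum m (\<lambda>i j. G $$ (i, j)) (\<lambda>i j. H $$ (i, j)) i j"
      using direct_sum_index[OF c that] by (simp add: fun_eq_iff)
    then show ?thesis
      using assms that by (auto simp: block_sum_def Mat_iff zero_mem)
  qed
  then show ?thesis
    using c by (auto simp: Mat_iff direct_sum_def)
qed

lemma one_mem_Mat: "1\<^sub>m n \<in> Mat A n"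
  by (auto simp: Mat_iff zero_mem one_mem)

lemma nrm_one_mat: "n > 0 \<Longrightarrow> nrm (1\<^sub>m n) \<le> 1"
proof (induction n)
  case (Suc n)
  have s: "singleton_mat (1 :: 'x \<Rightarrow> complex) = 1\<^sub>m 1"
    by (auto simp: singleton_mat_def)
  show ?case
  proof (cases "n = 0")
    case True
    then show ?thesis
      using nrm_one s by simp
  next
    case False
    have "(1\<^sub>m (Suc n) :: ('x \<Rightarrow> complex) mat) = direct_sum (1\<^sub>m n) (1\<^sub>m 1)"
      by (auto simp: direct_sum_def)
    then have "nrm (1\<^sub>m (Suc n)) = max (nrm (1\<^sub>m n)) (nrm (1\<^sub>m 1))"
      using False nrm_direct_sum[OF _ _ one_mem_Mat one_mem_Mat, of n 1] by simp
    then show ?thesis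
      using Suc False nrm_one s by simp
  qed
qed simp

end

section \<open>The quotient norm over a finite set of points\<close>

locale function_operator_algebra_restriction = function_operator_algebra A nrm
  for A :: "('x \<Rightarrow> complex) set" and nrm +
  fixes F :: "'x set"
  assumes finite_F: "finite F"
begin

abbreviation rn where "rn \<equiv> restr_norm A nrm F"

lemma lifts_nonempty: "lifts A F n G \<noteq> {}"
proof -
  obtain f where f: "\<And>h. f h \<in> A" "\<And>h x. x \<in> F \<Longrightarrow> f h x = h x"
    using interpolation[OF finite_F] by metis
  have "mat n n (\<lambda>(i, j). f (G i j)) \<in> lifts A F n G"
    using f by (auto simp: lifts_def intro!: Mat_matI)
  then show ?thesis by blast
qed

lemma bdd_below_lifts: "n > 0 \<Longrightarrow> bdd_below (nrm ` lifts A F n G)"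
  by (auto simp: bdd_below_def lifts_def intro!: exI[of _ 0] nrm_nonneg)

lemma rn_nonneg: "n > 0 \<Longrightarrow> 0 \<le> rn n G"
  unfolding restr_norm_def using lifts_nonempty
  by (intro cInf_greatest) (auto simp: lifts_def intro: nrm_nonneg)

lemma rn_le: "n > 0 \<Longrightarrow> H \<in> lifts A F n G \<Longrightarrow> rn n G \<le> nrm H"
  unfolding restr_norm_def by (intro cInf_lower bdd_below_lifts) auto

lemma rn_lessD: "n > 0 \<Longrightarrow> rn n G < t \<Longrightarrow> \<exists>H\<in>lifts A F n G. nrm H < t"
  unfolding restr_norm_def using cInf_less_iff[OF _ bdd_below_lifts, of n G t] lifts_nonempty
  by auto

lemma rn_le_rn:
  assumes "m > 0" "n > 0" and "\<And>H. H \<in> lifts A F n G \<Longrightarrow> \<exists>H'\<in>lifts A F m G'. nrm H' \<le> nrm H"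
  shows "rn m G' \<le> rn n G"
proof (rule field_le_epsilon)
  fix e :: real assume "e > 0"
  then obtain H where "H \<in> lifts A F n G" "nrm H < rn n G + e"
    using rn_lessD[of n G "rn n G + e"] assms by auto
  then show "rn m G' \<le> rn n G + e"
    using assms(3) rn_le[OF assms(1), of _ G'] by force
qed

lemma rn_contractive:
  assumes "m > 0" "n > 0" and L: "contractive m n L" and M: "contractive n m M"
    and G': "\<And>i j x. i < m \<Longrightarrow> j < m \<Longrightarrow> x \<in> F \<Longrightarrow>
      G' i j x = (\<Sum>k<n. \<Sum>l<n. L i k * G k l x * M l j)"
  shows "rn m G' \<le> rn n G"
proof (rule rn_le_rn[OF assms(1,2)])
  fix H assume H: "H \<in> lifts A F n G"
  then obtain H' where "H' \<in> Mat A m" "nrm H' \<le> nrm H"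
    "\<forall>i<m. \<forall>j<m. \<forall>x. (H' $$ (i, j)) x = (\<Sum>k<n. \<Sum>l<n. L i k * (H $$ (k, l)) x * M l j)"
    using nrm_contractive[OF assms(1,2) _ L M, of H] by (auto simp: lifts_def)
  then show "\<exists>H'\<in>lifts A F m G'. nrm H' \<le> nrm H"
    using H by (intro bexI[of _ H']) (auto simp: lifts_def G')
qed

lemma rn_cong:
  assumes "n > 0" "\<And>i j x. i < n \<Longrightarrow> j < n \<Longrightarrow> x \<in> F \<Longrightarrow> G i j x = G' i j x"
  shows "rn n G = rn n G'"
  using assms by (simp add: restr_norm_def lifts_def cong: conj_cong)

lemma rn_block_sum:
  assumes "m > 0" "n > 0"
  shows "rn (m + n) (block_sum m G H) \<le> max (rn m G) (rn n H)"
proof (rule field_le_epsilon)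
  fix e :: real assume "e > 0"
  then obtain G' H' where G': "G' \<in> lifts A F m G" "nrm G' < rn m G + e"
    and H': "H' \<in> lifts A F n H" "nrm H' < rn n H + e"
    using rn_lessD[of m G "rn m G + e"] rn_lessD[of n H "rn n H + e"] assms by auto
  have mem: "G' \<in> Mat A m" "H' \<in> Mat A n"
    using G' H' by (auto simp: lifts_def)
  then have c: "G' \<in> carrier_mat m m" "H' \<in> carrier_mat n n"
    by (auto simp: Mat_iff)
  have "direct_sum G' H' \<in> lifts A F (m + n) (block_sum m G H)"
    unfolding lifts_def
  proof (intro CollectI conjI direct_sum_mem mem allI impI ballI)
    fix i j x assume ij: "i < m + n" "j < m + n" and "x \<in> F"
    then show "(direct_sum G' H' $$ (i, j)) x = block_sum m G H i j x"
      using G' H' by (subst direct_sum_index[OF c ij]) (auto simp: lifts_def block_sum_def)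
  qed
  then have "rn (m + n) (block_sum m G H) \<le> nrm (direct_sum G' H')"
    using assms by (intro rn_le) auto
  also have "\<dots> = max (nrm G') (nrm H')"
    by (rule nrm_direct_sum[OF assms mem])
  finally show "rn (m + n) (block_sum m G H) \<le> max (rn m G) (rn n H) + e"
    using G' H' by linarith
qed

lemma rn_mult:
  assumes n: "n > 0" and le: "rn n G \<le> 1"
    and P: "\<And>i j x. i < n \<Longrightarrow> j < n \<Longrightarrow> x \<in> F \<Longrightarrow> P i j x = (\<Sum>k<n. G i k x * H k j x)"
  shows "rn n P \<le> rn n H"
proof (rule field_le_epsilon)
  fix e :: real assume e: "e > 0"
  define s where "s = rn n H + e / 2"
  have s: "s > 0"
    using rn_nonneg[OF n, of H] e by (simp add: s_def)
  \<comment> \<open>Lifts come only within an error of the infimum. The slack d is the solution of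
    (1 + d) s = rn n H + e.\<close>
  define d where "d = e / (2 * s)"
  have d: "d > 0"
    using e s by (simp add: d_def)
  obtain G' H' where G': "G' \<in> lifts A F n G" "nrm G' < 1 + d"
    and H': "H' \<in> lifts A F n H" "nrm H' < s"
    using rn_lessD[of n G "1 + d"] rn_lessD[of n H s] n le d e by (auto simp: s_def)
  have mem: "G' \<in> Mat A n" "H' \<in> Mat A n"
    using G' H' by (auto simp: lifts_def)
  then have c: "G' \<in> carrier_mat n n" "H' \<in> carrier_mat n n"
    by (auto simp: Mat_iff)
  have "G' * H' \<in> lifts A F n P"
    unfolding lifts_def Mat_iff
  proof (intro CollectI conjI allI impI ballI)
    show "G' * H' \<in> carrier_mat n n"
      using c by auto
    fix i j assume ij: "i < n" "j < n"
    show "(G' * H') $$ (i, j) \<in> A"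
      unfolding index_mult_mat_sum[OF c ij] using mem ij
      by (auto intro!: sum_mem mult_mem simp: Mat_iff)
    fix x assume "x \<in> F"
    then show "((G' * H') $$ (i, j)) x = P i j x"
      unfolding index_mult_mat_sum[OF c ij] using G' H' ij
      by (auto simp: sum_fun_apply lifts_def P)
  qed
  then have "rn n P \<le> nrm (G' * H')"
    by (rule rn_le[OF n])
  also have "\<dots> \<le> nrm G' * nrm H'"
    by (rule nrm_mult[OF n mem])
  also have "\<dots> \<le> (1 + d) * s"
    using G' H' n mem s d by (intro mult_mono) (auto intro: nrm_nonneg)
  also have "\<dots> = rn n H + e"
    using s by (simp add: s_def[symmetric] d_def field_simps) (simp add: s_def field_simps)
  finally show "rn n P \<le> rn n H + e" .
qed

lemma rn_one: "n > 0 \<Longrightarrow> rn n (\<lambda>i j x. if i = j then 1 else 0) \<le> 1"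
  by (rule order_trans[OF rn_le nrm_one_mat]) (auto simp: lifts_def one_mem_Mat)

lemma rn_scale:
  assumes n: "n > 0" and t: "t \<ge> 0"
  shows "rn n (\<lambda>i j x. complex_of_real t * G i j x) \<le> t * rn n G"
proof (rule field_le_epsilon)
  fix e :: real assume "e > 0"
  \<comment> \<open>The denominator is t + 1 because t may be 0.\<close>
  then obtain H where H: "H \<in> lifts A F n G" "nrm H < rn n G + e / (t + 1)"
    using rn_lessD[of n G "rn n G + e / (t + 1)"] n t by auto
  have mem: "H \<in> Mat A n"
    using H by (auto simp: lifts_def)
  have "(\<lambda>_. complex_of_real t) \<cdot>\<^sub>m H \<in> lifts A F n (\<lambda>i j x. complex_of_real t * G i j x)"
    using H by (auto simp: lifts_def Mat_iff intro!: mult_mem const_mem)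
  then have "rn n (\<lambda>i j x. complex_of_real t * G i j x) \<le> nrm ((\<lambda>_. complex_of_real t) \<cdot>\<^sub>m H)"
    by (rule rn_le[OF n])
  also have "\<dots> = t * nrm H"
    using nrm_smult[OF n mem] t by simp
  also have "\<dots> \<le> t * (rn n G + e / (t + 1))"
    using H t by (intro mult_left_mono) auto
  also have "\<dots> \<le> t * rn n G + e"
    using t \<open>e > 0\<close> by (simp add: algebra_simps divide_simps)
  finally show "rn n (\<lambda>i j x. complex_of_real t * G i j x) \<le> t * rn n G + e" .
qed

text \<open>A lift of the restricted entries of G differs from G by a matrix over the vanishing
  ideal.\<close>

lemma quotient_norm_le_rn:
  assumes n: "n > 0" and G: "G \<in> Mat A n"
  shows "quotient_norm A nrm F G \<le> rn n (\<lambda>i j. G $$ (i, j))"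
proof (rule field_le_epsilon)
  fix e :: real assume "e > 0"
  then obtain H where H: "H \<in> lifts A F n (\<lambda>i j. G $$ (i, j))"
    "nrm H < rn n (\<lambda>i j. G $$ (i, j)) + e"
    using rn_lessD[OF n, of "\<lambda>i j. G $$ (i, j)" "rn n (\<lambda>i j. G $$ (i, j)) + e"] by auto
  define K where "K = mat n n (\<lambda>(i, j). H $$ (i, j) - G $$ (i, j))"
  have c: "G \<in> carrier_mat n n" "H \<in> carrier_mat n n"
    using G H by (auto simp: Mat_iff lifts_def)
  have K: "K \<in> Mat (vanishing_ideal A F) (dim_row G)"
    using G H c by (auto simp: K_def vanishing_ideal_def lifts_def Mat_iff intro!: diff_mem)
  have "G + K = H"
    using c by (intro eq_matI) (auto simp: K_def)
  moreover have "bdd_below {nrm (G + H) |H. H \<in> Mat (vanishing_ideal A F) (dim_row G)}"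
    using G c n by (auto simp: bdd_below_def vanishing_ideal_def Mat_iff
        intro!: exI[of _ 0] nrm_nonneg[OF n] add_mem)
  ultimately have "quotient_norm A nrm F G \<le> nrm H"
    unfolding quotient_norm_def using K by (intro cInf_lower) auto
  then show "quotient_norm A nrm F G \<le> rn n (\<lambda>i j. G $$ (i, j)) + e"
    using H by simp
qed

end

section \<open>Columns of row vectors over the quotient algebra\<close>

lemma sum_diag:
  "p \<le> (N::nat) \<Longrightarrow> (\<Sum>l<N. a l * (if l = j \<and> j < p then 1 else 0)) = (if j < p then a j else (0::complex))"
proof -
  assume "p \<le> N"
  have "(\<Sum>l<N. a l * (if l = j \<and> j < p then 1 else 0)) = (\<Sum>l<N. if l = j then if j < p then a j else 0 else 0)"
    by (intro sum.cong) auto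
  then show ?thesis
    using \<open>p \<le> N\<close> by simp
qed

lemma sum_select:
  fixes f N :: nat
  assumes "P \<Longrightarrow> f < N"
  shows "(\<Sum>k<N. (if P \<and> k = f then 1 else 0) * a k) = (if P then a f else (0::complex))"
proof (cases P)
  case True
  have "(\<Sum>k<N. (if P \<and> k = f then 1 else 0) * a k) = (\<Sum>k<N. if k = f then a f else 0)"
    using True by (intro sum.cong) auto
  then show ?thesis
    using True assms by simp
qed simp

lemma sum_list_map_lessThan: "(\<Sum>x\<leftarrow>xs. f x) = (\<Sum>i<length xs. f (xs ! i))"
  by (simp add: sum_list_sum_nth lessThan_atLeast0)

text \<open>M_m(A) acting on columns of m row vectors. In z = (j, x) the number j is the position in
  the row and x the point; functions multiply through x alone.\<close>

definition fun_mat_act ::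
    "nat \<Rightarrow> (nat \<Rightarrow> nat \<Rightarrow> 'x \<Rightarrow> complex) \<Rightarrow> (nat \<Rightarrow> nat \<times> 'x \<Rightarrow> complex) \<Rightarrow> nat \<Rightarrow> nat \<times> 'x \<Rightarrow> complex"
  where "fun_mat_act m T b i = (\<lambda>z. \<Sum>k<m. T i k (snd z) * b k z)"

text \<open>The j-th generator of the free module of rows, with the constant function 1 in position
  j.\<close>

definition unit_row :: "nat \<Rightarrow> nat \<times> 'x \<Rightarrow> complex" where
  "unit_row j = (\<lambda>z. if fst z = j then 1 else 0)"

locale restricted_columns = function_operator_algebra_restriction A nrm F
  for A :: "('x \<Rightarrow> complex) set" and nrm F +
  fixes n :: nat
  assumes n_pos: "n > 0"
begin

abbreviation Z :: "(nat \<times> 'x) set" where "Z \<equiv> {..<n} \<times> F"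

text \<open>Columns are padded by zeros to square matrices, as \<open>nrm\<close> is only defined on those.\<close>

definition column :: "(nat \<times> 'x \<Rightarrow> complex) list \<Rightarrow> nat \<Rightarrow> nat \<Rightarrow> 'x \<Rightarrow> complex" where
  "column xs i j x = (if i < length xs \<and> j < n then (xs ! i) (j, x) else 0)"

text \<open>The size \<open>length xs + n\<close> has room for all rows and all n columns, and it is
  positive even for the empty list.\<close>

definition cn :: "(nat \<times> 'x \<Rightarrow> complex) list \<Rightarrow> real" where
  "cn xs = rn (length xs + n) (column xs)"

lemma cn_nonneg: "0 \<le> cn xs"
  unfolding cn_def using n_pos by (intro rn_nonneg) simp

lemma cn_contractive:
  assumes U: "contractive (length ys) (length xs) U"
    and ys: "\<And>i z. i < length ys \<Longrightarrow> z \<in> Z \<Longrightarrow> (ys ! i) z = (\<Sum>k<length xs. U i k * (xs ! k) z)"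
  shows "cn ys \<le> cn xs"
  unfolding cn_def
proof (rule rn_contractive)
  show "contractive (length ys + n) (length xs + n)
      (\<lambda>i k. if i < length ys \<and> k < length xs then U i k else 0)"
    by (rule contractive_pad[OF U]) auto
  show "contractive (length xs + n) (length ys + n) (\<lambda>l j. if l = j \<and> j < n then 1 else 0)"
    by (rule contractive_diag) auto
  fix i j x assume ij: "i < length ys + n" "j < length ys + n" and x: "x \<in> F"
  have "(\<Sum>k<length xs + n. \<Sum>l<length xs + n. (if i < length ys \<and> k < length xs then U i k else 0) *
      column xs k l x * (if l = j \<and> j < n then 1 else 0)) =
      (\<Sum>k<length xs + n. if j < n then (if i < length ys \<and> k < length xs then U i k else 0) * column xs k j x else 0)"
    by (intro sum.cong refl sum_diag) simp
  also have "\<dots> = (\<Sum>k<length xs. if i < length ys \<and> j < n then U i k * (xs ! k) (j, x) else 0)"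
    by (intro sum.mono_neutral_cong_right) (auto simp: column_def)
  also have "\<dots> = column ys i j x"
    using x by (auto simp: column_def ys)
  finally show "column ys i j x =
    (\<Sum>k<length xs + n. \<Sum>l<length xs + n. (if i < length ys \<and> k < length xs then U i k else 0) *
      column xs k l x * (if l = j \<and> j < n then 1 else 0))" by simp
qed (use n_pos in auto)

text \<open>Equality of Gram matrices supplies a contractive scalar matrix that takes the rows xs to
  the rows ys.\<close>

lemma cn_tensor_le:
  assumes "tensor Z xs = tensor Z ys"
  shows "cn ys \<le> cn xs"
proof -
  have "(\<Sum>i<length xs. (xs ! i) z * cnj ((xs ! i) z')) = (\<Sum>i<length ys. (ys ! i) z * cnj ((ys ! i) z'))"
    if "z \<in> Z" "z' \<in> Z" for z z'
    using fun_cong[OF assms, of "(z, z')"] that by (auto simp: tensor_def sum_list_map_lessThan)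
  then obtain U where "contractive (length ys) (length xs) U"
    "\<forall>i<length ys. \<forall>z\<in>Z. (ys ! i) z = (\<Sum>k<length xs. U i k * (xs ! k) z)"
    using gram_factorization[where Z = Z and p = "length xs" and X = "(!) xs" and q = "length ys" and Y = "(!) ys"]
      finite_F
    by blast
  then show ?thesis
    by (intro cn_contractive) auto
qed

text \<open>For a and b strictly above the two norms, so that division is possible even when a norm
  vanishes, the column of X over Y is s times the product of diag(X / a, Y / b), of norm at most 1,
  with the column of a / s over b / s, which is isometric when s^2 = a^2 + b^2.\<close>

lemma cn_append:
  "(cn (xs @ ys))\<^sup>2 \<le> (cn xs)\<^sup>2 + (cn ys)\<^sup>2"
proof -
  have bound: "cn (xs @ ys) \<le> sqrt (a\<^sup>2 + b\<^sup>2)" if a: "cn xs < a" and b: "cn ys < b" for a b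
  proof -
    have a0: "a > 0" and b0: "b > 0"
      using a b rn_nonneg[of "length xs + n" "column xs"] rn_nonneg[of "length ys + n" "column ys"] n_pos
      by (auto simp: cn_def)
    define s where "s = sqrt (a\<^sup>2 + b\<^sup>2)"
    have s: "s > 0" "s\<^sup>2 = a\<^sup>2 + b\<^sup>2"
      using a0 b0 by (auto simp: s_def add_pos_pos)
    define m1 m2 where "m1 = length xs" and "m2 = length ys"
    define X where "X = (\<lambda>i j x. complex_of_real (1 / a) * column xs i j x)"
    define Y where "Y = (\<lambda>i j x. complex_of_real (1 / b) * column ys i j x)"
    define N where "N = (m1 + n) + (m2 + n)"
    define D where "D = block_sum (m1 + n) X Y"
    have "rn (m1 + n) X \<le> (1 / a) * cn xs" "rn (m2 + n) Y \<le> (1 / b) * cn ys"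
      unfolding X_def Y_def cn_def m1_def m2_def using n_pos a0 b0 by (intro rn_scale; simp)+
    moreover have "(1 / a) * cn xs \<le> 1" "(1 / b) * cn ys \<le> 1"
      using a b a0 b0 by auto
    ultimately have "rn (m1 + n) X \<le> 1" "rn (m2 + n) Y \<le> 1"
      by linarith+
    then have D1: "rn N D \<le> 1"
      unfolding N_def D_def using rn_block_sum[of "m1 + n" "m2 + n" X Y] n_pos by simp
    \<comment> \<open>L picks the genuine rows of both padded blocks: those of Y start after the m1
      rows of X and its n rows of padding.\<close>
    define L :: "nat \<Rightarrow> nat \<Rightarrow> complex" where
      "L = (\<lambda>i k. if i < m1 + m2 \<and> k = (if i < m1 then i else i + n) then 1 else 0)"
    \<comment> \<open>Column j < n of M has the entry a / s in the first block and b / s in the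
      second; these columns are orthonormal.\<close>
    define M :: "nat \<Rightarrow> nat \<Rightarrow> complex" where
      "M = (\<lambda>l j. if j < n \<and> l = j then a / s else if j < n \<and> l = m1 + n + j then b / s else 0)"
    have L: "contractive (m1 + m2 + n) N L"
      unfolding L_def by (rule contractive_select) (auto simp: inj_on_def N_def split: if_splits)
    have M: "contractive N (m1 + m2 + n) M"
      unfolding contractive_def
    proof
      fix \<xi> :: "nat \<Rightarrow> complex"
      have M_apply: "(\<Sum>j<m1 + m2 + n. M l j * \<xi> j) =
          (if l < n then a / s * \<xi> l else if m1 + n \<le> l \<and> l < m1 + n + n then b / s * \<xi> (l - (m1 + n)) else 0)" for l
      proof -
        have "(\<Sum>j<m1 + m2 + n. M l j * \<xi> j) = (\<Sum>j<n. M l j * \<xi> j)"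
          by (intro sum.mono_neutral_right) (auto simp: M_def)
        also have "\<dots> = (\<Sum>j<n. (if j = l then a / s * \<xi> l else 0) +
            (if j = l - (m1 + n) \<and> m1 + n \<le> l then b / s * \<xi> (l - (m1 + n)) else 0))"
          by (intro sum.cong) (auto simp: M_def)
        also have "\<dots> = (if l < n then a / s * \<xi> l else 0) +
            (if m1 + n \<le> l \<and> l < m1 + n + n then b / s * \<xi> (l - (m1 + n)) else 0)"
          by (auto simp: sum.distrib)
        finally show ?thesis by auto
      qed
      have "(\<Sum>l<N. (cmod (\<Sum>j<m1 + m2 + n. M l j * \<xi> j))\<^sup>2) =
          (\<Sum>l\<in>{..<n} \<union> {m1 + n..<m1 + n + n}. (cmod (\<Sum>j<m1 + m2 + n. M l j * \<xi> j))\<^sup>2)"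
        unfolding M_apply by (intro sum.mono_neutral_right) (auto simp: N_def)
      also have "\<dots> = (\<Sum>l<n. (cmod (\<Sum>j<m1 + m2 + n. M l j * \<xi> j))\<^sup>2) +
          (\<Sum>l\<in>{m1 + n..<m1 + n + n}. (cmod (\<Sum>j<m1 + m2 + n. M l j * \<xi> j))\<^sup>2)"
        by (rule sum.union_disjoint) auto
      also have "(\<Sum>l<n. (cmod (\<Sum>j<m1 + m2 + n. M l j * \<xi> j))\<^sup>2) = (\<Sum>l<n. (a / s)\<^sup>2 * (cmod (\<xi> l))\<^sup>2)"
        unfolding M_apply using a0 s
        by (intro sum.cong) (auto simp: norm_mult norm_divide power_mult_distrib power_divide)
      also have "(\<Sum>l\<in>{m1 + n..<m1 + n + n}. (cmod (\<Sum>j<m1 + m2 + n. M l j * \<xi> j))\<^sup>2) =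
          (\<Sum>l<n. (cmod (\<Sum>j<m1 + m2 + n. M (m1 + n + l) j * \<xi> j))\<^sup>2)"
        by (rule sum.reindex_bij_witness[of _ "\<lambda>l. m1 + n + l" "\<lambda>l. l - (m1 + n)"]) auto
      also have "\<dots> = (\<Sum>l<n. (b / s)\<^sup>2 * (cmod (\<xi> l))\<^sup>2)"
        unfolding M_apply using b0 s
        by (intro sum.cong) (auto simp: norm_mult norm_divide power_mult_distrib power_divide)
      also have "(\<Sum>l<n. (a / s)\<^sup>2 * (cmod (\<xi> l))\<^sup>2) + (\<Sum>l<n. (b / s)\<^sup>2 * (cmod (\<xi> l))\<^sup>2) =
          ((a / s)\<^sup>2 + (b / s)\<^sup>2) * (\<Sum>l<n. (cmod (\<xi> l))\<^sup>2)"
        by (simp add: sum_distrib_left distrib_right sum.distrib)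
      also have "(a / s)\<^sup>2 + (b / s)\<^sup>2 = 1"
        using s a0 b0 by (simp add: power_divide add_divide_distrib[symmetric])
      also have "1 * (\<Sum>l<n. (cmod (\<xi> l))\<^sup>2) \<le> (\<Sum>j<m1 + m2 + n. (cmod (\<xi> j))\<^sup>2)"
        unfolding mult_1 by (intro sum_mono2) auto
      finally show "(\<Sum>l<N. (cmod (\<Sum>j<m1 + m2 + n. M l j * \<xi> j))\<^sup>2) \<le> (\<Sum>j<m1 + m2 + n. (cmod (\<xi> j))\<^sup>2)" .
    qed
    define E where "E = (\<lambda>i j x. complex_of_real (1 / s) * column (xs @ ys) i j x)"
    have "rn (m1 + m2 + n) E \<le> rn N D"
    proof (rule rn_contractive[OF _ _ L M])
      fix i j x assume ij: "i < m1 + m2 + n" "j < m1 + m2 + n" and x: "x \<in> F"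
      define f where "f = (if i < m1 then i else i + n)"
      have "(\<Sum>k<N. \<Sum>l<N. L i k * D k l x * M l j) = (\<Sum>k<N. L i k * (\<Sum>l<N. D k l x * M l j))"
        by (simp add: sum_distrib_left mult.assoc)
      also have "\<dots> = (if i < m1 + m2 then \<Sum>l<N. D f l x * M l j else 0)"
        unfolding L_def f_def by (rule sum_select) (auto simp: N_def)
      also have "\<dots> = E i j x"
      proof (cases "i < m1 + m2 \<and> j < n")
        case True
        have "(\<Sum>l<N. D f l x * M l j) = (\<Sum>l\<in>{j, m1 + n + j}. D f l x * M l j)"
          using True by (intro sum.mono_neutral_right) (auto simp: M_def N_def)
        also have "\<dots> = D f j x * (a / s) + D f (m1 + n + j) x * (b / s)"
          using True n_pos by (simp add: M_def)
        also have "\<dots> = E i j x"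
          using True a0 b0 s
          by (auto simp: D_def E_def f_def block_sum_def X_def Y_def column_def m1_def m2_def nth_append
              field_simps)
        finally show ?thesis
          using True by simp
      next
        case False
        then show ?thesis
          by (auto simp: E_def column_def M_def m1_def m2_def)
      qed
      finally show "E i j x = (\<Sum>k<N. \<Sum>l<N. L i k * D k l x * M l j)" ..
    qed (use n_pos in \<open>auto simp: N_def\<close>)
    then have E1: "rn (m1 + m2 + n) E \<le> 1"
      using D1 by simp
    have "cn (xs @ ys) = rn (m1 + m2 + n) (\<lambda>i j x. complex_of_real s * E i j x)"
      unfolding cn_def using n_pos s by (simp add: m1_def m2_def E_def mult.assoc[symmetric])
    also have "\<dots> \<le> s * rn (m1 + m2 + n) E"
      using n_pos s by (intro rn_scale) auto
    also have "\<dots> \<le> s"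
      using E1 s by (simp add: mult_left_le)
    finally show ?thesis
      by (simp add: s_def)
  qed
  \<comment> \<open>Now a and b decrease to the two norms.\<close>
  have "cn (xs @ ys) \<le> sqrt ((cn xs)\<^sup>2 + (cn ys)\<^sup>2)"
  proof (rule tendsto_lowerbound)
    show "((\<lambda>e. sqrt ((cn xs + e)\<^sup>2 + (cn ys + e)\<^sup>2)) \<longlongrightarrow> sqrt ((cn xs)\<^sup>2 + (cn ys)\<^sup>2)) (at_right 0)"
      by (auto intro!: tendsto_eq_intros)
    show "\<forall>\<^sub>F e in at_right 0. cn (xs @ ys) \<le> sqrt ((cn xs + e)\<^sup>2 + (cn ys + e)\<^sup>2)"
      using eventually_at_right_less[of "0 :: real"] by eventually_elim (intro bound; simp)
  qed simp
  then have "(cn (xs @ ys))\<^sup>2 \<le> (sqrt ((cn xs)\<^sup>2 + (cn ys)\<^sup>2))\<^sup>2"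
    by (intro power_mono cn_nonneg)
  then show ?thesis by simp
qed

sublocale column_norm Z cn
proof
  fix xs ys :: "(nat \<times> 'x \<Rightarrow> complex) list" and t :: real
  show "0 \<le> cn xs"
    by (rule cn_nonneg)
  show "cn xs = cn ys" if "tensor Z xs = tensor Z ys"
    using cn_tensor_le[OF that] cn_tensor_le[OF that[symmetric]] by simp
  show "(cn (xs @ ys))\<^sup>2 \<le> (cn xs)\<^sup>2 + (cn ys)\<^sup>2"
    by (rule cn_append)
  show "cn (scale_list t xs) \<le> t * cn xs" if "0 \<le> t"
  proof -
    have "cn (scale_list t xs) = rn (length xs + n) (\<lambda>i j x. complex_of_real t * column xs i j x)"
      unfolding cn_def using n_pos
      by (simp add: scale_list_def) (rule rn_cong, auto simp: column_def scaleC_fun_def)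
    also have "\<dots> \<le> t * cn xs"
      unfolding cn_def using n_pos that by (intro rn_scale) auto
    finally show ?thesis .
  qed
  show "cn xs \<le> cn (xs @ ys)"
  proof (rule cn_contractive)
    show "contractive (length xs) (length (xs @ ys)) (\<lambda>i k. if i < length xs \<and> k = i then 1 else 0)"
      by (rule contractive_select) auto
    fix i z assume "i < length xs"
    then show "(xs ! i) z =
        (\<Sum>k<length (xs @ ys). (if i < length xs \<and> k = i then 1 else 0) * ((xs @ ys) ! k) z)"
      by (subst sum_select) (auto simp: nth_append)
  qed
qed

text \<open>The context us is acted on by an identity block, and diag(T, 1) still has norm at most
  1. Through this use of submultiplicativity the cone, and with it the separating form, learns of
  the action of the algebra.\<close>

lemma dominated_fun_mat_act:
  assumes m: "m > 0" and len: "length bs = m" and T: "rn m T \<le> 1"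
  shows "dominated (map (fun_mat_act m T (\<lambda>k. bs ! k)) [0..<m]) bs"
  unfolding dominated_def
proof
  fix us :: "(nat \<times> 'x \<Rightarrow> complex) list"
  define tb where "tb = map (fun_mat_act m T (\<lambda>k. bs ! k)) [0..<m]"
  define p where "p = length us + n"
  define S :: "nat \<Rightarrow> nat \<Rightarrow> 'x \<Rightarrow> complex" where "S = block_sum m T (\<lambda>i j x. if i = j then 1 else 0)"
  have p: "p > 0"
    using n_pos by (simp add: p_def)
  have S1: "rn (m + p) S \<le> 1"
    using rn_block_sum[OF m p, of T "\<lambda>i j x. if i = j then 1 else 0"] T rn_one[OF p]
    unfolding S_def by linarith
  have "cn (us @ tb) = cn (tb @ us)"
    by (rule c_tensor) (simp add: tensor_append add.commute)
  also have "\<dots> = rn (m + p) (column (tb @ us))"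
    by (simp add: cn_def tb_def p_def add.assoc)
  also have "\<dots> \<le> rn (m + p) (column (bs @ us))"
  proof (rule rn_mult[OF _ S1])
    fix i j x assume ij: "i < m + p" "j < m + p"
    show "column (tb @ us) i j x = (\<Sum>k<m + p. S i k x * column (bs @ us) k j x)"
    proof (cases "i < m")
      case True
      have "(\<Sum>k<m + p. S i k x * column (bs @ us) k j x) = (\<Sum>k<m. T i k x * column (bs @ us) k j x)"
        using True by (intro sum.mono_neutral_cong_right) (auto simp: S_def block_sum_def)
      also have "\<dots> = column (tb @ us) i j x"
        using True len by (auto simp: column_def tb_def nth_append fun_mat_act_def)
      finally show ?thesis ..
    next
      case False
      have "(\<Sum>k<m + p. S i k x * column (bs @ us) k j x) =
          (\<Sum>k<m + p. (if \<not> i < m \<and> k = i then 1 else 0) * column (bs @ us) k j x)"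
        using False by (intro sum.cong) (auto simp: S_def block_sum_def)
      also have "\<dots> = column (bs @ us) i j x"
        using False ij by (subst sum_select) auto
      also have "\<dots> = column (tb @ us) i j x"
        using False len by (auto simp: column_def tb_def nth_append)
      finally show ?thesis ..
    qed
  qed (use m in simp)
  also have "\<dots> = cn (bs @ us)"
    by (simp add: cn_def len p_def add.assoc)
  also have "\<dots> = cn (us @ bs)"
    by (rule c_tensor) (simp add: tensor_append add.commute)
  finally show "cn (us @ map (fun_mat_act m T (\<lambda>k. bs ! k)) [0..<m]) \<le> cn (us @ bs)"
    by (simp add: tb_def)
qed

definition unit_rows :: "(nat \<times> 'x \<Rightarrow> complex) list" where
  "unit_rows = map unit_row [0..<n]"

lemma length_unit_rows: "length unit_rows = n"
  by (simp add: unit_rows_def)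

text \<open>The column of the unit rows is the identity matrix padded by zeros.\<close>

lemma cn_unit_rows: "cn unit_rows \<le> 1"
proof -
  have "rn (n + n) (column unit_rows) \<le> rn n (\<lambda>i j x. if i = j then 1 else 0)"
  proof (rule rn_contractive)
    show "contractive (n + n) n (\<lambda>i k. if i = k \<and> k < n then 1 else 0)"
      and "contractive n (n + n) (\<lambda>l j. if l = j \<and> j < n then 1 else 0)"
      by (rule contractive_diag; simp)+
    fix i j x
    have "(\<Sum>k<n. \<Sum>l<n. (if i = k \<and> k < n then 1 else 0) * (if k = l then 1 else 0) *
        (if l = j \<and> j < n then 1 else 0)) =
      (\<Sum>k<n. if j < n then (if i = k \<and> k < n then 1 else 0) * (if k = j then 1 else 0) else (0 :: complex))"
      by (intro sum.cong refl sum_diag) simp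
    also have "\<dots> = (\<Sum>k<n. if k = i then (if i = j then 1 else 0) else 0)"
      by (intro sum.cong) auto
    also have "\<dots> = column unit_rows i j x"
      by (auto simp: column_def unit_rows_def unit_row_def)
    finally show "column unit_rows i j x = (\<Sum>k<n. \<Sum>l<n. (if i = k \<and> k < n then 1 else 0) *
        (if k = l then 1 else 0) * (if l = j \<and> j < n then 1 else 0))" ..
  qed (use n_pos in auto)
  also have "\<dots> \<le> 1"
    by (rule rn_one[OF n_pos])
  finally show ?thesis
    by (simp add: cn_def length_unit_rows)
qed

text \<open>A row x is the product of the matrix with first row x, all other rows being 0, and the
  column of unit rows. Scaled by its norm that matrix becomes a contraction, to which
  \<open>dominated_fun_mat_act\<close> applies.\<close>

lemma order_unit: "\<exists>t\<ge>0. dominated [x] (scale_list t unit_rows)"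
proof -
  define T where "T = (\<lambda>i k y. if i = (0::nat) then x (k, y) else 0)"
  \<comment> \<open>Adding 1 keeps t positive when the norm of T is 0.\<close>
  define t where "t = rn n T + 1"
  have t: "t > 0"
    using rn_nonneg[OF n_pos, of T] by (simp add: t_def)
  define S where "S = (\<lambda>i j y. complex_of_real (1 / t) * T i j y)"
  have "rn n S \<le> (1 / t) * rn n T"
    unfolding S_def using t n_pos by (intro rn_scale) auto
  also have "\<dots> \<le> 1"
    using t by (simp add: t_def)
  finally have S1: "rn n S \<le> 1" .
  define bs where "bs = scale_list t unit_rows"
  have bs: "length bs = n"
    by (simp add: bs_def scale_list_def length_unit_rows)
  have act: "fun_mat_act n S (\<lambda>k. bs ! k) i (j, y) = (if i = 0 then x (j, y) else 0)"
    if "i < n" "j < n" for i j y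
  proof -
    have "fun_mat_act n S (\<lambda>k. bs ! k) i (j, y) = (\<Sum>k<n. if k = j then T i k y else 0)"
      using t unfolding fun_mat_act_def
      by (intro sum.cong) (auto simp: S_def bs_def scale_list_def unit_rows_def unit_row_def scaleC_fun_def)
    then show ?thesis
      using that by (simp add: T_def)
  qed
  \<comment> \<open>The rows of the product other than the first vanish on Z and add nothing to the
    Gram matrix.\<close>
  have "tensor Z (map (fun_mat_act n S (\<lambda>k. bs ! k)) [0..<n]) = tensor Z [x]"
  proof -
    have "(\<Sum>i<n. fun_mat_act n S ((!) bs) i (j, y) * cnj (fun_mat_act n S ((!) bs) i (j', y'))) =
        x (j, y) * cnj (x (j', y'))" if "j < n" "j' < n" for j y j' y'
    proof -
      have "(\<Sum>i<n. fun_mat_act n S ((!) bs) i (j, y) * cnj (fun_mat_act n S ((!) bs) i (j', y'))) =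
          (\<Sum>i<n. if i = 0 then x (j, y) * cnj (x (j', y')) else 0)"
        using that by (intro sum.cong) (auto simp: act)
      then show ?thesis
        using n_pos by simp
    qed
    then show ?thesis
      by (auto simp: tensor_def fun_eq_iff sum_list_map_lessThan)
  qed
  then have "tensor Z (us @ map (fun_mat_act n S (\<lambda>k. bs ! k)) [0..<n]) = tensor Z (us @ [x])" for us
    by (simp only: tensor_append)
  then have "dominated [x] bs"
    using dominated_fun_mat_act[OF n_pos bs S1] c_tensor unfolding dominated_def by metis
  then show ?thesis
    using t by (intro exI[of _ t]) (auto simp: bs_def)
qed

lemma rn_le_cn_rows:
  "rn n G \<le> cn (map (\<lambda>i z. G i (fst z) (snd z)) [0..<n])"
proof -
  let ?gs = "map (\<lambda>i z. G i (fst z) (snd z)) [0..<n]"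
  have "rn n G \<le> rn (n + n) (column ?gs)"
  proof (rule rn_contractive)
    show "contractive n (n + n) (\<lambda>i k. if i < n \<and> k = i then 1 else 0)"
      by (rule contractive_select) auto
    show "contractive (n + n) n (\<lambda>l j. if l = j \<and> j < n then 1 else 0)"
      by (rule contractive_diag; simp)
    fix i j x assume ij: "i < n" "j < n"
    have "(\<Sum>k<n + n. \<Sum>l<n + n. (if i < n \<and> k = i then 1 else 0) * column ?gs k l x *
        (if l = j \<and> j < n then 1 else 0)) =
      (\<Sum>k<n + n. (if i < n \<and> k = i then 1 else 0) * (if j < n then column ?gs k j x else 0))"
      by (intro sum.cong refl) (simp add: sum_diag)
    also have "\<dots> = G i j x"
      using ij by (subst sum_select) (auto simp: column_def)
    finally show "G i j x = (\<Sum>k<n + n. \<Sum>l<n + n. (if i < n \<and> k = i then 1 else 0) * column ?gs k l x *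
        (if l = j \<and> j < n then 1 else 0))" ..
  qed (use n_pos in auto)
  then show ?thesis
    by (simp add: cn_def)
qed

text \<open>The Blecher--Ruan--Sinclair representation theorem for the restriction of the algebra to \<open>F\<close>.\<close>

lemma restricted_form_exists:
  assumes r: "0 \<le> r" "r < rn n G"
  shows "\<exists>q. psd_form UNIV q \<and>
    (\<forall>v v' w. (\<forall>z\<in>Z. v z = v' z) \<longrightarrow> q v w = q v' w) \<and>
    (\<forall>m>0. \<forall>T b. (\<Sum>i<m. Re (q (fun_mat_act m T b i) (fun_mat_act m T b i))) \<le>
      (rn m T)\<^sup>2 * (\<Sum>k<m. Re (q (b k) (b k)))) \<and>
    (\<Sum>j<n. Re (q (unit_row j) (unit_row j))) = 1 \<and>
    r\<^sup>2 \<le> (\<Sum>i<n. Re (q (\<lambda>z. G i (fst z) (snd z)) (\<lambda>z. G i (fst z) (snd z))))"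
proof -
  let ?gs = "map (\<lambda>i z. G i (fst z) (snd z)) [0..<n]"
  have "r < cn ?gs"
    using r rn_le_cn_rows[of G] by simp
  then obtain q where q: "psd_form UNIV q"
    and dom: "\<And>xs ys. dominated ys xs \<Longrightarrow> (\<Sum>y\<leftarrow>ys. Re (q y y)) \<le> (\<Sum>x\<leftarrow>xs. Re (q x x))"
    and one: "(\<Sum>e\<leftarrow>unit_rows. Re (q e e)) = 1" and ge: "r\<^sup>2 \<le> (\<Sum>g\<leftarrow>?gs. Re (q g g))"
    and loc: "\<forall>v v' w. (\<forall>z\<in>Z. v z = v' z) \<longrightarrow> q v w = q v' w"
    using separating_form[OF cn_unit_rows order_unit r(1)] by blast
  interpret q: psd_form UNIV q
    by (rule q)
  have "(\<Sum>i<m. Re (q (fun_mat_act m T b i) (fun_mat_act m T b i))) \<le>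
      (rn m T)\<^sup>2 * (\<Sum>k<m. Re (q (b k) (b k)))" if m: "m > 0" for m T b
  proof -
    define N where "N = (\<Sum>k<m. Re (q (b k) (b k)))"
    define J where "J = (\<Sum>i<m. Re (q (fun_mat_act m T b i) (fun_mat_act m T b i)))"
    \<comment> \<open>Dominance is available for T / t, a contraction; afterwards t decreases to
      \<open>rn m T\<close>, which may be 0.\<close>
    have "J \<le> t\<^sup>2 * N" if t: "t > rn m T" for t
    proof -
      have t0: "t > 0"
        using t rn_nonneg[OF m, of T] by simp
      define S where "S = (\<lambda>i j y. complex_of_real (1 / t) * T i j y)"
      have "rn m S \<le> (1 / t) * rn m T"
        unfolding S_def using t0 m by (intro rn_scale) auto
      also have "\<dots> \<le> 1"
        using t t0 by simp
      finally have S1: "rn m S \<le> 1" .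
      define bs where "bs = map b [0..<m]"
      have "(\<Sum>y\<leftarrow>map (fun_mat_act m S ((!) bs)) [0..<m]. Re (q y y)) \<le> (\<Sum>x\<leftarrow>bs. Re (q x x))"
        by (intro dom dominated_fun_mat_act[OF m _ S1]) (simp add: bs_def)
      also have "(\<Sum>x\<leftarrow>bs. Re (q x x)) = N"
        by (simp add: bs_def sum_list_map_lessThan N_def)
      also have "(\<Sum>y\<leftarrow>map (fun_mat_act m S ((!) bs)) [0..<m]. Re (q y y)) =
          (\<Sum>i<m. Re (q (fun_mat_act m S ((!) bs) i) (fun_mat_act m S ((!) bs) i)))"
        by (simp add: sum_list_map_lessThan)
      also have "\<dots> = (\<Sum>i<m. (1 / t)\<^sup>2 * Re (q (fun_mat_act m T b i) (fun_mat_act m T b i)))"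
      proof (intro sum.cong refl)
        fix i
        have "fun_mat_act m S ((!) bs) i = (1 / t) *\<^sub>r fun_mat_act m T b i"
          by (auto simp: fun_mat_act_def S_def bs_def scaleC_fun_def sum_distrib_left mult.assoc
              intro!: sum.cong)
        then show "Re (q (fun_mat_act m S ((!) bs) i) (fun_mat_act m S ((!) bs) i)) =
            (1 / t)\<^sup>2 * Re (q (fun_mat_act m T b i) (fun_mat_act m T b i))"
          using t0 q.Re_ip_scaleC[of "fun_mat_act m T b i" "complex_of_real (1 / t)"]
          by (simp add: norm_divide)
      qed
      also have "\<dots> = J / t\<^sup>2"
        by (simp add: J_def power_divide sum_divide_distrib)
      finally show ?thesis
        using t0 by (simp add: field_simps)
    qed
    then have "\<forall>\<^sub>F t in at_right (rn m T). J \<le> t\<^sup>2 * N"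
      using eventually_at_right_less[of "rn m T"] by (auto elim: eventually_mono)
    moreover have "((\<lambda>t. t\<^sup>2 * N) \<longlongrightarrow> (rn m T)\<^sup>2 * N) (at_right (rn m T))"
      by (auto intro!: tendsto_eq_intros)
    ultimately show ?thesis
      unfolding J_def[symmetric] N_def[symmetric]
      using tendsto_lowerbound trivial_limit_at_right_real by blast
  qed
  then show ?thesis
    using q loc one ge
    by (intro exI[of _ q]) (simp add: unit_rows_def sum_list_map_lessThan)
qed

end

section \<open>Finite-dimensional Hilbert modules over the algebra\<close>

text \<open>The last clause is complete contractivity of the action of A. The third makes evaluation
  at each point of Z contractive, so that vectors of length zero vanish on Z.\<close>

definition rep_form ::
    "('x \<Rightarrow> complex) set \<Rightarrow> (('x \<Rightarrow> complex) mat \<Rightarrow> real) \<Rightarrow> (nat \<times> 'x) set \<Rightarrow>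
     ((nat \<times> 'x \<Rightarrow> complex) \<Rightarrow> (nat \<times> 'x \<Rightarrow> complex) \<Rightarrow> complex) \<Rightarrow> bool" where
  "rep_form A nrm Z Q \<longleftrightarrow> psd_form UNIV Q \<and>
     (\<forall>v v' w. (\<forall>z\<in>Z. v z = v' z) \<longrightarrow> Q v w = Q v' w) \<and>
     (\<forall>v. (\<Sum>z\<in>Z. (cmod (v z))\<^sup>2) \<le> Re (Q v v)) \<and>
     (\<forall>m>0. \<forall>T\<in>Mat A m. \<forall>b.
        (\<Sum>i<m. Re (Q (fun_mat_act m (\<lambda>i k. T $$ (i, k)) b i) (fun_mat_act m (\<lambda>i k. T $$ (i, k)) b i))) \<le>
        (nrm T)\<^sup>2 * (\<Sum>k<m. Re (Q (b k) (b k))))"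

lemma psd_form_combination:
  assumes "psd_form UNIV q" and "psd_form UNIV p" and c: "(c::real) \<ge> 0"
  shows "psd_form UNIV (\<lambda>v w. complex_of_real c * q v w + p v w)"
proof -
  interpret q: psd_form UNIV q by fact
  interpret p: psd_form UNIV p by fact
  show ?thesis
  proof (rule psd_form_UNIV_I)
    fix u v
    show "complex_of_real c * q v u + p v u = cnj (complex_of_real c * q u v + p u v)"
      using q.ip_commute[of u v] p.ip_commute[of u v] by simp
    show "0 \<le> Re (complex_of_real c * q u u + p u u)"
      using c q.ip_ge_zero[of u] p.ip_ge_zero[of u] by simp
  qed (simp_all add: q.ip_add_left p.ip_add_left q.ip_scaleC_left p.ip_scaleC_left algebra_simps)
qed

text \<open>If a > b > 0, the powers of a / b outgrow every C. This strips the constant from bounds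
  on multiplicative functionals.\<close>

lemma power_growth:
  fixes a b C :: real
  assumes "0 \<le> b" and bound: "\<And>k. a ^ Suc k \<le> C * b ^ Suc k"
  shows "a \<le> b"
proof (rule ccontr)
  assume "\<not> a \<le> b"
  then have ab: "a > b" by simp
  show False
  proof (cases "b = 0")
    case True
    then show False
      using bound[of 0] ab by simp
  next
    case False
    then have b: "b > 0"
      using assms by simp
    then obtain k where k: "C < (a / b) ^ k"
      using real_arch_pow[of "a / b" C] ab by auto
    also have "(a / b) ^ k \<le> (a / b) ^ Suc k"
      using ab b by (intro power_increasing) auto
    also have "\<dots> \<le> C"
      using bound[of k] b by (simp add: power_divide divide_le_eq)
    finally show False by simp
  qed
qed

section \<open>Evaluations and norming modules\<close>

context function_operator_algebra
begin

lemma singleton_mem_iff: "singleton_mat f \<in> Mat A (Suc 0) \<longleftrightarrow> f \<in> A"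
  by (auto simp: Mat_iff singleton_mat_def)

text \<open>Evaluation is multiplicative, so its bound C applied to the powers of f gives |f x|^k <=
  C |f|^k for all k > 0, where the constant is harmless.\<close>

lemma evaluation_contractive:
  assumes f: "f \<in> A"
  shows "cmod (f x) \<le> nrm (singleton_mat f)"
proof -
  obtain C where C: "\<And>g. g \<in> A \<Longrightarrow> cmod (g x) \<le> C * nrm (singleton_mat g)"
    using evaluation_bounded by blast
  have f1: "singleton_mat f \<in> Mat A 1"
    using f by (simp add: singleton_mem_iff)
  have pow: "nrm (singleton_mat (f ^ Suc k)) \<le> nrm (singleton_mat f) ^ Suc k" for k
  proof (induction k)
    case (Suc k)
    have "singleton_mat (f ^ Suc (Suc k)) = singleton_mat f * singleton_mat (f ^ Suc k)"
      by (intro eq_matI) (auto simp: singleton_mat_def scalar_prod_def)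
    then have "nrm (singleton_mat (f ^ Suc (Suc k))) \<le> nrm (singleton_mat f) * nrm (singleton_mat (f ^ Suc k))"
      using nrm_mult[OF _ f1, of "singleton_mat (f ^ Suc k)"] f power_mem[of f "Suc k"]
      by (simp add: singleton_mem_iff)
    also have "\<dots> \<le> nrm (singleton_mat f) * nrm (singleton_mat f) ^ Suc k"
      by (rule mult_left_mono[OF Suc.IH]) (use nrm_nonneg[OF _ f1] in simp)
    finally show ?case
      by (simp only: power_Suc)
  qed simp
  have C0: "C \<ge> 0"
    using C[OF one_mem] nrm_one by simp
  show ?thesis
  proof (rule power_growth)
    show "0 \<le> nrm (singleton_mat f)"
      using nrm_nonneg[OF _ f1] by simp
    fix k
    have "cmod (f x) ^ Suc k = cmod ((f ^ Suc k) x)"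
      by (induction k) (simp_all add: norm_mult)
    also have "\<dots> \<le> C * nrm (singleton_mat (f ^ Suc k))"
      by (rule C[OF power_mem[OF f]])
    also have "\<dots> \<le> C * nrm (singleton_mat f) ^ Suc k"
      by (rule mult_left_mono[OF pow C0])
    finally show "cmod (f x) ^ Suc k \<le> C * nrm (singleton_mat f) ^ Suc k" .
  qed
qed

text \<open>Compressing T by a unit row and a unit column leaves a single function, for which
  evaluation is already known to be contractive.\<close>

lemma evaluation_completely_contractive:
  assumes m: "m > 0" and T: "T \<in> Mat A m"
  shows "(\<Sum>i<m. (cmod (\<Sum>k<m. (T $$ (i, k)) x * \<xi> k))\<^sup>2) \<le> (nrm T)\<^sup>2 * (\<Sum>k<m. (cmod (\<xi> k))\<^sup>2)"
proof -
  define \<eta> where "\<eta> i = (\<Sum>k<m. (T $$ (i, k)) x * \<xi> k)" for i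
  define N D where "N = sqrt (\<Sum>i<m. (cmod (\<eta> i))\<^sup>2)" and "D = sqrt (\<Sum>k<m. (cmod (\<xi> k))\<^sup>2)"
  have N2: "N\<^sup>2 = (\<Sum>i<m. (cmod (\<eta> i))\<^sup>2)" and D2: "D\<^sup>2 = (\<Sum>k<m. (cmod (\<xi> k))\<^sup>2)"
    by (simp_all add: N_def D_def sum_nonneg)
  have ND: "N \<ge> 0" "D \<ge> 0"
    by (simp_all add: N_def D_def sum_nonneg)
  have "N \<le> nrm T * D"
  proof (cases "N = 0 \<or> D = 0")
    case True
    show ?thesis
    proof (cases "D = 0")
      case True
      then have "\<xi> k = 0" if "k < m" for k
        using D2 that by (simp add: sum_nonneg_eq_0_iff)
      then have "\<eta> i = 0" for i
        by (simp add: \<eta>_def)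
      then show ?thesis
        using True by (simp add: N_def)
    next
      case False
      then show ?thesis
        using \<open>N = 0 \<or> D = 0\<close> ND nrm_nonneg[OF m T] by simp
    qed
  next
    case False
    then have pos: "N > 0" "D > 0"
      using ND by auto
    \<comment> \<open>With the unit vectors in the directions of \<eta> and \<xi>, the compressed
      function has the value N / D at x.\<close>
    have a: "contractive 1 m (\<lambda>_ k. cnj (\<eta> k) / N)"
      by (rule contractive_row)
        (use pos in \<open>simp add: norm_divide power_divide sum_divide_distrib[symmetric] N2[symmetric]\<close>)
    have b: "contractive m 1 (\<lambda>l _. \<xi> l / D)"
      by (rule contractive_column)
        (use pos in \<open>simp add: norm_divide power_divide sum_divide_distrib[symmetric] D2[symmetric]\<close>)
    obtain H where H: "H \<in> Mat A 1" "nrm H \<le> nrm T"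
      "\<And>i j y. i < 1 \<Longrightarrow> j < 1 \<Longrightarrow> (H $$ (i, j)) y =
        (\<Sum>k<m. \<Sum>l<m. cnj (\<eta> k) / N * (T $$ (k, l)) y * (\<xi> l / D))"
      using nrm_contractive[OF _ m T a b] by auto
    have "H = singleton_mat (H $$ (0, 0))"
      using H(1) by (intro eq_matI) (auto simp: singleton_mat_def Mat_iff)
    moreover have "H $$ (0, 0) \<in> A"
      using H(1) by (simp add: Mat_iff)
    ultimately have "cmod ((H $$ (0, 0)) x) \<le> nrm H"
      using evaluation_contractive[of "H $$ (0, 0)" x] by simp
    moreover have "(H $$ (0, 0)) x = complex_of_real (N / D)"
    proof -
      have "(H $$ (0, 0)) x = (\<Sum>k<m. cnj (\<eta> k) / N * \<eta> k / D)"
        using H(3)[of 0 0 x] by (simp add: \<eta>_def sum_distrib_left sum_divide_distrib mult.assoc)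
      also have "\<dots> = (\<Sum>k<m. \<eta> k * cnj (\<eta> k)) / (N * D)"
        by (simp add: sum_divide_distrib mult.commute)
      also have "(\<Sum>k<m. \<eta> k * cnj (\<eta> k)) = complex_of_real (N\<^sup>2)"
        unfolding N2 by (simp add: complex_norm_square del: of_real_power)
      finally show ?thesis
        using pos by (simp add: power2_eq_square)
    qed
    ultimately have "N / D \<le> nrm T"
      using H(2) pos by (simp add: norm_divide)
    then show ?thesis
      using pos by (simp add: field_simps)
  qed
  then have "N\<^sup>2 \<le> (nrm T * D)\<^sup>2"
    using ND by (intro power_mono)
  then show ?thesis
    by (simp add: power_mult_distrib N2 D2 \<eta>_def)
qed

text \<open>The standard inner product is the sum, over z in Z, of the one-dimensional modules given
  by evaluation at the point of z.\<close>

lemma rep_form_standard: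
  assumes "finite Z"
  shows "rep_form A nrm Z (\<lambda>v w. \<Sum>z\<in>Z. v z * cnj (w z))"
  unfolding rep_form_def
proof (intro conjI allI impI ballI)
  have sq: "Re (\<Sum>z\<in>Z. v z * cnj (v z)) = (\<Sum>z\<in>Z. (cmod (v z))\<^sup>2)" for v :: "nat \<times> 'x \<Rightarrow> complex"
    by (simp flip: complex_norm_square of_real_sum)
  show "psd_form UNIV (\<lambda>v w :: nat \<times> 'x \<Rightarrow> complex. \<Sum>z\<in>Z. v z * cnj (w z))"
    by (rule psd_form_standard)
  show "(\<Sum>z\<in>Z. (cmod (v z))\<^sup>2) \<le> Re (\<Sum>z\<in>Z. v z * cnj (v z))" for v :: "nat \<times> 'x \<Rightarrow> complex"
    by (simp only: sq)
  fix m T and b :: "nat \<Rightarrow> nat \<times> 'x \<Rightarrow> complex" assume m: "m > 0" and T: "T \<in> Mat A m"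
  let ?Tb = "fun_mat_act m (\<lambda>i k. T $$ (i, k)) b"
  have "(\<Sum>i<m. Re (\<Sum>z\<in>Z. ?Tb i z * cnj (?Tb i z))) = (\<Sum>z\<in>Z. \<Sum>i<m. (cmod (?Tb i z))\<^sup>2)"
    unfolding sq by (rule sum.swap)
  also have "\<dots> \<le> (\<Sum>z\<in>Z. (nrm T)\<^sup>2 * (\<Sum>k<m. (cmod (b k z))\<^sup>2))"
    unfolding fun_mat_act_def by (intro sum_mono evaluation_completely_contractive m T)
  also have "\<dots> = (nrm T)\<^sup>2 * (\<Sum>k<m. \<Sum>z\<in>Z. (cmod (b k z))\<^sup>2)"
    unfolding sum_distrib_left[symmetric] by (subst sum.swap) simp
  finally show "(\<Sum>i<m. Re (\<Sum>z\<in>Z. ?Tb i z * cnj (?Tb i z))) \<le>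
      (nrm T)\<^sup>2 * (\<Sum>k<m. Re (\<Sum>z\<in>Z. b k z * cnj (b k z)))"
    unfolding sq .
qed simp

text \<open>The form q that norms G need not dominate the standard form p, so the form used is c q +
  p. Adding p can spoil the lower bound; q is therefore taken for a larger number r1, and c is
  chosen large.\<close>

lemma rep_form_exists:
  assumes n: "n > 0" and G: "G \<in> Mat A n" and F: "finite F"
    and r: "0 \<le> r" "r < quotient_norm A nrm F G"
  shows "\<exists>Q. rep_form A nrm ({..<n} \<times> F) Q \<and>
    r\<^sup>2 * (\<Sum>j<n. Re (Q (unit_row j) (unit_row j))) \<le>
    (\<Sum>i<n. Re (Q (fun_mat_act n (\<lambda>i k. G $$ (i, k)) unit_row i) (fun_mat_act n (\<lambda>i k. G $$ (i, k)) unit_row i)))"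
proof -
  interpret restricted_columns A nrm F n
    by unfold_locales (use F n in auto)
  let ?G = "\<lambda>i k. G $$ (i, k)"
  \<comment> \<open>The gap between r and r1 is what pays for the standard form.\<close>
  define r1 where "r1 = (r + rn n ?G) / 2"
  have "r < rn n ?G"
    using quotient_norm_le_rn[OF n G] r by simp
  then have r1: "0 \<le> r1" "r1 < rn n ?G" "r < r1"
    using r by (auto simp: r1_def)
  obtain q where q: "psd_form UNIV q"
    and loc: "\<And>v v' w. (\<forall>z\<in>Z. v z = v' z) \<Longrightarrow> q v w = q v' w"
    and con: "\<And>m T b. m > 0 \<Longrightarrow> (\<Sum>i<m. Re (q (fun_mat_act m T b i) (fun_mat_act m T b i))) \<le>
      (rn m T)\<^sup>2 * (\<Sum>k<m. Re (q (b k) (b k)))"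
    and one: "(\<Sum>j<n. Re (q (unit_row j) (unit_row j))) = 1"
    and ge: "r1\<^sup>2 \<le> (\<Sum>i<n. Re (q (\<lambda>z. ?G i (fst z) (snd z)) (\<lambda>z. ?G i (fst z) (snd z))))"
    using restricted_form_exists[OF r1(1,2)] by blast
  interpret q: psd_form UNIV q
    by (rule q)
  define p where "p v w = (\<Sum>z\<in>Z. v z * cnj (w z))" for v w :: "nat \<times> 'x \<Rightarrow> complex"
  have p: "rep_form A nrm Z p"
    unfolding p_def using F by (intro rep_form_standard) simp
  interpret p: psd_form UNIV p
    using p by (simp add: rep_form_def)
  define P where "P = (\<Sum>j<n. Re (p (unit_row j) (unit_row j)))"
  have P: "P \<ge> 0"
    unfolding P_def by (intro sum_nonneg p.ip_ge_zero) simp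
  have r2: "r\<^sup>2 < r1\<^sup>2"
    using r r1 by (intro power_strict_mono) auto
  \<comment> \<open>The solution of r^2 (c + P) = c r1^2: the unit rows have total length c + P for
    Q, and their images have at least c r1^2.\<close>
  define c where "c = r\<^sup>2 * P / (r1\<^sup>2 - r\<^sup>2)"
  have c: "c \<ge> 0"
    using P r2 by (simp add: c_def)
  define Q where "Q v w = complex_of_real c * q v w + p v w" for v w
  have ReQ: "Re (Q v w) = c * Re (q v w) + Re (p v w)" for v w
    by (simp add: Q_def)
  have row: "q (fun_mat_act n ?G unit_row i) (fun_mat_act n ?G unit_row i) =
      q (\<lambda>z. ?G i (fst z) (snd z)) (\<lambda>z. ?G i (fst z) (snd z))" for i
  proof -
    have eq: "\<forall>z\<in>Z. fun_mat_act n ?G unit_row i z = ?G i (fst z) (snd z)"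
    proof
      fix z :: "nat \<times> 'x" assume "z \<in> Z"
      have "fun_mat_act n ?G unit_row i z = (\<Sum>k<n. if k = fst z then ?G i k (snd z) else 0)"
        unfolding fun_mat_act_def by (intro sum.cong) (auto simp: unit_row_def)
      then show "fun_mat_act n ?G unit_row i z = ?G i (fst z) (snd z)"
        using \<open>z \<in> Z\<close> by auto
    qed
    let ?u = "fun_mat_act n ?G unit_row i" and ?v = "\<lambda>z. ?G i (fst z) (snd z)"
    have "q ?u ?u = q ?v ?u"
      by (rule loc[OF eq])
    also have "\<dots> = cnj (q ?u ?v)"
      by (rule q.ip_commute) simp_all
    also have "q ?u ?v = q ?v ?v"
      by (rule loc[OF eq])
    also have "cnj (q ?v ?v) = q ?v ?v"
      by (rule q.ip_commute[symmetric]) simp_all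
    finally show ?thesis .
  qed
  have "rep_form A nrm Z Q"
    unfolding rep_form_def
  proof (intro conjI allI impI ballI)
    show "psd_form UNIV Q"
      unfolding Q_def by (rule psd_form_combination[OF q p.psd_form_axioms c])
    show "Q v w = Q v' w" if "\<forall>z\<in>Z. v z = v' z" for v v' w
      using that loc[OF that] p by (simp add: Q_def rep_form_def)
    show "(\<Sum>z\<in>Z. (cmod (v z))\<^sup>2) \<le> Re (Q v v)" for v
    proof -
      have "0 \<le> c * Re (q v v)"
        using c q.ip_ge_zero[of v] by simp
      moreover have "(\<Sum>z\<in>Z. (cmod (v z))\<^sup>2) \<le> Re (p v v)"
        using p by (simp add: rep_form_def)
      ultimately show ?thesis
        unfolding ReQ by simp
    qed
    fix m T and b :: "nat \<Rightarrow> nat \<times> 'x \<Rightarrow> complex" assume m: "m > 0" and T: "T \<in> Mat A m"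
    let ?T = "\<lambda>i k. T $$ (i, k)"
    have "rn m ?T \<le> nrm T"
      using T by (intro rn_le m) (simp add: lifts_def)
    then have "(rn m ?T)\<^sup>2 \<le> (nrm T)\<^sup>2"
      using rn_nonneg[OF m] by (intro power_mono) auto
    then have "(rn m ?T)\<^sup>2 * (\<Sum>k<m. Re (q (b k) (b k))) \<le> (nrm T)\<^sup>2 * (\<Sum>k<m. Re (q (b k) (b k)))"
      by (intro mult_right_mono sum_nonneg q.ip_ge_zero) auto
    then have "(\<Sum>i<m. Re (q (fun_mat_act m ?T b i) (fun_mat_act m ?T b i))) \<le>
        (nrm T)\<^sup>2 * (\<Sum>k<m. Re (q (b k) (b k)))"
      using con[OF m, of ?T b] by linarith
    then have "c * (\<Sum>i<m. Re (q (fun_mat_act m ?T b i) (fun_mat_act m ?T b i))) \<le>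
        c * ((nrm T)\<^sup>2 * (\<Sum>k<m. Re (q (b k) (b k))))"
      using c by (rule mult_left_mono)
    moreover have "(\<Sum>i<m. Re (p (fun_mat_act m ?T b i) (fun_mat_act m ?T b i))) \<le>
        (nrm T)\<^sup>2 * (\<Sum>k<m. Re (p (b k) (b k)))"
      using p m T by (simp add: rep_form_def)
    ultimately show "(\<Sum>i<m. Re (Q (fun_mat_act m ?T b i) (fun_mat_act m ?T b i))) \<le>
        (nrm T)\<^sup>2 * (\<Sum>k<m. Re (Q (b k) (b k)))"
      unfolding ReQ by (simp add: sum.distrib sum_distrib_left[symmetric] algebra_simps)
  qed
  moreover have "r\<^sup>2 * (\<Sum>j<n. Re (Q (unit_row j) (unit_row j))) \<le>
    (\<Sum>i<n. Re (Q (fun_mat_act n ?G unit_row i) (fun_mat_act n ?G unit_row i)))"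
  proof -
    have "r\<^sup>2 * (\<Sum>j<n. Re (Q (unit_row j) (unit_row j))) = r\<^sup>2 * (c + P)"
      unfolding ReQ by (simp add: sum.distrib sum_distrib_left[symmetric] one P_def)
    also have "\<dots> = c * r1\<^sup>2"
      using r2 by (simp add: c_def field_simps)
    also have "\<dots> \<le> c * (\<Sum>i<n. Re (q (fun_mat_act n ?G unit_row i) (fun_mat_act n ?G unit_row i)))"
      using ge c unfolding row by (rule mult_left_mono)
    also have "\<dots> \<le> (\<Sum>i<n. Re (Q (fun_mat_act n ?G unit_row i) (fun_mat_act n ?G unit_row i)))"
      unfolding ReQ by (simp add: sum.distrib sum_distrib_left[symmetric] sum_nonneg p.ip_ge_zero)
    finally show ?thesis .
  qed
  ultimately show ?thesis by blast
qed

end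

section \<open>Hilbert spaces\<close>

text \<open>The representing vector minimizes J u = |u|^2 - 2 Re (\<phi> u). The parallelogram law
  makes minimizing sequences Cauchy, and the vanishing first variation at the minimum is the
  required identity.\<close>

lemma (in hilbert) riesz:
  assumes add: "\<And>u v. u \<in> H \<Longrightarrow> v \<in> H \<Longrightarrow> \<phi> (u + v) = \<phi> u + \<phi> v"
    and scale: "\<And>c u. u \<in> H \<Longrightarrow> \<phi> (c *\<^sub>C u) = c * \<phi> u"
    and bound: "\<And>u. u \<in> H \<Longrightarrow> cmod (\<phi> u) \<le> M * ip_norm ip u"
  shows "\<exists>l\<in>H. \<forall>u\<in>H. \<phi> u = ip u l"
proof -
  define J where "J u = Re (ip u u) - 2 * Re (\<phi> u)" for u
  have \<phi>_diff: "\<phi> (u - v) = \<phi> u - \<phi> v" if "u \<in> H" "v \<in> H" for u v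
    using add[of u "(-1) *\<^sub>C v"] scale[of v "-1"] that scaleC_mem[of v "-1"]
    by (simp add: scaleC_minus_one)
  \<comment> \<open>By completing the square in |u|^2 - 2 M |u|.\<close>
  have lower: "- (M\<^sup>2) \<le> J u" if "u \<in> H" for u
  proof -
    have "Re (\<phi> u) \<le> M * ip_norm ip u"
      using bound[OF that] complex_Re_le_cmod order_trans by blast
    moreover have "2 * (M * ip_norm ip u) \<le> Re (ip u u) + M\<^sup>2"
      using zero_le_power2[of "ip_norm ip u - M"] that by (simp add: power2_diff ip_norm_sq algebra_simps)
    ultimately show ?thesis
      by (simp add: J_def)
  qed
  define m where "m = Inf (J ` H)"
  have bdd: "bdd_below (J ` H)"
    using lower by (auto simp: bdd_below_def)
  have m_le: "m \<le> J u" if "u \<in> H" for u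
    unfolding m_def using that bdd by (intro cInf_lower) auto
  have "\<exists>u\<in>H. J u < m + 1 / real (Suc n)" for n
  proof -
    have "Inf (J ` H) < m + 1 / real (Suc n)"
      by (simp add: m_def)
    then show ?thesis
      using cInf_less_iff[OF _ bdd, of "m + 1 / real (Suc n)"] zero_mem by auto
  qed
  then obtain s where s: "\<And>n. s n \<in> H" "\<And>n. J (s n) < m + 1 / real (Suc n)"
    by metis
  \<comment> \<open>The midpoint h of u and v has J h >= m.\<close>
  have close: "Re (ip (u - v) (u - v)) \<le> 2 * (J u + J v - 2 * m)" if "u \<in> H" "v \<in> H" for u v
  proof -
    define h where "h = (1 / 2) *\<^sub>C (u + v)"
    have h: "h \<in> H"
      using that by (simp add: h_def add_mem scaleC_mem)
    have "Re (ip h h) = Re (ip (u + v) (u + v)) / 4"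
      using that by (simp add: h_def Re_ip_scaleC add_mem norm_divide power_divide)
    moreover have "Re (\<phi> h) = (Re (\<phi> u) + Re (\<phi> v)) / 2"
      using that by (simp add: h_def scale add add_mem)
    ultimately show ?thesis
      using m_le[OF h] parallelogram[OF that] by (simp add: J_def)
  qed
  have cauchy: "\<exists>N. \<forall>i\<ge>N. \<forall>j\<ge>N. ip_norm ip (s i - s j) < e" if e: "e > 0" for e
  proof -
    obtain N where N: "inverse (real (Suc N)) < e\<^sup>2 / 4"
      using reals_Archimedean[of "e\<^sup>2 / 4"] e by auto
    have "ip_norm ip (s i - s j) < e" if ij: "i \<ge> N" "j \<ge> N" for i j
    proof -
      have "1 / real (Suc i) \<le> 1 / real (Suc N)" "1 / real (Suc j) \<le> 1 / real (Suc N)"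
        using ij by (auto intro!: divide_left_mono)
      then have "Re (ip (s i - s j) (s i - s j)) < e\<^sup>2"
        using close[OF s(1) s(1), of i j] s(2)[of i] s(2)[of j] N by (simp add: inverse_eq_divide)
      then have "(ip_norm ip (s i - s j))\<^sup>2 < e\<^sup>2"
        by (simp add: ip_norm_sq diff_mem s)
      then show ?thesis
        using \<open>e > 0\<close> by (simp add: power_less_imp_less_base)
    qed
    then show ?thesis by blast
  qed
  obtain l where l: "l \<in> H" and lim: "(\<lambda>n. ip_norm ip (s n - l)) \<longlonglongrightarrow> 0"
    using complete[OF s(1) cauchy] by blast
  have "(\<lambda>n. ip_norm ip (s n)) \<longlonglongrightarrow> ip_norm ip l"
  proof (rule LIM_zero_cancel, rule tendsto_rabs_zero_cancel, rule Lim_null_comparison[OF _ lim])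
    show "\<forall>\<^sub>F n in sequentially. norm \<bar>ip_norm ip (s n) - ip_norm ip l\<bar> \<le> ip_norm ip (s n - l)"
      using ip_norm_triangle_diff[OF s(1) l] by simp
  qed
  moreover have "(\<lambda>n. \<phi> (s n)) \<longlonglongrightarrow> \<phi> l"
  proof (rule LIM_zero_cancel, rule Lim_null_comparison)
    show "(\<lambda>n. M * ip_norm ip (s n - l)) \<longlonglongrightarrow> 0"
      using tendsto_mult_right_zero[OF lim] by simp
    show "\<forall>\<^sub>F n in sequentially. norm (\<phi> (s n) - \<phi> l) \<le> M * ip_norm ip (s n - l)"
      using bound[OF diff_mem[OF s(1) l]] \<phi>_diff[OF s(1) l] by simp
  qed
  ultimately have "(\<lambda>n. (ip_norm ip (s n))\<^sup>2 - 2 * Re (\<phi> (s n))) \<longlonglongrightarrow> (ip_norm ip l)\<^sup>2 - 2 * Re (\<phi> l)"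
    by (intro tendsto_intros)
  then have Jlim: "(\<lambda>n. J (s n)) \<longlonglongrightarrow> J l"
    by (simp add: J_def ip_norm_sq s l)
  have "(\<lambda>n. m + 1 / real (Suc n)) \<longlonglongrightarrow> m + 0"
    by (intro tendsto_intros LIMSEQ_Suc[OF lim_1_over_n])
  then have "J l \<le> m + 0"
    by (rule LIMSEQ_le[OF Jlim]) (use s(2) less_imp_le in blast)
  then have min: "J l \<le> J u" if "u \<in> H" for u
    using m_le[OF that] by simp
  have Re_eq: "Re (\<phi> h) = Re (ip h l)" if h: "h \<in> H" for h
  proof -
    define \<delta> where "\<delta> = Re (ip h l) - Re (\<phi> h)"
    define K where "K = Re (ip h h)"
    have K: "K \<ge> 0"
      using h by (simp add: K_def ip_ge_zero)
    \<comment> \<open>The right-hand side is J (l + t h) - J l; being nonnegative for both signs of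
      t, it has no linear term.\<close>
    have quad: "0 \<le> 2 * t * \<delta> + t\<^sup>2 * K" for t
    proof -
      have th: "complex_of_real t *\<^sub>C h \<in> H"
        using h by (rule scaleC_mem)
      have "Re (ip l (complex_of_real t *\<^sub>C h)) = t * Re (ip h l)"
        using ip_commute[OF h l] h l by (simp add: ip_scaleC_right)
      moreover have "Re (ip (complex_of_real t *\<^sub>C h) (complex_of_real t *\<^sub>C h)) = t\<^sup>2 * K"
        using h by (simp add: Re_ip_scaleC K_def)
      moreover have "Re (\<phi> (complex_of_real t *\<^sub>C h)) = t * Re (\<phi> h)"
        using h by (simp add: scale)
      ultimately show ?thesis
        using min[OF add_mem[OF l th]] add[OF l th] Re_ip_add[OF l th]
        by (simp add: J_def \<delta>_def algebra_simps)
    qed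
    have "\<delta> = 0"
    proof (cases "K = 0")
      case True
      then show ?thesis
        using quad[of 1] quad[of "-1"] by simp
    next
      case False
      then have "K > 0"
        using K by simp
      then have "0 \<le> - (\<delta>\<^sup>2 / K)"
        using quad[of "- \<delta> / K"] by (simp add: power2_eq_square)
      then show ?thesis
        using \<open>K > 0\<close> by (simp add: divide_le_0_iff)
    qed
    then show ?thesis
      by (simp add: \<delta>_def)
  qed
  have "\<phi> u = ip u l" if u: "u \<in> H" for u
  proof (rule complex_eqI)
    show "Re (\<phi> u) = Re (ip u l)"
      using u by (rule Re_eq)
    show "Im (\<phi> u) = Im (ip u l)"
      using Re_eq[OF scaleC_mem[OF u, of \<i>]] u l by (simp add: scale ip_scaleC_left)
  qed
  then show ?thesis
    using l by blast
qed

section \<open>Hilbert sums of semidefinite forms\<close>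

lemma summable_on_UNIV_I:
  fixes f :: "'a \<Rightarrow> real"
  assumes "\<And>x. 0 \<le> f x" and "\<And>S. finite S \<Longrightarrow> sum f S \<le> B"
  shows "f summable_on UNIV"
  using assms by (intro nonneg_bdd_above_summable_on) (auto simp: bdd_above_def)

text \<open>The summands are given as semidefinite forms on one ambient space V, so that the sum is
  a set of elements of V and no new type arises. V has to be separated by the forms jointly and
  complete for all of them at once.\<close>

locale hilbert_sum =
  fixes q :: "'s \<Rightarrow> 'v::complex_vector \<Rightarrow> 'v \<Rightarrow> complex" and V :: "'v set"
  assumes form: "psd_form UNIV (q s)"
    and V_zero: "0 \<in> V" and V_add: "u \<in> V \<Longrightarrow> v \<in> V \<Longrightarrow> u + v \<in> V"
    and V_scale: "u \<in> V \<Longrightarrow> c *\<^sub>C u \<in> V"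
    and definite: "u \<in> V \<Longrightarrow> (\<And>s. Re (q s u u) = 0) \<Longrightarrow> u = 0"
    and block_complete: "(\<And>n. w n \<in> V) \<Longrightarrow>
      (\<And>s e. e > 0 \<Longrightarrow> \<exists>N. \<forall>m\<ge>N. \<forall>n\<ge>N. ip_norm (q s) (w m - w n) < e) \<Longrightarrow>
      \<exists>l\<in>V. \<forall>s. (\<lambda>n. ip_norm (q s) (w n - l)) \<longlonglongrightarrow> 0"
begin

definition sum_space :: "'v set" where
  "sum_space = {v \<in> V. (\<lambda>s. Re (q s v v)) summable_on UNIV}"

definition sum_ip :: "'v \<Rightarrow> 'v \<Rightarrow> complex" where
  "sum_ip u v = infsum (\<lambda>s. q s u v) UNIV"

lemma sum_space_subset: "u \<in> sum_space \<Longrightarrow> u \<in> V"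
  by (simp add: sum_space_def)

lemma summable_q:
  assumes "u \<in> sum_space" and "v \<in> sum_space"
  shows "(\<lambda>s. q s u v) summable_on UNIV"
proof (rule abs_summable_summable)
  let ?g = "\<lambda>s. Re (q s u u) + Re (q s v v)"
  have g: "?g summable_on UNIV"
    using assms by (intro summable_on_add) (auto simp: sum_space_def)
  have le: "norm (q s u v) \<le> ?g s" for s
  proof -
    interpret psd_form UNIV "q s"
      by (rule form)
    have "0 \<le> (ip_norm (q s) u - ip_norm (q s) v)\<^sup>2"
      by simp
    then have "2 * (ip_norm (q s) u * ip_norm (q s) v) \<le> ?g s"
      by (simp add: power2_diff ip_norm_sq mult.assoc)
    moreover have "0 \<le> ip_norm (q s) u * ip_norm (q s) v"
      by (simp add: ip_norm_nonneg)
    ultimately show ?thesis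
      using cauchy_schwarz[of u v] by simp
  qed
  show "(\<lambda>s. norm (q s u v)) summable_on UNIV"
  proof (rule summable_on_UNIV_I)
    fix S :: "'s set" assume "finite S"
    then have "sum ?g S \<le> infsum ?g UNIV"
      using g order_trans[OF norm_ge_zero le] by (intro finite_sum_le_infsum) auto
    then show "(\<Sum>s\<in>S. norm (q s u v)) \<le> infsum ?g UNIV"
      using sum_mono[of S "\<lambda>s. norm (q s u v)" ?g] le by force
  qed simp
qed

lemma Re_sum_ip_self: "u \<in> sum_space \<Longrightarrow> Re (sum_ip u u) = infsum (\<lambda>s. Re (q s u u)) UNIV"
  unfolding sum_ip_def using summable_q[of u u]
  by (simp add: infsum_Re)

lemma sum_le_sum_ip:
  assumes "u \<in> sum_space" and "finite S"
  shows "(\<Sum>s\<in>S. Re (q s u u)) \<le> Re (sum_ip u u)"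
  unfolding Re_sum_ip_self[OF assms(1)]
proof (rule finite_sum_le_infsum)
  fix s
  interpret psd_form UNIV "q s"
    by (rule form)
  show "0 \<le> Re (q s u u)"
    by (simp add: ip_ge_zero)
qed (use assms in \<open>auto simp: sum_space_def\<close>)

lemma sum_space_I:
  assumes "u \<in> V" and B: "\<And>S. finite S \<Longrightarrow> (\<Sum>s\<in>S. Re (q s u u)) \<le> B"
  shows "u \<in> sum_space" "Re (sum_ip u u) \<le> B"
proof -
  have "(\<lambda>s. Re (q s u u)) summable_on UNIV"
    using psd_form.ip_ge_zero[OF form] B by (intro summable_on_UNIV_I[of _ B]) auto
  then show u: "u \<in> sum_space"
    using assms by (simp add: sum_space_def)
  show "Re (sum_ip u u) \<le> B"
    unfolding Re_sum_ip_self[OF u] using u B by (intro infsum_le_finite_sums) (auto simp: sum_space_def)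
qed

lemma sum_space_add:
  assumes "u \<in> sum_space" and "v \<in> sum_space"
  shows "u + v \<in> sum_space"
proof (rule sum_space_I)
  show "u + v \<in> V"
    using assms by (simp add: sum_space_def V_add)
  fix S :: "'s set" assume S: "finite S"
  have "Re (q s (u + v) (u + v)) \<le> 2 * Re (q s u u) + 2 * Re (q s v v)" for s
  proof -
    interpret psd_form UNIV "q s"
      by (rule form)
    show ?thesis
      using parallelogram[of u v] ip_ge_zero[of "u - v"] by simp
  qed
  then have "(\<Sum>s\<in>S. Re (q s (u + v) (u + v))) \<le> (\<Sum>s\<in>S. 2 * Re (q s u u) + 2 * Re (q s v v))"
    by (intro sum_mono)
  also have "\<dots> = 2 * (\<Sum>s\<in>S. Re (q s u u)) + 2 * (\<Sum>s\<in>S. Re (q s v v))"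
    by (simp add: sum.distrib sum_distrib_left)
  also have "\<dots> \<le> 2 * Re (sum_ip u u) + 2 * Re (sum_ip v v)"
    using sum_le_sum_ip[OF assms(1) S] sum_le_sum_ip[OF assms(2) S] by simp
  finally show "(\<Sum>s\<in>S. Re (q s (u + v) (u + v))) \<le> 2 * Re (sum_ip u u) + 2 * Re (sum_ip v v)" .
qed

lemma sum_space_scale:
  assumes "u \<in> sum_space"
  shows "c *\<^sub>C u \<in> sum_space"
proof (rule sum_space_I)
  show "c *\<^sub>C u \<in> V"
    using assms by (simp add: sum_space_def V_scale)
  fix S :: "'s set" assume S: "finite S"
  have "(\<Sum>s\<in>S. Re (q s (c *\<^sub>C u) (c *\<^sub>C u))) = (cmod c)\<^sup>2 * (\<Sum>s\<in>S. Re (q s u u))"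
    by (simp add: psd_form.Re_ip_scaleC[OF form] sum_distrib_left)
  also have "\<dots> \<le> (cmod c)\<^sup>2 * Re (sum_ip u u)"
    using sum_le_sum_ip[OF assms S] by (intro mult_left_mono) auto
  finally show "(\<Sum>s\<in>S. Re (q s (c *\<^sub>C u) (c *\<^sub>C u))) \<le> (cmod c)\<^sup>2 * Re (sum_ip u u)" .
qed

lemma hilbert_sum_space: "hilbert sum_space sum_ip"
proof
  have zero: "Re (q s 0 0) = 0" for s
    using psd_form.ip_zero_left[OF form, of 0 s] by simp
  show "0 \<in> sum_space"
    by (simp add: sum_space_def V_zero zero)
next
  fix u v w and c :: complex assume u: "u \<in> sum_space" and v: "v \<in> sum_space"
  show "u + v \<in> sum_space"
    by (rule sum_space_add[OF u v])
  show "c *\<^sub>C u \<in> sum_space"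
    by (rule sum_space_scale[OF u])
  show "sum_ip (u + v) w = sum_ip u w + sum_ip v w" if w: "w \<in> sum_space"
    unfolding sum_ip_def using summable_q[OF u w] summable_q[OF v w]
    by (simp add: psd_form.ip_add_left[OF form] infsum_add)
  show "sum_ip (c *\<^sub>C u) v = c * sum_ip u v"
    unfolding sum_ip_def by (simp add: psd_form.ip_scaleC_left[OF form] infsum_cmult_right')
  have "q s v u = cnj (q s u v)" for s
    by (rule psd_form.ip_commute[OF form]) simp_all
  then show "sum_ip v u = cnj (sum_ip u v)"
    unfolding sum_ip_def by simp
  show "0 \<le> Re (sum_ip u u)"
    using sum_le_sum_ip[OF u, of "{}"] by simp
next
  fix u assume u: "u \<in> sum_space" and "sum_ip u u = 0"
  then have "Re (q s u u) \<le> 0" for s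
    using sum_le_sum_ip[OF u, of "{s}"] by simp
  then have "Re (q s u u) = 0" for s
    using psd_form.ip_ge_zero[OF form, of u s] by (simp add: order_antisym)
  then show "u = 0"
    using u definite by (simp add: sum_space_def)
next
  fix w :: "nat \<Rightarrow> 'v"
  assume w: "\<And>n. w n \<in> sum_space"
    and cauchy: "\<And>e. e > 0 \<Longrightarrow> \<exists>N. \<forall>m\<ge>N. \<forall>n\<ge>N. ip_norm sum_ip (w m - w n) < e"
  have minus: "u - v \<in> sum_space" if "u \<in> sum_space" "v \<in> sum_space" for u v
    using sum_space_add[OF that(1) sum_space_scale[OF that(2), of "-1"]] by (simp add: scaleC_minus_one)
  have block_le: "ip_norm (q s) u \<le> ip_norm sum_ip u" if "u \<in> sum_space" for s u
    using sum_le_sum_ip[OF that, of "{s}"] by (simp add: ip_norm_def)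
  obtain l where l: "l \<in> V" and lim: "\<And>s. (\<lambda>n. ip_norm (q s) (w n - l)) \<longlonglongrightarrow> 0"
  proof -
    have "\<exists>N. \<forall>m\<ge>N. \<forall>n\<ge>N. ip_norm (q s) (w m - w n) < e" if "e > 0" for s e
      using cauchy[OF that] block_le[OF minus[OF w w]] by (meson le_less_trans)
    then show thesis
      using block_complete[of w] w that by (auto simp: sum_space_def)
  qed
  have V_diff: "u - v \<in> V" if "u \<in> V" "v \<in> V" for u v
    using V_add[OF that(1) V_scale[OF that(2), of "-1"]] by (simp add: scaleC_minus_one)
  have wl: "w n - l \<in> V" for n
    using w[of n] l by (intro V_diff) (auto simp: sum_space_def)
  \<comment> \<open>A Fatou argument: over finitely many blocks the squared distance of w m and w n
    passes to the limit in n, with a bound that does not depend on the blocks chosen.\<close>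
  have tail: "w m - l \<in> sum_space \<and> Re (sum_ip (w m - l) (w m - l)) \<le> e\<^sup>2"
    if N: "\<And>m n. m \<ge> N \<Longrightarrow> n \<ge> N \<Longrightarrow> ip_norm sum_ip (w m - w n) < e" and m: "m \<ge> N" for N m e
  proof -
    have "(\<Sum>s\<in>S. Re (q s (w m - l) (w m - l))) \<le> e\<^sup>2" if S: "finite S" for S
    proof (rule tendsto_upperbound)
      have "(\<lambda>n. Re (q s (w m - w n) (w m - w n))) \<longlonglongrightarrow> Re (q s (w m - l) (w m - l))" for s
      proof -
        interpret psd_form UNIV "q s"
          by (rule form)
        have "(\<lambda>n. ip_norm (q s) (w m - w n)) \<longlonglongrightarrow> ip_norm (q s) (w m - l)"
        proof (rule LIM_zero_cancel, rule tendsto_rabs_zero_cancel, rule Lim_null_comparison[OF _ lim[of s]])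
          have "\<bar>ip_norm (q s) (w m - w n) - ip_norm (q s) (w m - l)\<bar> \<le> ip_norm (q s) (w n - l)" for n
            using ip_norm_triangle_diff[of "w m - w n" "w m - l"] ip_norm_minus_commute[of "w n" l] by simp
          then show "\<forall>\<^sub>F n in sequentially.
              norm \<bar>ip_norm (q s) (w m - w n) - ip_norm (q s) (w m - l)\<bar> \<le> ip_norm (q s) (w n - l)"
            by simp
        qed
        from tendsto_power[OF this, of 2] show ?thesis
          by (simp add: ip_norm_sq)
      qed
      then show "(\<lambda>n. \<Sum>s\<in>S. Re (q s (w m - w n) (w m - w n))) \<longlonglongrightarrow> (\<Sum>s\<in>S. Re (q s (w m - l) (w m - l)))"
        by (intro tendsto_sum)
      show "\<forall>\<^sub>F n in sequentially. (\<Sum>s\<in>S. Re (q s (w m - w n) (w m - w n))) \<le> e\<^sup>2"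
        using eventually_ge_at_top[of N]
      proof eventually_elim
        case (elim n)
        have "0 \<le> Re (sum_ip (w m - w n) (w m - w n))"
          using sum_le_sum_ip[OF minus[OF w w], of "{}"] by simp
        then have "Re (sum_ip (w m - w n) (w m - w n)) = (ip_norm sum_ip (w m - w n))\<^sup>2"
          and "0 \<le> ip_norm sum_ip (w m - w n)"
          by (simp_all add: ip_norm_def)
        then have "Re (sum_ip (w m - w n) (w m - w n)) \<le> e\<^sup>2"
          using N[OF m elim] by (auto intro: power_mono)
        then show ?case
          using sum_le_sum_ip[OF minus[OF w w] S, of m n] by simp
      qed
    qed simp
    then show ?thesis
      using sum_space_I[OF wl] by blast
  qed
  obtain N where N: "\<forall>m\<ge>N. \<forall>n\<ge>N. ip_norm sum_ip (w m - w n) < 1"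
    using cauchy[of 1] by auto
  have "w N - l \<in> sum_space"
    using tail[of N 1 N] N by blast
  then have "w N - (w N - l) \<in> sum_space"
    using w minus by blast
  then have l_space: "l \<in> sum_space"
    by simp
  have "(\<lambda>n. ip_norm sum_ip (w n - l)) \<longlonglongrightarrow> 0"
  proof (rule LIMSEQ_I)
    fix e :: real assume e: "e > 0"
    then obtain N where N: "\<forall>m\<ge>N. \<forall>n\<ge>N. ip_norm sum_ip (w m - w n) < e / 2"
      using cauchy[of "e / 2"] by auto
    have "norm (ip_norm sum_ip (w m - l) - 0) < e" if m: "m \<ge> N" for m
    proof -
      have "Re (sum_ip (w m - l) (w m - l)) \<le> (e / 2)\<^sup>2"
        using tail[of N "e / 2" m] N m by blast
      then have "ip_norm sum_ip (w m - l) \<le> e / 2"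
        using e real_sqrt_le_mono[of "Re (sum_ip (w m - l) (w m - l))" "(e / 2)\<^sup>2"]
        by (simp add: ip_norm_def)
      moreover have "0 \<le> ip_norm sum_ip (w m - l)"
        using sum_le_sum_ip[OF minus[OF w l_space], of "{}"] by (simp add: ip_norm_def)
      ultimately show ?thesis
        using e by simp
    qed
    then show "\<exists>N. \<forall>m\<ge>N. norm (ip_norm sum_ip (w m - l) - 0) < e"
      by blast
  qed
  then show "\<exists>l\<in>sum_space. (\<lambda>n. ip_norm sum_ip (w n - l)) \<longlonglongrightarrow> 0"
    using l_space by blast
qed

end

section \<open>The kernel\<close>

lemma infsum_finite_sum:
  fixes f :: "'i \<Rightarrow> 'a \<Rightarrow> real"
  assumes "finite I" and "\<And>i. i \<in> I \<Longrightarrow> f i summable_on S"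
  shows "(\<lambda>x. \<Sum>i\<in>I. f i x) summable_on S" "infsum (\<lambda>x. \<Sum>i\<in>I. f i x) S = (\<Sum>i\<in>I. infsum (f i) S)"
proof -
  have "(\<lambda>x. \<Sum>i\<in>I. f i x) summable_on S \<and> infsum (\<lambda>x. \<Sum>i\<in>I. f i x) S = (\<Sum>i\<in>I. infsum (f i) S)"
    using assms by (induction I rule: finite_induct) (auto simp: summable_on_add infsum_add)
  then show "(\<lambda>x. \<Sum>i\<in>I. f i x) summable_on S" "infsum (\<lambda>x. \<Sum>i\<in>I. f i x) S = (\<Sum>i\<in>I. infsum (f i) S)"
    by auto
qed

text \<open>One-dimensional blocks: the resulting Hilbert sum is the space of square summable
  families, which serves as coefficient space.\<close>

lemma hilbert_sum_coordinates:
  "hilbert_sum (\<lambda>i v w. v i * cnj (w i)) (UNIV :: ('i \<Rightarrow> complex) set)"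
proof (rule hilbert_sum.intro)
  fix s :: 'i
  have "psd_form UNIV (\<lambda>v w :: 'i \<Rightarrow> complex. \<Sum>z\<in>{s}. v z * cnj (w z))"
    by (rule psd_form_standard)
  then show "psd_form UNIV (\<lambda>v w :: 'i \<Rightarrow> complex. v s * cnj (w s))"
    by simp
next
  fix u :: "'i \<Rightarrow> complex" assume "\<And>s. Re (u s * cnj (u s)) = 0"
  then have "u s = 0" for s
    by (simp add: complex_eq_iff flip: power2_eq_square)
  then show "u = 0"
    by (simp add: fun_eq_iff)
next
  fix w :: "nat \<Rightarrow> 'i \<Rightarrow> complex"
  have norm_eq: "ip_norm (\<lambda>v w. v s * cnj (w s)) v = cmod (v s)" for s and v :: "'i \<Rightarrow> complex"
    by (simp add: ip_norm_def cmod_def power2_eq_square)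
  assume "\<And>s e. e > 0 \<Longrightarrow> \<exists>N. \<forall>m\<ge>N. \<forall>n\<ge>N. ip_norm (\<lambda>v w. v s * cnj (w s)) (w m - w n) < e"
  then have "Cauchy (\<lambda>n. w n s)" for s
    unfolding norm_eq by (intro CauchyI) simp
  then have "\<exists>l. (\<lambda>n. w n s) \<longlonglongrightarrow> l" for s
    by (simp add: Cauchy_convergent_iff convergent_def)
  then obtain l where l: "\<And>s. (\<lambda>n. w n s) \<longlonglongrightarrow> l s"
    by metis
  then have "(\<lambda>n. cmod (w n s - l s)) \<longlonglongrightarrow> 0" for s
    by (simp add: LIM_zero tendsto_norm_zero)
  then show "\<exists>l\<in>UNIV. \<forall>s. (\<lambda>n. ip_norm (\<lambda>v w. v s * cnj (w s)) (w n - l)) \<longlonglongrightarrow> 0"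
    unfolding norm_eq by (intro bexI[of _ l]) auto
qed simp_all

text \<open>Functions on the finite set Z are combinations of the point functions. Thus convergence
  at the points of Z implies convergence for Q, as completeness of the blocks requires.\<close>

lemma rep_form_norm_le:
  assumes Q: "rep_form A nrm Z Q" and Z: "finite Z"
  shows "ip_norm Q v \<le> (\<Sum>z\<in>Z. cmod (v z) * ip_norm Q (\<lambda>y. if y = z then 1 else 0))"
proof -
  interpret psd_form UNIV Q
    using Q by (simp add: rep_form_def)
  define \<delta> :: "nat \<times> 'a \<Rightarrow> nat \<times> 'a \<Rightarrow> complex" where "\<delta> z = (\<lambda>y. if y = z then 1 else 0)" for z
  have "ip_norm Q (\<Sum>z\<in>W. v z *\<^sub>C \<delta> z) \<le> (\<Sum>z\<in>W. cmod (v z) * ip_norm Q (\<delta> z))" if "finite W" for W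
    using that
  proof (induction W rule: finite_induct)
    case empty
    show ?case
      unfolding sum.empty by (simp only: ip_norm_zero)
  next
    case (insert z W)
    have "ip_norm Q (\<Sum>z\<in>insert z W. v z *\<^sub>C \<delta> z) \<le>
        ip_norm Q (v z *\<^sub>C \<delta> z) + ip_norm Q (\<Sum>z\<in>W. v z *\<^sub>C \<delta> z)"
      unfolding sum.insert[OF insert.hyps] by (rule ip_norm_triangle) simp_all
    also have "ip_norm Q (v z *\<^sub>C \<delta> z) = cmod (v z) * ip_norm Q (\<delta> z)"
      by (rule ip_norm_scaleC) simp
    also have "cmod (v z) * ip_norm Q (\<delta> z) + ip_norm Q (\<Sum>z\<in>W. v z *\<^sub>C \<delta> z) \<le>
        (\<Sum>z\<in>insert z W. cmod (v z) * ip_norm Q (\<delta> z))"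
      using insert by simp
    finally show ?case .
  qed
  from this[OF Z] have le: "ip_norm Q (\<Sum>z\<in>Z. v z *\<^sub>C \<delta> z) \<le> (\<Sum>z\<in>Z. cmod (v z) * ip_norm Q (\<delta> z))" .
  have agree: "\<forall>z\<in>Z. v z = (\<Sum>z\<in>Z. v z *\<^sub>C \<delta> z) z"
  proof
    fix y assume "y \<in> Z"
    have "(\<Sum>z\<in>Z. v z *\<^sub>C \<delta> z) y = (\<Sum>z\<in>Z. if z = y then v z else 0)"
      unfolding sum_fun_apply by (intro sum.cong) (auto simp: \<delta>_def scaleC_fun_def)
    then show "v y = (\<Sum>z\<in>Z. v z *\<^sub>C \<delta> z) y"
      using Z \<open>y \<in> Z\<close> by simp
  qed
  define u where "u = (\<Sum>z\<in>Z. v z *\<^sub>C \<delta> z)"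
  have loc: "Q v w = Q u w" for w
    using Q agree unfolding u_def rep_form_def by blast
  have "Q v v = Q u v"
    by (rule loc)
  also have "\<dots> = cnj (Q v u)"
    by (rule ip_commute) simp_all
  also have "Q v u = Q u u"
    by (rule loc)
  finally have "Re (Q v v) = Re (Q u u)"
    by simp
  then show ?thesis
    using le by (simp add: ip_norm_def u_def \<delta>_def)
qed

type_synonym 'x block_index = "nat \<times> (nat \<Rightarrow> nat \<Rightarrow> 'x \<Rightarrow> complex)"

text \<open>Every number below a quotient norm is witnessed by some member of the family. An index
  that encodes nothing can be given the empty \<open>Zs s\<close>, which leaves it a zero
  block.\<close>

locale norming_family = function_operator_algebra A nrm
  for A :: "('x \<Rightarrow> complex) set" and nrm +
  fixes Zs :: "'x block_index \<Rightarrow> (nat \<times> 'x) set"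
    and Q :: "'x block_index \<Rightarrow> (nat \<times> 'x \<Rightarrow> complex) \<Rightarrow> (nat \<times> 'x \<Rightarrow> complex) \<Rightarrow> complex"
  assumes finite_Zs: "finite (Zs s)"
    and rep: "rep_form A nrm (Zs s) (Q s)"
    and norming: "n > 0 \<Longrightarrow> G \<in> Mat A n \<Longrightarrow> finite F \<Longrightarrow> 0 \<le> r \<Longrightarrow> r < quotient_norm A nrm F G \<Longrightarrow>
      \<exists>s. Zs s = {..<n} \<times> F \<and> r\<^sup>2 * (\<Sum>j<n. Re (Q s (unit_row j) (unit_row j))) \<le>
        (\<Sum>i<n. Re (Q s (fun_mat_act n (\<lambda>i k. G $$ (i, k)) unit_row i)
          (fun_mat_act n (\<lambda>i k. G $$ (i, k)) unit_row i)))"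
begin

text \<open>A function from points to families is regrouped by modules: component s becomes a
  function of (j, x), on which the form Q s is evaluated.\<close>

definition block :: "'x block_index \<Rightarrow> ('x \<Rightarrow> 'x kernel_index \<Rightarrow> complex) \<Rightarrow> nat \<times> 'x \<Rightarrow> complex" where
  "block s h = (\<lambda>(j, x). h x (fst s, snd s, j))"

definition supported :: "('x \<Rightarrow> 'x kernel_index \<Rightarrow> complex) set" where
  "supported = {h. \<forall>s z. z \<notin> Zs s \<longrightarrow> block s h z = 0}"

lemma supportedD: "h \<in> supported \<Longrightarrow> z \<notin> Zs s \<Longrightarrow> block s h z = 0"
  unfolding supported_def by blast

lemma psd: "psd_form UNIV (Q s)"
  and Q_local: "(\<forall>z\<in>Zs s. v z = v' z) \<Longrightarrow> Q s v w = Q s v' w"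
  and Q_dominates: "(\<Sum>z\<in>Zs s. (cmod (v z))\<^sup>2) \<le> Re (Q s v v)"
  and Q_contractive: "m > 0 \<Longrightarrow> T \<in> Mat A m \<Longrightarrow>
    (\<Sum>i<m. Re (Q s (fun_mat_act m (\<lambda>i k. T $$ (i, k)) b i) (fun_mat_act m (\<lambda>i k. T $$ (i, k)) b i))) \<le>
    (nrm T)\<^sup>2 * (\<Sum>k<m. Re (Q s (b k) (b k)))"
  using rep[of s] unfolding rep_form_def by blast+

lemma Re_Q_cong:
  assumes "\<And>z. z \<in> Zs s \<Longrightarrow> v z = v' z"
  shows "Re (Q s v v) = Re (Q s v' v')"
proof -
  interpret psd_form UNIV "Q s"
    by (rule psd)
  have "Q s v v = Q s v' v"
    using assms by (intro Q_local) simp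
  also have "\<dots> = cnj (Q s v v')"
    by (rule ip_commute) simp_all
  also have "Q s v v' = Q s v' v'"
    using assms by (intro Q_local) simp
  finally show ?thesis by simp
qed

lemma block_add: "block s (g + h) = block s g + block s h"
  and block_diff: "block s (g - h) = block s g - block s h"
  and block_scale: "block s (c *\<^sub>C h) = c *\<^sub>C block s h"
  by (auto simp: block_def fun_eq_iff scaleC_fun_def)

lemma block_of_sum: "block s (\<Sum>i\<in>I. h i) = (\<lambda>z. \<Sum>i\<in>I. block s (h i) z)"
  by (auto simp: block_def fun_eq_iff sum_fun_apply)

lemma function_eq_blockI: "(\<And>s z. block s g z = block s h z) \<Longrightarrow> g = h"
  by (force simp: block_def fun_eq_iff)

lemma hilbert_sum_blocks: "hilbert_sum (\<lambda>s g h. Q s (block s g) (block s h)) supported"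
proof (rule hilbert_sum.intro)
  fix s
  show "psd_form UNIV (\<lambda>g h. Q s (block s g) (block s h))"
    by (rule psd_form_pullback[where L = "block s" and ip = "Q s"]) (rule psd block_add block_scale)+
next
  show "0 \<in> supported"
    by (auto simp: supported_def block_def)
  fix g h and c :: complex assume "g \<in> supported" and "h \<in> supported"
  then show "g + h \<in> supported" and "c *\<^sub>C g \<in> supported"
    by (auto simp: supported_def block_add block_scale scaleC_apply)
next
  fix u assume u: "u \<in> supported" and zero: "\<And>s. Re (Q s (block s u) (block s u)) = 0"
  show "u = 0"
  proof (rule function_eq_blockI)
    fix s z
    have "block s u z = 0"
    proof (cases "z \<in> Zs s")
      case True
      have "(\<Sum>z\<in>Zs s. (cmod (block s u z))\<^sup>2) = 0"
        using Q_dominates[of "block s u" s] zero[of s] by (simp add: sum_nonneg order_antisym)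
      then show ?thesis
        using True finite_Zs[of s] by (simp add: sum_nonneg_eq_0_iff)
    qed (rule supportedD[OF u])
    then show "block s u z = block s 0 z"
      by (auto simp: block_def)
  qed
next
  fix w :: "nat \<Rightarrow> 'x \<Rightarrow> 'x kernel_index \<Rightarrow> complex"
  assume w: "\<And>n. w n \<in> supported"
    and cauchy: "\<And>s e. e > 0 \<Longrightarrow>
      \<exists>N. \<forall>m\<ge>N. \<forall>n\<ge>N. ip_norm (\<lambda>g h. Q s (block s g) (block s h)) (w m - w n) < e"
  have norm_eq: "ip_norm (\<lambda>g h. Q s (block s g) (block s h)) h = ip_norm (Q s) (block s h)" for s h
    by (simp add: ip_norm_def)
  have coord: "cmod (block s h z) \<le> ip_norm (Q s) (block s h)" if "z \<in> Zs s" for s h z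
  proof -
    have "(cmod (block s h z))\<^sup>2 \<le> (\<Sum>z\<in>Zs s. (cmod (block s h z))\<^sup>2)"
      using that finite_Zs by (intro member_le_sum) auto
    also have "\<dots> \<le> Re (Q s (block s h) (block s h))"
      by (rule Q_dominates)
    finally show ?thesis
      by (simp add: ip_norm_def real_le_rsqrt)
  qed
  \<comment> \<open>Q s dominates the coordinates, so Cauchy sequences converge at each point of
    \<open>Zs s\<close>; finiteness of \<open>Zs s\<close> turns this back into convergence for Q
    s.\<close>
  define l where "l s z = lim (\<lambda>n. block s (w n) z)" for s z
  have l: "(\<lambda>n. block s (w n) z) \<longlonglongrightarrow> l s z" if z: "z \<in> Zs s" for s z
  proof -
    have "Cauchy (\<lambda>n. block s (w n) z)"
    proof (rule CauchyI)
      fix e :: real assume "e > 0"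
      then obtain N where N: "\<forall>m\<ge>N. \<forall>n\<ge>N. ip_norm (Q s) (block s (w m - w n)) < e"
        using cauchy[of e s] unfolding norm_eq by blast
      have "norm (block s (w m) z - block s (w n) z) < e" if "m \<ge> N" "n \<ge> N" for m n
        using N that coord[OF z, of "w m - w n"] by (force simp: block_diff)
      then show "\<exists>N. \<forall>m\<ge>N. \<forall>n\<ge>N. norm (block s (w m) z - block s (w n) z) < e"
        by blast
    qed
    then show ?thesis
      by (simp add: Cauchy_convergent_iff convergent_LIMSEQ_iff l_def)
  qed
  define g :: "'x \<Rightarrow> 'x kernel_index \<Rightarrow> complex" where
    "g = (\<lambda>x (k, d, j). if (j, x) \<in> Zs (k, d) then l (k, d) (j, x) else 0)"
  have block_g: "block s g z = (if z \<in> Zs s then l s z else 0)" for s z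
    by (cases s; cases z) (auto simp: block_def g_def)
  have "(\<lambda>n. ip_norm (Q s) (block s (w n - g))) \<longlonglongrightarrow> 0" for s
  proof (rule Lim_null_comparison)
    have nonneg: "0 \<le> ip_norm (Q s) v" for v
      using psd_form.ip_norm_nonneg[OF psd] by simp
    show "\<forall>\<^sub>F n in sequentially. norm (ip_norm (Q s) (block s (w n - g))) \<le>
        (\<Sum>z\<in>Zs s. cmod (block s (w n - g) z) * ip_norm (Q s) (\<lambda>y. if y = z then 1 else 0))"
      using rep_form_norm_le[OF rep finite_Zs] nonneg by simp
    have "(\<lambda>n. cmod (block s (w n - g) z)) \<longlonglongrightarrow> 0" if "z \<in> Zs s" for z
      using l[OF that] that by (simp add: block_diff block_g LIM_zero tendsto_norm_zero)
    then have "(\<lambda>n. \<Sum>z\<in>Zs s. cmod (block s (w n - g) z) * ip_norm (Q s) (\<lambda>y. if y = z then 1 else 0))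
        \<longlonglongrightarrow> (\<Sum>z\<in>Zs s. 0 * ip_norm (Q s) (\<lambda>y. if y = z then 1 else 0))"
      by (intro tendsto_sum tendsto_mult tendsto_const)
    then show "(\<lambda>n. \<Sum>z\<in>Zs s. cmod (block s (w n - g) z) * ip_norm (Q s) (\<lambda>y. if y = z then 1 else 0)) \<longlonglongrightarrow> 0"
      by simp
  qed
  moreover have "g \<in> supported"
    by (simp add: supported_def block_g)
  ultimately show "\<exists>l\<in>supported. \<forall>s. (\<lambda>n. ip_norm (\<lambda>g h. Q s (block s g) (block s h)) (w n - l)) \<longlonglongrightarrow> 0"
    unfolding norm_eq by blast
qed

section \<open>The Hilbert sum L, the coefficient space C and the kernel\<close>

sublocale L: hilbert_sum "\<lambda>s g h. Q s (block s g) (block s h)" supported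
  by (rule hilbert_sum_blocks)

sublocale L: hilbert L.sum_space L.sum_ip
  by (rule L.hilbert_sum_space)

sublocale C: hilbert_sum "\<lambda>i v w. v i * cnj (w i)" "UNIV :: ('x kernel_index \<Rightarrow> complex) set"
  by (rule hilbert_sum_coordinates)

sublocale C: hilbert C.sum_space C.sum_ip
  by (rule C.hilbert_sum_space)

text \<open>For fixed x the coordinates of h x are some of the values of the blocks of h on the sets
  \<open>Zs s\<close>, and Q s dominates the sum of the squares of all these values.\<close>

lemma evaluation_norm:
  assumes h: "h \<in> L.sum_space"
  shows "h x \<in> C.sum_space" "Re (C.sum_ip (h x) (h x)) \<le> Re (L.sum_ip h h)"
proof -
  have bound: "(\<Sum>i\<in>J. Re (h x i * cnj (h x i))) \<le> Re (L.sum_ip h h)" if J: "finite J" for J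
  proof -
    define p :: "'x kernel_index \<Rightarrow> 'x block_index" where "p = (\<lambda>(k, d, j). (k, d))"
    have "(\<Sum>i\<in>J. Re (h x i * cnj (h x i))) = (\<Sum>s\<in>p ` J. \<Sum>i\<in>{i \<in> J. p i = s}. Re (h x i * cnj (h x i)))"
      by (rule sum.image_gen[OF J])
    also have "\<dots> \<le> (\<Sum>s\<in>p ` J. Re (Q s (block s h) (block s h)))"
    proof (rule sum_mono)
      fix s
      have "(\<Sum>i\<in>{i \<in> J. p i = s}. Re (h x i * cnj (h x i))) =
          (\<Sum>i\<in>{i \<in> J. p i = s \<and> (snd (snd i), x) \<in> Zs s}. (cmod (h x i))\<^sup>2)"
      proof (rule sum.mono_neutral_cong_right)
        show "\<forall>i\<in>{i \<in> J. p i = s} - {i \<in> J. p i = s \<and> (snd (snd i), x) \<in> Zs s}. Re (h x i * cnj (h x i)) = 0"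
        proof
          fix i assume "i \<in> {i \<in> J. p i = s} - {i \<in> J. p i = s \<and> (snd (snd i), x) \<in> Zs s}"
          then have "(snd (snd i), x) \<notin> Zs s" and i: "p i = s"
            by auto
          then have "block s h (snd (snd i), x) = 0"
            by (intro supportedD L.sum_space_subset[OF h])
          moreover have "i = (fst s, snd s, snd (snd i))"
            using i by (auto simp: p_def split: prod.splits)
          ultimately have "h x i = 0"
            unfolding block_def by (metis case_prod_conv)
          then show "Re (h x i * cnj (h x i)) = 0"
            by simp
        qed
        show "Re (h x i * cnj (h x i)) = (cmod (h x i))\<^sup>2" for i
          by (simp flip: complex_norm_square)
      qed (use J in auto)
      also have "\<dots> \<le> (\<Sum>z\<in>Zs s. (cmod (block s h z))\<^sup>2)"
      proof (rule sum_le_included[where i = "\<lambda>z. (fst s, snd s, fst z)"])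
        show "\<forall>i\<in>{i \<in> J. p i = s \<and> (snd (snd i), x) \<in> Zs s}.
            \<exists>z\<in>Zs s. (fst s, snd s, fst z) = i \<and> (cmod (h x i))\<^sup>2 \<le> (cmod (block s h z))\<^sup>2"
        proof
          fix i assume "i \<in> {i \<in> J. p i = s \<and> (snd (snd i), x) \<in> Zs s}"
          then show "\<exists>z\<in>Zs s. (fst s, snd s, fst z) = i \<and> (cmod (h x i))\<^sup>2 \<le> (cmod (block s h z))\<^sup>2"
            by (intro bexI[of _ "(snd (snd i), x)"]) (auto simp: p_def block_def split: prod.splits)
        qed
      qed (use J finite_Zs in auto)
      also have "\<dots> \<le> Re (Q s (block s h) (block s h))"
        by (rule Q_dominates)
      finally show "(\<Sum>i\<in>{i \<in> J. p i = s}. Re (h x i * cnj (h x i))) \<le> Re (Q s (block s h) (block s h))" .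
    qed
    also have "\<dots> \<le> Re (L.sum_ip h h)"
      using J by (intro L.sum_le_sum_ip[OF h]) simp
    finally show ?thesis .
  qed
  show "h x \<in> C.sum_space" "Re (C.sum_ip (h x) (h x)) \<le> Re (L.sum_ip h h)"
    using C.sum_space_I[of "h x"] bound by auto
qed

lemma evaluation_ip_norm: "h \<in> L.sum_space \<Longrightarrow> ip_norm C.sum_ip (h x) \<le> ip_norm L.sum_ip h"
  by (simp add: ip_norm_def evaluation_norm)

text \<open>The adjoint of evaluation at y, applied to v.\<close>

definition kernel_fun :: "'x \<Rightarrow> ('x kernel_index \<Rightarrow> complex) \<Rightarrow> 'x \<Rightarrow> 'x kernel_index \<Rightarrow> complex" where
  "kernel_fun y v = (SOME l. l \<in> L.sum_space \<and> (\<forall>g\<in>L.sum_space. C.sum_ip (g y) v = L.sum_ip g l))"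

lemma kernel_fun:
  assumes v: "v \<in> C.sum_space"
  shows "kernel_fun y v \<in> L.sum_space"
    and "g \<in> L.sum_space \<Longrightarrow> L.sum_ip g (kernel_fun y v) = C.sum_ip (g y) v"
proof -
  have "\<exists>l\<in>L.sum_space. \<forall>g\<in>L.sum_space. C.sum_ip (g y) v = L.sum_ip g l"
  proof (rule L.riesz)
    fix g h and c :: complex assume g: "g \<in> L.sum_space"
    show "C.sum_ip ((g + h) y) v = C.sum_ip (g y) v + C.sum_ip (h y) v" if "h \<in> L.sum_space"
      using C.ip_add_left[OF evaluation_norm(1)[OF g] evaluation_norm(1)[OF that] v] by simp
    show "C.sum_ip ((c *\<^sub>C g) y) v = c * C.sum_ip (g y) v"
      using C.ip_scaleC_left[OF evaluation_norm(1)[OF g] v] by (simp add: scaleC_apply)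
    have "cmod (C.sum_ip (g y) v) \<le> ip_norm C.sum_ip (g y) * ip_norm C.sum_ip v"
      by (rule C.cauchy_schwarz[OF evaluation_norm(1)[OF g] v])
    also have "\<dots> \<le> ip_norm L.sum_ip g * ip_norm C.sum_ip v"
      by (intro mult_right_mono evaluation_ip_norm g C.ip_norm_nonneg v)
    finally show "cmod (C.sum_ip (g y) v) \<le> ip_norm C.sum_ip v * ip_norm L.sum_ip g"
      by (simp add: mult.commute)
  qed
  then have "kernel_fun y v \<in> L.sum_space \<and>
      (\<forall>g\<in>L.sum_space. C.sum_ip (g y) v = L.sum_ip g (kernel_fun y v))"
    unfolding kernel_fun_def Bex_def by (rule someI_ex)
  then show "kernel_fun y v \<in> L.sum_space"
    and "g \<in> L.sum_space \<Longrightarrow> L.sum_ip g (kernel_fun y v) = C.sum_ip (g y) v"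
    by auto
qed

lemma kernel_fun_eqI:
  assumes v: "v \<in> C.sum_space" and l: "l \<in> L.sum_space"
    and eq: "\<And>g. g \<in> L.sum_space \<Longrightarrow> L.sum_ip g l = C.sum_ip (g y) v"
  shows "kernel_fun y v = l"
proof -
  define d where "d = kernel_fun y v - l"
  have d: "d \<in> L.sum_space"
    by (simp add: d_def L.diff_mem kernel_fun[OF v] l)
  have "L.sum_ip d d = 0"
    using eq[OF d] kernel_fun(2)[OF v d, of y] L.ip_diff_right[OF kernel_fun(1)[OF v, of y] l d]
    by (simp add: d_def)
  then have "d = 0"
    using L.ip_definite[OF d] by blast
  then show ?thesis
    by (simp add: d_def)
qed

text \<open>Evaluation at x composed with the adjoint of evaluation at y.\<close>

definition K :: "'x \<Rightarrow> 'x \<Rightarrow> ('x kernel_index \<Rightarrow> complex) \<Rightarrow> 'x kernel_index \<Rightarrow> complex" where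
  "K x y v = kernel_fun y v x"

lemma kernel_bounded: "K x y \<in> bounded_ops C.sum_space C.sum_ip"
  unfolding bounded_ops_def
proof (intro CollectI conjI ballI allI)
  fix u v and c :: complex assume u: "u \<in> C.sum_space"
  show "K x y u \<in> C.sum_space"
    unfolding K_def by (intro evaluation_norm kernel_fun u)
  show "K x y (u + v) = K x y u + K x y v" if v: "v \<in> C.sum_space"
  proof -
    have "kernel_fun y (u + v) = kernel_fun y u + kernel_fun y v"
      by (rule kernel_fun_eqI)
        (simp_all add: u v C.add_mem L.add_mem kernel_fun L.ip_add_right C.ip_add_right evaluation_norm)
    then show ?thesis
      by (simp add: K_def)
  qed
  have "kernel_fun y (c *\<^sub>C u) = c *\<^sub>C kernel_fun y u"
    by (rule kernel_fun_eqI)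
      (simp_all add: u C.scaleC_mem L.scaleC_mem kernel_fun L.ip_scaleC_right C.ip_scaleC_right evaluation_norm)
  then show "K x y (c *\<^sub>C u) = c *\<^sub>C K x y u"
    by (simp add: K_def scaleC_apply)
next
  \<comment> \<open>Both evaluations are contractions, hence so is the adjoint of one followed by
    the other.\<close>
  have "ip_norm C.sum_ip (K x y u) \<le> 1 * ip_norm C.sum_ip u" if u: "u \<in> C.sum_space" for u
  proof -
    define k where "k = kernel_fun y u"
    have k: "k \<in> L.sum_space"
      unfolding k_def by (rule kernel_fun[OF u])
    have "(ip_norm L.sum_ip k)\<^sup>2 = Re (C.sum_ip (k y) u)"
      using kernel_fun(2)[OF u k, of y] k by (simp add: L.ip_norm_sq k_def)
    also have "\<dots> \<le> ip_norm C.sum_ip (k y) * ip_norm C.sum_ip u"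
      using C.cauchy_schwarz[OF evaluation_norm(1)[OF k] u] complex_Re_le_cmod order_trans by blast
    also have "\<dots> \<le> ip_norm L.sum_ip k * ip_norm C.sum_ip u"
      by (intro mult_right_mono evaluation_ip_norm k C.ip_norm_nonneg u)
    finally have "ip_norm L.sum_ip k * ip_norm L.sum_ip k \<le> ip_norm L.sum_ip k * ip_norm C.sum_ip u"
      by (simp add: power2_eq_square)
    then have "ip_norm L.sum_ip k \<le> ip_norm C.sum_ip u"
      using L.ip_norm_nonneg[OF k] C.ip_norm_nonneg[OF u] by (cases "ip_norm L.sum_ip k = 0") auto
    then show ?thesis
      using evaluation_ip_norm[OF k, of x] by (simp add: K_def k_def)
  qed
  then show "\<exists>M. \<forall>u\<in>C.sum_space. ip_norm C.sum_ip (K x y u) \<le> M * ip_norm C.sum_ip u"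
    by blast
qed

text \<open>The double sum is the squared norm of the vector W, the sum of the kernel functions of
  the v j at the x j.\<close>

lemma kernel_positive_definite: "positive_definite_kernel C.sum_space C.sum_ip K"
  unfolding positive_definite_kernel_def
proof (intro conjI allI impI kernel_bounded)
  fix n :: nat and x :: "nat \<Rightarrow> 'x" and v :: "nat \<Rightarrow> 'x kernel_index \<Rightarrow> complex"
  assume v: "\<forall>i<n. v i \<in> C.sum_space"
  define W where "W = (\<Sum>j<n. kernel_fun (x j) (v j))"
  have k: "kernel_fun (x j) (v j) \<in> L.sum_space" if "j < n" for j
    using v that by (simp add: kernel_fun)
  have W: "W \<in> L.sum_space"
    unfolding W_def using k by (intro L.sum_mem) simp
  have "(\<Sum>i<n. \<Sum>j<n. C.sum_ip (K (x i) (x j) (v j)) (v i)) =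
      (\<Sum>i<n. \<Sum>j<n. L.sum_ip (kernel_fun (x j) (v j)) (kernel_fun (x i) (v i)))"
    using v k by (intro sum.cong refl) (simp add: kernel_fun(2) K_def)
  also have "\<dots> = (\<Sum>i<n. L.sum_ip W (kernel_fun (x i) (v i)))"
    unfolding W_def using k by (intro sum.cong refl L.ip_sum_left[symmetric]) auto
  also have "\<dots> = L.sum_ip W W"
    by (subst (3) W_def, rule L.ip_sum_right[symmetric]) (use k W in auto)
  finally have eq: "(\<Sum>i<n. \<Sum>j<n. C.sum_ip (K (x i) (x j) (v j)) (v i)) = L.sum_ip W W" .
  show "(\<Sum>i<n. \<Sum>j<n. C.sum_ip (K (x i) (x j) (v j)) (v i)) \<in> \<real>"
    unfolding eq by (subst L.ip_self[OF W]) simp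
  show "0 \<le> Re (\<Sum>i<n. \<Sum>j<n. C.sum_ip (K (x i) (x j) (v j)) (v i))"
    unfolding eq by (rule L.ip_ge_zero[OF W])
qed

lemma kernel_rkhs: "rkhs C.sum_space C.sum_ip K L.sum_space L.sum_ip"
proof -
  have "(\<lambda>x. K x y v) = kernel_fun y v" for y v
    by (simp add: K_def fun_eq_iff)
  then show ?thesis
    unfolding rkhs_def by (auto simp: L.hilbert_sum_space evaluation_norm kernel_fun)
qed

end

section \<open>Multipliers\<close>

context function_operator_algebra
begin

lemma quotient_norm_nonneg:
  assumes n: "n > 0" and G: "G \<in> Mat A n"
  shows "0 \<le> quotient_norm A nrm F G"
  unfolding quotient_norm_def
proof (rule cInf_greatest)
  have d: "dim_row G = n" and c: "G \<in> carrier_mat n n"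
    using G by (auto simp: Mat_iff)
  have "0\<^sub>m n n \<in> Mat (vanishing_ideal A F) (dim_row G)"
    by (auto simp: Mat_iff d vanishing_ideal_def zero_mem)
  then show "{nrm (G + H) |H. H \<in> Mat (vanishing_ideal A F) (dim_row G)} \<noteq> {}"
    by blast
  fix x assume "x \<in> {nrm (G + H) |H. H \<in> Mat (vanishing_ideal A F) (dim_row G)}"
  then obtain H where H: "x = nrm (G + H)" "H \<in> Mat (vanishing_ideal A F) n"
    unfolding d by blast
  then have "G + H \<in> Mat A n"
    using G by (auto simp: Mat_iff vanishing_ideal_def intro!: add_mem)
  then show "0 \<le> x"
    using H nrm_nonneg[OF n] by simp
qed

lemma quotient_norm_le:
  assumes n: "n > 0" and G: "G \<in> Mat A n" and H: "H \<in> Mat (vanishing_ideal A F) n"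
  shows "quotient_norm A nrm F G \<le> nrm (G + H)"
  unfolding quotient_norm_def
proof (rule cInf_lower)
  have d: "dim_row G = n"
    using G by (auto simp: Mat_iff)
  show "nrm (G + H) \<in> {nrm (G + H) |H. H \<in> Mat (vanishing_ideal A F) (dim_row G)}"
    using H d by blast
  have "0 \<le> nrm (G + H)" if "H \<in> Mat (vanishing_ideal A F) n" for H
    using that G by (intro nrm_nonneg[OF n]) (auto simp: Mat_iff vanishing_ideal_def intro!: add_mem)
  then show "bdd_below {nrm (G + H) |H. H \<in> Mat (vanishing_ideal A F) (dim_row G)}"
    unfolding d by (auto simp: bdd_below_def intro!: exI[of _ 0])
qed

lemma quotient_norm_le_nrm:
  assumes n: "n > 0" and G: "G \<in> Mat A n"
  shows "quotient_norm A nrm F G \<le> nrm G"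
proof -
  have "G + 0\<^sub>m n n = G"
    using G by (auto simp: Mat_iff)
  then show ?thesis
    using quotient_norm_le[OF n G, of "0\<^sub>m n n" F] by (simp add: Mat_iff vanishing_ideal_def zero_mem)
qed

text \<open>This keeps the empty set F out of the norming arguments: its module is zero and contains
  no test vector.\<close>

lemma quotient_norm_empty:
  assumes n: "n > 0" and G: "G \<in> Mat A n"
  shows "quotient_norm A nrm {} G = 0"
proof -
  have mem: "- G \<in> Mat (vanishing_ideal A {}) n"
    using G by (auto simp: Mat_iff vanishing_ideal_def intro!: minus_mem)
  have "G + - G = 0\<^sub>m n n"
    using G by (auto simp: Mat_iff)
  moreover have "nrm (0\<^sub>m n n) = 0"
    using nrm_eq_0[OF n, of "0\<^sub>m n n"] by (simp add: Mat_iff zero_mem)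
  ultimately have "quotient_norm A nrm {} G \<le> 0"
    using quotient_norm_le[OF n G mem] by simp
  then show ?thesis
    using quotient_norm_nonneg[OF n G] by (simp add: order_antisym)
qed

lemma quotient_norm_lessD:
  assumes n: "n > 0" and G: "G \<in> Mat A n" and less: "quotient_norm A nrm F G < t"
  shows "\<exists>H\<in>Mat (vanishing_ideal A F) n. nrm (G + H) < t"
proof -
  have d: "dim_row G = n"
    using G by (auto simp: Mat_iff)
  have "0\<^sub>m n n \<in> Mat (vanishing_ideal A F) n"
    by (auto simp: Mat_iff vanishing_ideal_def zero_mem)
  then have "{nrm (G + H) |H. H \<in> Mat (vanishing_ideal A F) n} \<noteq> {}"
    by blast
  from cInf_lessD[OF this] show ?thesis
    using less unfolding quotient_norm_def d by blast
qed

end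

section \<open>The multiplier algebra of L\<close>

context norming_family
begin

definition embed :: "'x block_index \<Rightarrow> (nat \<times> 'x \<Rightarrow> complex) \<Rightarrow> 'x \<Rightarrow> 'x kernel_index \<Rightarrow> complex" where
  "embed s v = (\<lambda>x (k, d, j). if (k, d) = s \<and> (j, x) \<in> Zs s then v (j, x) else 0)"

lemma block_embed: "block t (embed s v) z = (if t = s \<and> z \<in> Zs s then v z else 0)"
  by (cases z; cases t) (auto simp: block_def embed_def)

lemma embed_norm:
  "embed s v \<in> L.sum_space" "Re (L.sum_ip (embed s v) (embed s v)) = Re (Q s v v)"
proof -
  have V: "embed s v \<in> supported"
    by (simp add: supported_def block_embed)
  have same: "Re (Q s (block s (embed s v)) (block s (embed s v))) = Re (Q s v v)"
    by (rule Re_Q_cong) (simp add: block_embed)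
  have other: "Re (Q t (block t (embed s v)) (block t (embed s v))) = 0" if "t \<noteq> s" for t
  proof -
    have "block t (embed s v) = 0"
      using that by (simp add: fun_eq_iff block_embed)
    then show ?thesis
      using psd_form.ip_zero_left[OF psd, of 0 t] by simp
  qed
  have nonneg: "0 \<le> Re (Q s v v)"
    using psd_form.ip_ge_zero[OF psd] by simp
  have bound: "(\<Sum>t\<in>S. Re (Q t (block t (embed s v)) (block t (embed s v)))) \<le> Re (Q s v v)"
    if "finite S" for S
  proof -
    have "(\<Sum>t\<in>S. Re (Q t (block t (embed s v)) (block t (embed s v)))) =
        (\<Sum>t\<in>S. if t = s then Re (Q s v v) else 0)"
      using same other by (intro sum.cong) auto
    then show ?thesis
      using that nonneg by simp
  qed
  show mem: "embed s v \<in> L.sum_space"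
    by (rule L.sum_space_I(1)[OF V bound])
  show "Re (L.sum_ip (embed s v) (embed s v)) = Re (Q s v v)"
    using L.sum_space_I(2)[OF V bound] L.sum_le_sum_ip[OF mem, of "{s}"] same by simp
qed

lemma block_matrix_action:
  "block s (\<Sum>j<n. mult_op (G $$ (i, j)) (g j)) = fun_mat_act n (\<lambda>i k. G $$ (i, k)) (\<lambda>j. block s (g j)) i"
  by (auto simp: block_of_sum fun_mat_act_def fun_eq_iff) (simp add: block_def mult_op_def scaleC_fun_def)

lemma matrix_action_embed:
  "(\<Sum>j<n. mult_op (G $$ (i, j)) (embed s (v j))) = embed s (fun_mat_act n (\<lambda>i k. G $$ (i, k)) v i)"
proof (rule function_eq_blockI)
  fix t z
  show "block t (\<Sum>j<n. mult_op (G $$ (i, j)) (embed s (v j))) z =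
      block t (embed s (fun_mat_act n (\<lambda>i k. G $$ (i, k)) v i)) z"
    unfolding block_matrix_action block_embed fun_mat_act_def by auto
qed

text \<open>Multiplication acts in each block by the module action, with the same bound
  \<open>nrm G\<close> everywhere; summing over finite sets of blocks gives membership as well as
  the norm estimate.\<close>

lemma matrix_action_bound:
  assumes n: "n > 0" and G: "G \<in> Mat A n" and g: "\<And>j. j < n \<Longrightarrow> g j \<in> L.sum_space"
  shows "i < n \<Longrightarrow> (\<Sum>j<n. mult_op (G $$ (i, j)) (g j)) \<in> L.sum_space"
    and "(\<Sum>i<n. Re (L.sum_ip (\<Sum>j<n. mult_op (G $$ (i, j)) (g j)) (\<Sum>j<n. mult_op (G $$ (i, j)) (g j)))) \<le>
      (nrm G)\<^sup>2 * (\<Sum>j<n. Re (L.sum_ip (g j) (g j)))"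
proof -
  define u where "u i = (\<Sum>j<n. mult_op (G $$ (i, j)) (g j))" for i
  define q where "q s h = Re (Q s (block s h) (block s h))" for s h
  have q_nonneg: "0 \<le> q s h" for s h
    using psd_form.ip_ge_zero[OF psd] by (simp add: q_def)
  define B where "B = (nrm G)\<^sup>2 * (\<Sum>j<n. Re (L.sum_ip (g j) (g j)))"
  have local_bound: "(\<Sum>i<n. q s (u i)) \<le> (nrm G)\<^sup>2 * (\<Sum>j<n. q s (g j))" for s
    unfolding q_def u_def block_matrix_action by (rule Q_contractive[OF n G])
  have total: "(\<Sum>s\<in>S. \<Sum>i<n. q s (u i)) \<le> B" if S: "finite S" for S
  proof -
    have "(\<Sum>s\<in>S. \<Sum>i<n. q s (u i)) \<le> (\<Sum>s\<in>S. (nrm G)\<^sup>2 * (\<Sum>j<n. q s (g j)))"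
      by (intro sum_mono local_bound)
    also have "\<dots> = (nrm G)\<^sup>2 * (\<Sum>j<n. \<Sum>s\<in>S. q s (g j))"
      unfolding sum_distrib_left[symmetric] by (subst sum.swap) simp
    also have "\<dots> \<le> B"
      unfolding B_def using L.sum_le_sum_ip[OF g S] by (intro mult_left_mono sum_mono) (auto simp: q_def)
    finally show ?thesis .
  qed
  have u_mem: "u i \<in> L.sum_space" if i: "i < n" for i
  proof (rule L.sum_space_I(1))
    have "block s (u i) z = 0" if "z \<notin> Zs s" for s z
      unfolding u_def block_matrix_action fun_mat_act_def
      using supportedD[OF L.sum_space_subset[OF g] that] by simp
    then show "u i \<in> supported"
      by (simp add: supported_def)
    fix S :: "'x block_index set" assume S: "finite S"
    have "(\<Sum>s\<in>S. q s (u i)) \<le> (\<Sum>s\<in>S. \<Sum>i<n. q s (u i))"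
      using i q_nonneg by (intro sum_mono member_le_sum) auto
    also have "\<dots> \<le> B"
      by (rule total[OF S])
    finally show "(\<Sum>s\<in>S. Re (Q s (block s (u i)) (block s (u i)))) \<le> B"
      by (simp add: q_def)
  qed
  then show "i < n \<Longrightarrow> (\<Sum>j<n. mult_op (G $$ (i, j)) (g j)) \<in> L.sum_space"
    by (simp add: u_def)
  have summable: "(\<lambda>s. q s (u i)) summable_on UNIV" if "i < n" for i
    using u_mem[OF that] by (simp add: L.sum_space_def q_def)
  have "(\<Sum>i<n. Re (L.sum_ip (u i) (u i))) = (\<Sum>i<n. infsum (\<lambda>s. q s (u i)) UNIV)"
    using u_mem by (intro sum.cong) (auto simp: L.Re_sum_ip_self q_def)
  also have "\<dots> = infsum (\<lambda>s. \<Sum>i<n. q s (u i)) UNIV"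
    using summable by (intro infsum_finite_sum(2)[symmetric]) auto
  also have "\<dots> \<le> B"
    using summable total by (intro infsum_le_finite_sums infsum_finite_sum(1)) auto
  finally show "(\<Sum>i<n. Re (L.sum_ip (\<Sum>j<n. mult_op (G $$ (i, j)) (g j)) (\<Sum>j<n. mult_op (G $$ (i, j)) (g j)))) \<le>
      (nrm G)\<^sup>2 * (\<Sum>j<n. Re (L.sum_ip (g j) (g j)))"
    by (simp add: u_def B_def)
qed

lemma mem_multipliers:
  assumes f: "f \<in> A"
  shows "f \<in> multipliers L.sum_space L.sum_ip"
proof -
  have G: "singleton_mat f \<in> Mat A 1"
    using f by (simp add: singleton_mem_iff)
  have sum1: "(\<Sum>j<1. mult_op (singleton_mat f $$ (i, j)) (g j)) = mult_op f (g 0)"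
    if "i < 1" for i :: nat and g :: "nat \<Rightarrow> 'x \<Rightarrow> 'x kernel_index \<Rightarrow> complex"
    using that by (simp add: singleton_mat_def)
  have mem: "mult_op f g \<in> L.sum_space" if "g \<in> L.sum_space" for g
    using matrix_action_bound(1)[OF _ G, of "\<lambda>_. g" 0] that sum1[of 0 "\<lambda>_. g"] by simp
  have "ip_norm L.sum_ip (mult_op f g) \<le> nrm (singleton_mat f) * ip_norm L.sum_ip g"
    if g: "g \<in> L.sum_space" for g
  proof (rule power2_le_imp_le)
    have "Re (L.sum_ip (mult_op f g) (mult_op f g)) \<le> (nrm (singleton_mat f))\<^sup>2 * Re (L.sum_ip g g)"
      using matrix_action_bound(2)[OF _ G, of "\<lambda>_. g"] g sum1[of 0 "\<lambda>_. g"] by simp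
    then show "(ip_norm L.sum_ip (mult_op f g))\<^sup>2 \<le> (nrm (singleton_mat f) * ip_norm L.sum_ip g)\<^sup>2"
      using g mem by (simp add: L.ip_norm_sq power_mult_distrib)
    show "0 \<le> nrm (singleton_mat f) * ip_norm L.sum_ip g"
      using nrm_nonneg[OF _ G] L.ip_norm_nonneg[OF g] by simp
  qed
  moreover have "mult_op f (g + h) = mult_op f g + mult_op f h"
    and "mult_op f (c *\<^sub>C g) = c *\<^sub>C mult_op f g" for g h :: "'x \<Rightarrow> 'x kernel_index \<Rightarrow> complex" and c
    by (auto simp: mult_op_def fun_eq_iff scaleC_fun_def algebra_simps)
  ultimately show ?thesis
    using mem unfolding multipliers_def bounded_ops_def by blast
qed

text \<open>Complete contractivity of every block bounds the multiplier norm from above. From below,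
  the normalized unit rows of a block that norms G over a suitable finite F are test vectors, and by
  locality such F come arbitrarily close to \<open>nrm G\<close>.\<close>

lemma multiplier_norm_eq:
  assumes "local_algebra A nrm" and n: "n > 0" and G: "G \<in> Mat A n"
  shows "nrm G = multiplier_norm L.sum_space L.sum_ip G"
proof -
  have d: "dim_row G = n" "dim_col G = n"
    using G by (auto simp: Mat_iff)
  define u where "u g i = (\<Sum>j<n. mult_op (G $$ (i, j)) (g j))"
    for g :: "nat \<Rightarrow> 'x \<Rightarrow> 'x kernel_index \<Rightarrow> complex" and i
  define N where "N g = L2_set (\<lambda>j. ip_norm L.sum_ip (g j)) {..<n}"
    for g :: "nat \<Rightarrow> 'x \<Rightarrow> 'x kernel_index \<Rightarrow> complex"
  have N_sq: "(N g)\<^sup>2 = (\<Sum>j<n. Re (L.sum_ip (g j) (g j)))" if "\<And>j. j < n \<Longrightarrow> g j \<in> L.sum_space" for g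
  proof -
    have "(N g)\<^sup>2 = (\<Sum>j<n. (ip_norm L.sum_ip (g j))\<^sup>2)"
      by (simp add: N_def L2_set_def sum_nonneg)
    also have "\<dots> = (\<Sum>j<n. Re (L.sum_ip (g j) (g j)))"
      using that by (intro sum.cong) (auto simp: L.ip_norm_sq)
    finally show ?thesis .
  qed
  have N_nonneg: "0 \<le> N g" for g
    by (simp add: N_def)
  define X where "X = {N (u g) | g. (\<forall>j<n. g j \<in> L.sum_space) \<and> N g \<le> 1}"
  have norm_X: "multiplier_norm L.sum_space L.sum_ip G = Sup X"
    unfolding multiplier_norm_def X_def N_def u_def d ..
  have u_mem: "u g i \<in> L.sum_space" if "\<forall>j<n. g j \<in> L.sum_space" "i < n" for g i
    unfolding u_def using matrix_action_bound(1)[OF n G] that by blast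
  have upper: "x \<le> nrm G" if x: "x \<in> X" for x
  proof -
    obtain g where g: "x = N (u g)" "\<forall>j<n. g j \<in> L.sum_space" "N g \<le> 1"
      using x unfolding X_def by blast
    have "(N (u g))\<^sup>2 \<le> (nrm G)\<^sup>2 * (N g)\<^sup>2"
      using matrix_action_bound(2)[OF n G, of g] g u_mem by (simp add: N_sq u_def)
    also have "\<dots> \<le> (nrm G)\<^sup>2"
      using g N_nonneg[of g] by (simp add: mult_left_le power_le_one)
    finally show ?thesis
      using power2_le_imp_le nrm_nonneg[OF n G] g by blast
  qed
  have ne: "X \<noteq> {}"
  proof -
    have "N (u (\<lambda>_. 0)) \<in> X"
      unfolding X_def by (intro CollectI exI[of _ "\<lambda>_. 0"] conjI refl)
        (simp_all add: L.zero_mem N_def L.ip_norm_zero L2_set_def)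
    then show ?thesis by blast
  qed
  have bdd: "bdd_above X"
    using upper by (auto simp: bdd_above_def)
  have lower: "r \<le> Sup X" if r: "0 \<le> r" "r < nrm G" for r
  proof -
    have "nrm G = (SUP F\<in>{F. finite F}. quotient_norm A nrm F G)"
      using assms by (simp add: local_algebra_def)
    moreover have "bdd_above ((\<lambda>F. quotient_norm A nrm F G) ` {F. finite F})"
      using quotient_norm_le_nrm[OF n G] by (auto simp: bdd_above_def)
    ultimately obtain F where F: "finite F" "r < quotient_norm A nrm F G"
      using r less_cSUP_iff[of "{F. finite F}" "\<lambda>F. quotient_norm A nrm F G" r] by auto
    then have F_ne: "F \<noteq> {}"
      using quotient_norm_empty[OF n G] r by auto
    obtain s where s: "Zs s = {..<n} \<times> F"
      "r\<^sup>2 * (\<Sum>j<n. Re (Q s (unit_row j) (unit_row j))) \<le>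
        (\<Sum>i<n. Re (Q s (fun_mat_act n (\<lambda>i k. G $$ (i, k)) unit_row i)
          (fun_mat_act n (\<lambda>i k. G $$ (i, k)) unit_row i)))"
      using norming[OF n G F(1) r(1) F(2)] by blast
    define e where "e j = embed s (unit_row j)" for j
    have e: "\<And>j. e j \<in> L.sum_space" "\<And>j. Re (L.sum_ip (e j) (e j)) = Re (Q s (unit_row j) (unit_row j))"
      unfolding e_def by (rule embed_norm)+
    have ue: "u e i = embed s (fun_mat_act n (\<lambda>i k. G $$ (i, k)) unit_row i)" for i
      unfolding u_def e_def by (rule matrix_action_embed)
    have sq: "r\<^sup>2 * (N e)\<^sup>2 \<le> (N (u e))\<^sup>2"
      using s(2) u_mem[of e] by (simp add: N_sq e ue embed_norm)
    \<comment> \<open>Domination of the standard form and a point of F prevent the test vectors from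
      being null.\<close>
    have "N e > 0"
    proof -
      obtain x where x: "x \<in> F"
        using F_ne by blast
      have "1 = (cmod (unit_row 0 (0, x)))\<^sup>2"
        by (simp add: unit_row_def)
      also have "\<dots> \<le> (\<Sum>z\<in>Zs s. (cmod (unit_row 0 z))\<^sup>2)"
        using x n finite_Zs[of s] by (intro member_le_sum) (auto simp: s(1))
      also have "\<dots> \<le> Re (Q s (unit_row 0) (unit_row 0))"
        by (rule Q_dominates)
      also have "\<dots> = Re (L.sum_ip (e 0) (e 0))"
        by (simp add: e)
      also have "\<dots> \<le> (\<Sum>j<n. Re (L.sum_ip (e j) (e j)))"
        using n by (intro member_le_sum[of 0 _ "\<lambda>j. Re (L.sum_ip (e j) (e j))"]) (auto intro: L.ip_ge_zero e(1))
      also have "\<dots> = (N e)\<^sup>2"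
        by (simp add: N_sq e)
      finally show ?thesis
        using N_nonneg[of e] by (cases "N e = 0") auto
    qed
    define c where "c = complex_of_real (1 / N e)"
    have c: "cmod c = 1 / N e"
      using \<open>N e > 0\<close> by (simp add: c_def norm_divide)
    have N_scale: "N (\<lambda>j. c *\<^sub>C h j) = cmod c * N h" if "\<And>j. j < n \<Longrightarrow> h j \<in> L.sum_space" for h
    proof -
      have "N (\<lambda>j. c *\<^sub>C h j) = L2_set (\<lambda>j. cmod c * ip_norm L.sum_ip (h j)) {..<n}"
        unfolding N_def using that by (intro L2_set_cong) (auto simp: L.ip_norm_scaleC)
      then show ?thesis
        by (simp add: N_def L2_set_right_distrib)
    qed
    have u_scale: "u (\<lambda>j. c *\<^sub>C e j) = (\<lambda>i. c *\<^sub>C u e i)"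
      unfolding u_def scaleC_sum_right
      by (intro ext sum.cong) (auto simp: mult_op_def fun_eq_iff scaleC_fun_def algebra_simps)
    have "(r * N e)\<^sup>2 \<le> (N (u e))\<^sup>2"
      using sq by (simp add: power_mult_distrib)
    then have "r * N e \<le> N (u e)"
      by (rule power2_le_imp_le) (rule N_nonneg)
    then have "r \<le> N (u (\<lambda>j. c *\<^sub>C e j))"
      unfolding u_scale using \<open>N e > 0\<close> u_mem[of e] e by (simp add: N_scale c field_simps)
    moreover have "N (u (\<lambda>j. c *\<^sub>C e j)) \<in> X"
      unfolding X_def
    proof (intro CollectI exI[of _ "\<lambda>j. c *\<^sub>C e j"] conjI refl)
      show "N (\<lambda>j. c *\<^sub>C e j) \<le> 1"
        using \<open>N e > 0\<close> by (simp add: N_scale e c)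
    qed (simp add: e L.scaleC_mem)
    ultimately show ?thesis
      using cSup_upper[OF _ bdd] order_trans by blast
  qed
  have "nrm G \<le> Sup X"
  proof (rule ccontr)
    assume less: "\<not> nrm G \<le> Sup X"
    \<comment> \<open>A member of X shows that Sup X is nonnegative, as the use of
      \<open>lower\<close> requires.\<close>
    obtain x where x: "x \<in> X"
      using ne by blast
    then have "0 \<le> x"
      using N_nonneg unfolding X_def by blast
    also have "x \<le> Sup X"
      by (rule cSup_upper[OF x bdd])
    finally show False
      using lower[of "(Sup X + nrm G) / 2"] less by simp
  qed
  then show ?thesis
    unfolding norm_X using cSup_least[OF ne upper] by (simp add: order_antisym)
qed

text \<open>Let h in A interpolate a multiplier f on F. On a block carried by F, multiplication by f
  is multiplication by h, so the bound M of f bounds the quotient norm of h. Hence f agrees on each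
  finite F with an element of A of norm at most M + 1, and BPW completeness applies along the finite
  sets.\<close>

lemma multipliers_subset:
  assumes bpw: "BPW_complete A nrm"
  shows "multipliers L.sum_space L.sum_ip \<subseteq> A"
proof
  fix f assume "f \<in> multipliers L.sum_space L.sum_ip"
  then obtain M0 where M0: "\<And>g. g \<in> L.sum_space \<Longrightarrow> mult_op f g \<in> L.sum_space"
    "\<And>g. g \<in> L.sum_space \<Longrightarrow> ip_norm L.sum_ip (mult_op f g) \<le> M0 * ip_norm L.sum_ip g"
    unfolding multipliers_def bounded_ops_def by blast
  define M where "M = max M0 0"
  have M: "M \<ge> 0" "\<And>g. g \<in> L.sum_space \<Longrightarrow> ip_norm L.sum_ip (mult_op f g) \<le> M * ip_norm L.sum_ip g"
  proof -
    fix g assume g: "g \<in> L.sum_space"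
    have "M0 * ip_norm L.sum_ip g \<le> M * ip_norm L.sum_ip g"
      using L.ip_norm_nonneg[OF g] by (intro mult_right_mono) (auto simp: M_def)
    then show "ip_norm L.sum_ip (mult_op f g) \<le> M * ip_norm L.sum_ip g"
      using M0(2)[OF g] by simp
  qed (simp add: M_def)
  \<comment> \<open>The quotient norm is an infimum that need not be attained; the 1 is slack that
    does not depend on F.\<close>
  have "\<exists>g\<in>A. nrm (singleton_mat g) \<le> M + 1 \<and> (\<forall>x\<in>F. g x = f x)" if F: "finite F" "F \<noteq> {}" for F
  proof -
    obtain h where h: "h \<in> A" "\<And>x. x \<in> F \<Longrightarrow> h x = f x"
      using interpolation[OF F(1)] by blast
    define G where "G = singleton_mat h"
    have G: "G \<in> Mat A 1"
      using h by (simp add: G_def singleton_mem_iff)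
    have "quotient_norm A nrm F G \<le> M"
    proof (rule ccontr)
      assume "\<not> quotient_norm A nrm F G \<le> M"
      define r where "r = (M + quotient_norm A nrm F G) / 2"
      have r: "M < r" "0 \<le> r" "r < quotient_norm A nrm F G"
        using \<open>\<not> quotient_norm A nrm F G \<le> M\<close> M(1) by (auto simp: r_def)
      obtain s where s: "Zs s = {..<1} \<times> F"
        "r\<^sup>2 * (\<Sum>j<1. Re (Q s (unit_row j) (unit_row j))) \<le>
          (\<Sum>i<1. Re (Q s (fun_mat_act 1 (\<lambda>i k. G $$ (i, k)) unit_row i)
            (fun_mat_act 1 (\<lambda>i k. G $$ (i, k)) unit_row i)))"
        using norming[OF _ G F(1) r(2,3)] by auto
      define e where "e = embed s (unit_row 0)"
      have e: "e \<in> L.sum_space" "Re (L.sum_ip e e) = Re (Q s (unit_row 0) (unit_row 0))"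
        unfolding e_def by (rule embed_norm)+
      \<comment> \<open>f and h agree on F, and e vanishes off F.\<close>
      have fe: "mult_op f e = embed s (fun_mat_act 1 (\<lambda>i k. G $$ (i, k)) unit_row 0)"
      proof (rule function_eq_blockI)
        fix t z
        show "block t (mult_op f e) z = block t (embed s (fun_mat_act 1 (\<lambda>i k. G $$ (i, k)) unit_row 0)) z"
        proof -
          have "block t (mult_op f e) z = f (snd z) * block t e z"
            by (cases z) (simp add: block_def mult_op_def scaleC_fun_def)
          then show ?thesis
            using h(2) by (cases z) (auto simp: e_def block_embed fun_mat_act_def G_def singleton_mat_def s(1))
        qed
      qed
      have pos: "Re (L.sum_ip e e) > 0"
      proof -
        obtain x where x: "x \<in> F"
          using F by blast
        have "1 = (cmod (unit_row 0 (0, x)))\<^sup>2"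
          by (simp add: unit_row_def)
        also have "\<dots> \<le> (\<Sum>z\<in>Zs s. (cmod (unit_row 0 z))\<^sup>2)"
          using x finite_Zs[of s] by (intro member_le_sum) (auto simp: s(1))
        also have "\<dots> \<le> Re (Q s (unit_row 0) (unit_row 0))"
          by (rule Q_dominates)
        finally show ?thesis
          by (simp add: e)
      qed
      have "r\<^sup>2 * Re (L.sum_ip e e) \<le> Re (L.sum_ip (mult_op f e) (mult_op f e))"
        using s(2) by (simp add: e fe embed_norm)
      also have "\<dots> = (ip_norm L.sum_ip (mult_op f e))\<^sup>2"
        by (simp add: L.ip_norm_sq M0 e)
      also have "\<dots> \<le> (M * ip_norm L.sum_ip e)\<^sup>2"
        by (intro power_mono M L.ip_norm_nonneg M0 e)
      also have "\<dots> = M\<^sup>2 * Re (L.sum_ip e e)"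
        by (simp add: power_mult_distrib L.ip_norm_sq e)
      finally have "r\<^sup>2 \<le> M\<^sup>2"
        using pos by simp
      moreover have "M\<^sup>2 < r\<^sup>2"
        using r M by (intro power_strict_mono) auto
      ultimately show False by simp
    qed
    then obtain H where H: "H \<in> Mat (vanishing_ideal A F) 1" "nrm (G + H) < M + 1"
      using quotient_norm_lessD[OF _ G, of F "M + 1"] by auto
    define g where "g = h + H $$ (0, 0)"
    have Hm: "H $$ (0, 0) \<in> A" "\<And>x. x \<in> F \<Longrightarrow> (H $$ (0, 0)) x = 0" "H \<in> carrier_mat 1 1"
      using H(1) by (auto simp: Mat_iff vanishing_ideal_def)
    have "G + H = singleton_mat g"
      using Hm(3) by (intro eq_matI) (auto simp: G_def g_def singleton_mat_def)
    then show ?thesis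
      using H(2) Hm h by (intro bexI[of _ g]) (auto simp: g_def intro: add_mem)
  qed
  then obtain g where g: "\<And>F. finite F \<Longrightarrow> F \<noteq> {} \<Longrightarrow> g F \<in> A"
    "\<And>F. finite F \<Longrightarrow> F \<noteq> {} \<Longrightarrow> nrm (singleton_mat (g F)) \<le> M + 1"
    "\<And>F x. finite F \<Longrightarrow> F \<noteq> {} \<Longrightarrow> x \<in> F \<Longrightarrow> g F x = f x"
    by metis
  have ev: "\<forall>\<^sub>F F in finite_subsets_at_top UNIV. finite F \<and> x \<in> F" for x :: 'x
    by (subst eventually_finite_subsets_at_top) (auto intro!: exI[of _ "{x}"])
  show "f \<in> A"
  proof (rule bpw[unfolded BPW_complete_def, rule_format])
    show "filtermap g (finite_subsets_at_top UNIV) \<noteq> bot"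
      by (simp add: filtermap_bot_iff)
    show "\<forall>\<^sub>F h in filtermap g (finite_subsets_at_top UNIV). h \<in> A \<and> nrm (singleton_mat h) \<le> M + 1"
      \<comment> \<open>Any point will do: finite sets that contain it are nonempty, and g was
        chosen for nonempty sets only.\<close>
      unfolding eventually_filtermap using ev[of undefined] by eventually_elim (use g in auto)
    show "((\<lambda>g. g x) \<longlongrightarrow> f x) (filtermap g (finite_subsets_at_top UNIV))" for x
      unfolding filterlim_filtermap
      by (rule tendsto_eventually, use ev[of x] in eventually_elim) (use g in auto)
  qed
qed

lemma kernel_represents:
  assumes "local_algebra A nrm" and "BPW_complete A nrm"
  shows "represented_by_kernel A nrm C.sum_space C.sum_ip K L.sum_space L.sum_ip"
  unfolding represented_by_kernel_def
proof (intro conjI allI impI ballI)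
  show "A = multipliers L.sum_space L.sum_ip"
    using mem_multipliers multipliers_subset[OF assms(2)] by blast
qed (simp_all add: C.hilbert_sum_space kernel_positive_definite kernel_rkhs multiplier_norm_eq[OF assms(1)])

end

section \<open>Existence of the norming family and of the kernel\<close>

context function_operator_algebra
begin

text \<open>
  The block index \<open>(k, d)\<close> encodes the size \<open>n\<close> and the accuracy \<open>1 / (m + 1)\<close> in \<open>k\<close>, and the
  \<open>n \<times> n\<close> matrix to be normed together with the finite set in \<open>d\<close>, the latter as an indicator function
  in the position \<open>(n, n)\<close>.
\<close>

lemma norming_family_exists: "\<exists>Zs Q. norming_family A nrm Zs Q"
proof -
  define size where "size s = fst (prod_decode (fst s))" for s :: "'x block_index"
  define acc where "acc s = snd (prod_decode (fst s))" for s :: "'x block_index"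
  define mx where "mx s = mat (size s) (size s) (\<lambda>(i, j). snd s i j)" for s :: "'x block_index"
  define pts where "pts s = {x. snd s (size s) (size s) x \<noteq> 0}" for s :: "'x block_index"
  \<comment> \<open>A number strictly below the quotient norm, so that a form attaining it exists;
    larger m bring it closer.\<close>
  define rad where "rad s = quotient_norm A nrm (pts s) (mx s) - 1 / real (Suc (acc s))" for s
  \<comment> \<open>Codes that name no matrix over A, an infinite set of points or a negative radius
    receive an empty block.\<close>
  define valid where "valid s \<longleftrightarrow> size s > 0 \<and> mx s \<in> Mat A (size s) \<and> finite (pts s) \<and> rad s \<ge> 0" for s
  define Zs where "Zs s = (if valid s then {..<size s} \<times> pts s else {})" for s
  define good where "good s q \<longleftrightarrow> rep_form A nrm (Zs s) q \<and> (valid s \<longrightarrow>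
    (rad s)\<^sup>2 * (\<Sum>j<size s. Re (q (unit_row j) (unit_row j))) \<le>
    (\<Sum>i<size s. Re (q (fun_mat_act (size s) (\<lambda>i k. mx s $$ (i, k)) unit_row i)
      (fun_mat_act (size s) (\<lambda>i k. mx s $$ (i, k)) unit_row i))))" for s q
  have "\<exists>q. good s q" for s
  proof (cases "valid s")
    case True
    then show ?thesis
      using rep_form_exists[of "size s" "mx s" "pts s" "rad s"]
      by (auto simp: good_def Zs_def valid_def rad_def)
  next
    case False
    then show ?thesis
      using rep_form_standard[of "{}"] by (auto simp: good_def Zs_def)
  qed
  then obtain Q where Q: "\<And>s. good s (Q s)"
    by metis
  have "norming_family A nrm Zs Q"
  proof (intro norming_family.intro function_operator_algebra_axioms norming_family_axioms.intro)
    show "finite (Zs s)" for s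
      by (auto simp: Zs_def valid_def)
    show "rep_form A nrm (Zs s) (Q s)" for s
      using Q[of s] by (simp add: good_def)
    fix n G F r assume n: "n > 0" and G: "G \<in> Mat A n" and F: "finite F" and r: "0 \<le> r"
      and less: "r < quotient_norm A nrm F G"
    \<comment> \<open>The accuracy m must fit into the gap above r, so that the radius of the code
      is at least r.\<close>
    obtain m where m: "inverse (real (Suc m)) < quotient_norm A nrm F G - r"
      using reals_Archimedean[of "quotient_norm A nrm F G - r"] less by auto
    define s :: "'x block_index" where
      "s = (prod_encode (n, m), \<lambda>i j. if i < n \<and> j < n then G $$ (i, j) else (\<lambda>x. if x \<in> F then 1 else 0))"
    have size: "size s = n" and acc: "acc s = m"
      by (simp_all add: size_def acc_def s_def)
    have mx: "mx s = G"
    proof -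
      have "mx s = mat n n (\<lambda>(i, j). snd s i j)"
        by (simp only: mx_def size)
      then show ?thesis
        using G by (intro eq_matI) (auto simp: s_def Mat_iff)
    qed
    have pts: "pts s = F"
      by (auto simp: pts_def size) (simp_all add: s_def split: if_splits)
    have rad: "r \<le> rad s"
      using m by (simp add: rad_def pts mx acc inverse_eq_divide)
    then have valid: "valid s"
      using n G F r by (simp add: valid_def size mx pts)
    then have "(rad s)\<^sup>2 * (\<Sum>j<n. Re (Q s (unit_row j) (unit_row j))) \<le>
        (\<Sum>i<n. Re (Q s (fun_mat_act n (\<lambda>i k. G $$ (i, k)) unit_row i)
          (fun_mat_act n (\<lambda>i k. G $$ (i, k)) unit_row i)))"
      using Q[of s] by (simp add: good_def size mx)
    moreover have "r\<^sup>2 * (\<Sum>j<n. Re (Q s (unit_row j) (unit_row j))) \<le>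
        (rad s)\<^sup>2 * (\<Sum>j<n. Re (Q s (unit_row j) (unit_row j)))"
    proof (intro mult_right_mono power_mono rad r sum_nonneg)
      have "psd_form UNIV (Q s)"
        using Q[of s] by (simp add: good_def rep_form_def)
      then show "0 \<le> Re (Q s (unit_row j) (unit_row j))" for j
        by (rule psd_form.ip_ge_zero) simp
    qed
    ultimately show "\<exists>s. Zs s = {..<n} \<times> F \<and> r\<^sup>2 * (\<Sum>j<n. Re (Q s (unit_row j) (unit_row j))) \<le>
        (\<Sum>i<n. Re (Q s (fun_mat_act n (\<lambda>i k. G $$ (i, k)) unit_row i)
          (fun_mat_act n (\<lambda>i k. G $$ (i, k)) unit_row i)))"
      using valid by (intro exI[of _ s]) (simp add: Zs_def size pts)
  qed
  then show ?thesis by blast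
qed

theorem kernel_representation_exists:
  assumes "local_algebra A nrm" and "BPW_complete A nrm"
  shows "\<exists>(C :: ('x kernel_index \<Rightarrow> complex) set) ipC K L ipL. represented_by_kernel A nrm C ipC K L ipL"
  using norming_family_exists norming_family.kernel_represents[OF _ assms] by blast

end

section \<open>Finite-dimensional representations\<close>

lemma sum_div_mod:
  fixes f :: "nat \<Rightarrow> nat \<Rightarrow> 'a::comm_monoid_add"
  assumes k: "k > 0"
  shows "(\<Sum>I<m * k. f (I div k) (I mod k)) = (\<Sum>i<m. \<Sum>a<k. f i a)"
proof -
  have "(\<Sum>i<m. \<Sum>a<k. f i a) = (\<Sum>(i, a)\<in>{..<m} \<times> {..<k}. f i a)"
    by (rule sum.cartesian_product)
  also have "\<dots> = (\<Sum>I<m * k. f (I div k) (I mod k))"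
  proof (rule sum.reindex_bij_witness[of _ "\<lambda>I. (I div k, I mod k)" "\<lambda>(i, a). i * k + a"])
    fix x assume x: "x \<in> {..<m} \<times> {..<k}"
    then obtain i a where ia: "x = (i, a)" "i < m" "a < k"
      by auto
    have "i * k + a < Suc i * k"
      using ia by simp
    also have "\<dots> \<le> m * k"
      using ia by (intro mult_right_mono) auto
    finally show "(case x of (i, a) \<Rightarrow> i * k + a) \<in> {..<m * k}"
      using ia by simp
    show "((case x of (i, a) \<Rightarrow> i * k + a) div k, (case x of (i, a) \<Rightarrow> i * k + a) mod k) = x"
      using ia by simp
    show "f ((case x of (i, a) \<Rightarrow> i * k + a) div k) ((case x of (i, a) \<Rightarrow> i * k + a) mod k) =
        (case x of (i, a) \<Rightarrow> f i a)"
      using ia by simp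
  next
    fix I assume "I \<in> {..<m * k}"
    then show "(I div k, I mod k) \<in> {..<m} \<times> {..<k}"
      using k by (simp add: less_mult_imp_div_less)
  qed auto
  finally show ?thesis ..
qed

lemma op_norm_bound:
  assumes t: "0 \<le> t" "\<And>v. v \<in> carrier_vec (dim_col L) \<Longrightarrow> vec_norm2 (L *\<^sub>v v) \<le> t * vec_norm2 v"
    and v: "v \<in> carrier_vec (dim_col L)"
  shows "vec_norm2 (L *\<^sub>v v) \<le> op_norm L * vec_norm2 v"
proof (cases "vec_norm2 v = 0")
  case True
  then show ?thesis
    using t(2)[OF v] by simp
next
  case False
  then have pos: "vec_norm2 v > 0"
    using vec_norm2_nonneg[of v] by simp
  define c where "c = complex_of_real (1 / vec_norm2 v)"
  have c: "cmod c = 1 / vec_norm2 v"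
    using pos by (simp add: c_def norm_divide)
  have scale: "vec_norm2 (c \<cdot>\<^sub>v w) = cmod c * vec_norm2 w" for w
  proof -
    have "vec_norm2 (c \<cdot>\<^sub>v w) = L2_set (\<lambda>i. cmod c * cmod (vec_index w i)) {..<dim_vec w}"
      unfolding vec_norm2_def by (intro L2_set_cong) (auto simp: norm_mult)
    then show ?thesis
      by (simp add: vec_norm2_def L2_set_right_distrib)
  qed
  have "vec_norm2 (L *\<^sub>v (c \<cdot>\<^sub>v v)) \<le> op_norm L"
    using v pos by (intro op_norm_ge[OF t]) (auto simp: scale c)
  moreover have "L *\<^sub>v (c \<cdot>\<^sub>v v) = c \<cdot>\<^sub>v (L *\<^sub>v v)"
    by (rule mult_mat_vec[OF _ v]) auto
  ultimately show ?thesis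
    using pos by (simp add: scale c field_simps)
qed

context function_operator_algebra
begin

text \<open>\<pi> f is the matrix of multiplication by f in an orthonormal basis of the module of Q.
  Functions on Z are determined by their coordinates, so vectors over M_k are columns of module
  elements; the contractivity of Q and the lower bound at the unit rows translate directly.\<close>

lemma rep_form_representation:
  assumes Q: "rep_form A nrm ({..<n} \<times> F) Q" and n: "n > 0" and F: "finite F" "F \<noteq> {}"
  shows "\<exists>k \<pi>. k > 0 \<and> algebra_hom A k \<pi> \<and>
    (\<forall>a<k. \<forall>b<k. \<exists>c. \<forall>f. \<pi> f $$ (a, b) = (\<Sum>z\<in>{..<n} \<times> F. c z * f (snd z))) \<and>
    (\<forall>m>0. \<forall>G\<in>Mat A m. \<forall>v\<in>carrier_vec (m * k).
      vec_norm2 (amplification k \<pi> G *\<^sub>v v) \<le> nrm G * vec_norm2 v) \<and>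
    (\<forall>G\<in>Mat A n. \<forall>r\<ge>0. r\<^sup>2 * (\<Sum>j<n. Re (Q (unit_row j) (unit_row j))) \<le>
      (\<Sum>i<n. Re (Q (fun_mat_act n (\<lambda>i k. G $$ (i, k)) unit_row i)
        (fun_mat_act n (\<lambda>i k. G $$ (i, k)) unit_row i))) \<longrightarrow> r \<le> op_norm (amplification k \<pi> G))"
proof -
  define Z where "Z = {..<n} \<times> F"
  have Z: "finite Z" "Z \<noteq> {}"
    using F n by (auto simp: Z_def)
  have psd: "psd_form UNIV Q"
    and Q_local: "\<And>v v' w. (\<And>z. z \<in> Z \<Longrightarrow> v z = v' z) \<Longrightarrow> Q v w = Q v' w"
    and Q_dominates: "\<And>v. (\<Sum>z\<in>Z. (cmod (v z))\<^sup>2) \<le> Re (Q v v)"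
    and Q_contractive: "\<And>m T b. m > 0 \<Longrightarrow> T \<in> Mat A m \<Longrightarrow>
      (\<Sum>i<m. Re (Q (fun_mat_act m (\<lambda>i k. T $$ (i, k)) b i) (fun_mat_act m (\<lambda>i k. T $$ (i, k)) b i))) \<le>
      (nrm T)\<^sup>2 * (\<Sum>k<m. Re (Q (b k) (b k)))"
    using Q unfolding rep_form_def Z_def by blast+
  interpret psd_form UNIV Q
    by (rule psd)
  have Q_local_right: "Q w v = Q w v'" if "\<And>z. z \<in> Z \<Longrightarrow> v z = v' z" for v v' w
    using Q_local[of v v' w, OF that] ip_commute[of v w] ip_commute[of v' w] by simp
  define \<delta> :: "nat \<times> 'x \<Rightarrow> nat \<times> 'x \<Rightarrow> complex" where "\<delta> z = (\<lambda>y. if y = z then 1 else 0)" for z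
  obtain k u where u: "orthonormal k u" and null: "\<And>z. z \<in> Z \<Longrightarrow>
      Re (Q (\<delta> z - (\<Sum>a<k. Q (\<delta> z) (u a) *\<^sub>C u a)) (\<delta> z - (\<Sum>a<k. Q (\<delta> z) (u a) *\<^sub>C u a))) = 0"
    using gram_schmidt[of "\<delta> ` Z"] Z by auto
  have zero_on: "v z = 0" if "Re (Q v v) = 0" "z \<in> Z" for v z
  proof -
    have "(\<Sum>z\<in>Z. (cmod (v z))\<^sup>2) = 0"
      using Q_dominates[of v] that by (simp add: sum_nonneg order_antisym)
    then show ?thesis
      using Z that by (simp add: sum_nonneg_eq_0_iff)
  qed
  have expand_\<delta>: "\<delta> z y = (\<Sum>a<k. Q (\<delta> z) (u a) * u a y)" if "z \<in> Z" "y \<in> Z" for z y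
    using zero_on[OF null[OF that(1)] that(2)] by (simp add: sum_fun_apply scaleC_fun_def)
  have coords: "v y = (\<Sum>z\<in>Z. v z *\<^sub>C \<delta> z) y" if "y \<in> Z" for v y
  proof -
    have "(\<Sum>z\<in>Z. v z *\<^sub>C \<delta> z) y = (\<Sum>z\<in>Z. if z = y then v z else 0)"
      unfolding sum_fun_apply by (intro sum.cong) (auto simp: \<delta>_def scaleC_fun_def)
    then show ?thesis
      using Z that by simp
  qed
  have Q_coords: "Q v w = (\<Sum>z\<in>Z. v z * Q (\<delta> z) w)" for v w
  proof -
    have "Q v w = Q (\<Sum>z\<in>Z. v z *\<^sub>C \<delta> z) w"
      by (rule Q_local[OF coords])
    also have "\<dots> = (\<Sum>z\<in>Z. v z * Q (\<delta> z) w)"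
      by (subst ip_sum_left) (auto simp: ip_scaleC_left)
    finally show ?thesis .
  qed
  \<comment> \<open>The expansion holds pointwise on Z and not merely up to null vectors, because
    null vectors vanish on Z.\<close>
  have expand: "v y = (\<Sum>a<k. Q v (u a) *\<^sub>C u a) y" if y: "y \<in> Z" for v y
  proof -
    have "v y = (\<Sum>z\<in>Z. v z * \<delta> z y)"
      using coords[OF y, of v] by (simp add: sum_fun_apply scaleC_fun_def)
    also have "\<dots> = (\<Sum>z\<in>Z. \<Sum>a<k. v z * (Q (\<delta> z) (u a) * u a y))"
      using y by (intro sum.cong) (auto simp: expand_\<delta> sum_distrib_left)
    also have "\<dots> = (\<Sum>a<k. \<Sum>z\<in>Z. v z * (Q (\<delta> z) (u a) * u a y))"
      by (rule sum.swap)
    also have "\<dots> = (\<Sum>a<k. Q v (u a) *\<^sub>C u a) y"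
      by (simp add: sum_fun_apply scaleC_fun_def Q_coords[of v] sum_distrib_right mult.assoc)
    finally show ?thesis .
  qed
  have parseval: "Re (Q v v) = (\<Sum>a<k. (cmod (Q v (u a)))\<^sup>2)" for v
  proof -
    define w where "w = (\<Sum>a<k. Q v (u a) *\<^sub>C u a)"
    have "Q v v = Q w v"
      unfolding w_def by (rule Q_local[OF expand])
    also have "\<dots> = Q w w"
      unfolding w_def by (rule Q_local_right[OF expand])
    finally show ?thesis
      unfolding w_def using Re_ip_orthonormal_expansion[OF u] by simp
  qed
  \<comment> \<open>With an empty basis all functions would vanish on Z, which is nonempty as n > 0
    and F is nonempty.\<close>
  have k: "k > 0"
  proof (rule ccontr)
    assume "\<not> k > 0"
    then have "\<delta> z z = 0" if "z \<in> Z" for z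
      using expand_\<delta>[OF that that] by simp
    then show False
      using Z by (auto simp: \<delta>_def)
  qed
  define act where "act f v = (\<lambda>z. f (snd z) * v z)" for f and v :: "nat \<times> 'x \<Rightarrow> complex"
  define \<pi> where "\<pi> f = mat k k (\<lambda>(a, b). Q (act f (u b)) (u a))" for f
  have \<pi>_index: "\<pi> f $$ (a, b) = Q (act f (u b)) (u a)" if "a < k" "b < k" for f a b
    using that by (simp add: \<pi>_def)
  have hom: "algebra_hom A k \<pi>"
    unfolding algebra_hom_def
  proof (intro conjI ballI allI)
    fix f g :: "'x \<Rightarrow> complex" and c :: complex
    show "\<pi> f \<in> carrier_mat k k"
      by (simp add: \<pi>_def)
    have "act (f + g) v = act f v + act g v" for v
      by (auto simp: act_def fun_eq_iff algebra_simps)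
    then show "\<pi> (f + g) = \<pi> f + \<pi> g"
      by (intro eq_matI) (auto simp: \<pi>_def ip_add_left)
    have "act ((\<lambda>_. c) * f) v = c *\<^sub>C act f v" for v
      by (auto simp: act_def fun_eq_iff scaleC_fun_def)
    then show "\<pi> ((\<lambda>_. c) * f) = c \<cdot>\<^sub>m \<pi> f"
      by (intro eq_matI) (auto simp: \<pi>_def ip_scaleC_left)
    show "\<pi> (f * g) = \<pi> f * \<pi> g"
    proof (rule eq_matI)
      fix a b assume "a < dim_row (\<pi> f * \<pi> g)" "b < dim_col (\<pi> f * \<pi> g)"
      then have ab: "a < k" "b < k"
        by (auto simp: \<pi>_def)
      \<comment> \<open>Multiplicativity: g u_b is expanded on Z before f is applied, which is
        legitimate because f multiplies pointwise.\<close>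
      have "\<pi> (f * g) $$ (a, b) = Q (\<Sum>c<k. Q (act g (u b)) (u c) *\<^sub>C act f (u c)) (u a)"
        unfolding \<pi>_index[OF ab]
      proof (rule Q_local)
        fix z assume z: "z \<in> Z"
        have "act (f * g) (u b) z = f (snd z) * act g (u b) z"
          by (simp add: act_def)
        also have "\<dots> = f (snd z) * (\<Sum>c<k. Q (act g (u b)) (u c) *\<^sub>C u c) z"
          using expand[OF z, of "act g (u b)"] by simp
        also have "\<dots> = (\<Sum>c<k. Q (act g (u b)) (u c) *\<^sub>C act f (u c)) z"
          by (simp add: sum_fun_apply scaleC_fun_def act_def sum_distrib_left algebra_simps)
        finally show "act (f * g) (u b) z = (\<Sum>c<k. Q (act g (u b)) (u c) *\<^sub>C act f (u c)) z" .
      qed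
      also have "\<dots> = (\<Sum>c<k. Q (act g (u b)) (u c) * Q (act f (u c)) (u a))"
        by (subst ip_sum_left) (auto simp: ip_scaleC_left)
      also have "\<dots> = (\<Sum>c<k. \<pi> f $$ (a, c) * \<pi> g $$ (c, b))"
        using ab by (intro sum.cong) (auto simp: \<pi>_index)
      also have "\<dots> = (\<pi> f * \<pi> g) $$ (a, b)"
        using ab by (subst index_mult_mat_sum[of _ k k _ k]) (auto simp: \<pi>_def)
      finally show "\<pi> (f * g) $$ (a, b) = (\<pi> f * \<pi> g) $$ (a, b)" .
    qed (auto simp: \<pi>_def)
  qed
  have entries: "\<exists>c. \<forall>f. \<pi> f $$ (a, b) = (\<Sum>z\<in>Z. c z * f (snd z))" if "a < k" "b < k" for a b
    unfolding \<pi>_index[OF that] Q_coords[of "act _ _"]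
    by (intro exI[of _ "\<lambda>z. u b z * Q (\<delta> z) (u a)"] allI sum.cong) (auto simp: act_def)
  \<comment> \<open>The coordinate j k + b of v is read as the coefficient of u b in the j-th of m
    module elements; this identification is isometric.\<close>
  have amp_norm: "(vec_norm2 (amplification k \<pi> G *\<^sub>v v))\<^sup>2 =
      (\<Sum>i<m. Re (Q (fun_mat_act m (\<lambda>i j. G $$ (i, j)) (\<lambda>j. \<Sum>b<k. vec_index v (j * k + b) *\<^sub>C u b) i)
        (fun_mat_act m (\<lambda>i j. G $$ (i, j)) (\<lambda>j. \<Sum>b<k. vec_index v (j * k + b) *\<^sub>C u b) i)))"
    if G: "G \<in> Mat A m" and v: "v \<in> carrier_vec (m * k)" for m G v
  proof -
    have d: "dim_row G = m" "dim_col G = m"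
      using G by (auto simp: Mat_iff)
    define w where "w j = (\<Sum>b<k. vec_index v (j * k + b) *\<^sub>C u b)" for j
    define W where "W = fun_mat_act m (\<lambda>i j. G $$ (i, j)) w"
    have dims: "dim_row (amplification k \<pi> G) = m * k" "dim_col (amplification k \<pi> G) = m * k"
      by (simp_all add: amplification_def d)
    have entry: "vec_index (amplification k \<pi> G *\<^sub>v v) I = Q (W (I div k)) (u (I mod k))"
      if I: "I < m * k" for I
    proof -
      have Im: "I mod k < k" "I div k < m"
        using I k by (auto simp: less_mult_imp_div_less)
      have "vec_index (amplification k \<pi> G *\<^sub>v v) I =
          (\<Sum>J<m * k. amplification k \<pi> G $$ (I, J) * vec_index v J)"
        using I v by (subst index_mult_mat_vec_sum) (auto simp: dims)
      also have "\<dots> = (\<Sum>J<m * k. Q (act (G $$ (I div k, J div k)) (u (J mod k))) (u (I mod k)) *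
          vec_index v (J div k * k + J mod k))"
        using I k Im by (intro sum.cong) (auto simp: amplification_def d \<pi>_index)
      also have "\<dots> = (\<Sum>j<m. \<Sum>b<k. Q (act (G $$ (I div k, j)) (u b)) (u (I mod k)) * vec_index v (j * k + b))"
        by (rule sum_div_mod[OF k])
      also have "\<dots> = Q (\<Sum>j<m. \<Sum>b<k. vec_index v (j * k + b) *\<^sub>C act (G $$ (I div k, j)) (u b)) (u (I mod k))"
        by (simp add: ip_sum_left ip_scaleC_left mult.commute)
      also have "(\<Sum>j<m. \<Sum>b<k. vec_index v (j * k + b) *\<^sub>C act (G $$ (I div k, j)) (u b)) = W (I div k)"
        by (auto simp: W_def fun_mat_act_def w_def fun_eq_iff sum_fun_apply scaleC_fun_def act_def
            sum_distrib_left algebra_simps)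
      finally show ?thesis .
    qed
    have "(vec_norm2 (amplification k \<pi> G *\<^sub>v v))\<^sup>2 =
        (\<Sum>I<m * k. (cmod (Q (W (I div k)) (u (I mod k))))\<^sup>2)"
      unfolding vec_norm2_sq using entry by (intro sum.cong) (auto simp: dims)
    also have "\<dots> = (\<Sum>i<m. \<Sum>a<k. (cmod (Q (W i) (u a)))\<^sup>2)"
      by (rule sum_div_mod[OF k])
    finally show ?thesis
      unfolding parseval[symmetric] W_def w_def .
  qed
  have vec_sq: "(vec_norm2 v)\<^sup>2 =
      (\<Sum>j<m. Re (Q (\<Sum>b<k. vec_index v (j * k + b) *\<^sub>C u b) (\<Sum>b<k. vec_index v (j * k + b) *\<^sub>C u b)))"
    if v: "v \<in> carrier_vec (m * k)" for m v
  proof -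
    have "(vec_norm2 v)\<^sup>2 = (\<Sum>J<m * k. (cmod (vec_index v (J div k * k + J mod k)))\<^sup>2)"
      unfolding vec_norm2_sq using v by simp
    also have "\<dots> = (\<Sum>j<m. \<Sum>b<k. (cmod (vec_index v (j * k + b)))\<^sup>2)"
      by (rule sum_div_mod[OF k])
    finally show ?thesis
      unfolding Re_ip_orthonormal_expansion[OF u] .
  qed
  have bound: "vec_norm2 (amplification k \<pi> G *\<^sub>v v) \<le> nrm G * vec_norm2 v"
    if m: "m > 0" and G: "G \<in> Mat A m" and v: "v \<in> carrier_vec (m * k)" for m G v
  proof (rule power2_le_imp_le)
    show "(vec_norm2 (amplification k \<pi> G *\<^sub>v v))\<^sup>2 \<le> (nrm G * vec_norm2 v)\<^sup>2"
      unfolding amp_norm[OF G v] power_mult_distrib vec_sq[OF v] by (rule Q_contractive[OF m G])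
    show "0 \<le> nrm G * vec_norm2 v"
      using nrm_nonneg[OF m G] vec_norm2_nonneg by simp
  qed
  have lower: "r \<le> op_norm (amplification k \<pi> G)"
    if G: "G \<in> Mat A n" and r: "r \<ge> 0" and le: "r\<^sup>2 * (\<Sum>j<n. Re (Q (unit_row j) (unit_row j))) \<le>
      (\<Sum>i<n. Re (Q (fun_mat_act n (\<lambda>i k. G $$ (i, k)) unit_row i)
        (fun_mat_act n (\<lambda>i k. G $$ (i, k)) unit_row i)))" for G r
  proof -
    \<comment> \<open>The coordinates of the n unit rows, strung together.\<close>
    define v where "v = vec (n * k) (\<lambda>J. Q (unit_row (J div k)) (u (J mod k)))"
    have v: "v \<in> carrier_vec (n * k)"
      by (simp add: v_def)
    define w where "w j = (\<Sum>b<k. vec_index v (j * k + b) *\<^sub>C u b)" for j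
    have w: "w j = (\<Sum>b<k. Q (unit_row j) (u b) *\<^sub>C u b)" if "j < n" for j
      unfolding w_def
    proof (intro sum.cong refl)
      fix b assume b: "b \<in> {..<k}"
      have "j * k + b < Suc j * k"
        using b by simp
      also have "\<dots> \<le> n * k"
        using that by (intro mult_right_mono) auto
      finally show "vec_index v (j * k + b) *\<^sub>C u b = Q (unit_row j) (u b) *\<^sub>C u b"
        using b by (simp add: v_def)
    qed
    have agree: "w j z = unit_row j z" if "j < n" "z \<in> Z" for j z
      unfolding w[OF that(1)] by (rule expand[OF that(2), symmetric])
    have Re_cong: "Re (Q x x) = Re (Q y y)" if "\<And>z. z \<in> Z \<Longrightarrow> x z = y z" for x y
      using Q_local[of x y x, OF that] Q_local_right[of x y y, OF that] by simp
    define W where "W = fun_mat_act n (\<lambda>i j. G $$ (i, j)) w"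
    have "(vec_norm2 v)\<^sup>2 = (\<Sum>j<n. Re (Q (unit_row j) (unit_row j)))"
      unfolding vec_sq[OF v] w_def[symmetric] using agree by (intro sum.cong Re_cong) auto
    moreover have "(vec_norm2 (amplification k \<pi> G *\<^sub>v v))\<^sup>2 =
        (\<Sum>i<n. Re (Q (fun_mat_act n (\<lambda>i k. G $$ (i, k)) unit_row i)
          (fun_mat_act n (\<lambda>i k. G $$ (i, k)) unit_row i)))"
      unfolding amp_norm[OF G v] w_def[symmetric] using agree
      by (intro sum.cong Re_cong) (auto simp: fun_mat_act_def)
    ultimately have "(r * vec_norm2 v)\<^sup>2 \<le> (vec_norm2 (amplification k \<pi> G *\<^sub>v v))\<^sup>2"
      using le by (simp add: power_mult_distrib)
    then have "r * vec_norm2 v \<le> vec_norm2 (amplification k \<pi> G *\<^sub>v v)"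
      by (rule power2_le_imp_le) (rule vec_norm2_nonneg)
    also have "\<dots> \<le> op_norm (amplification k \<pi> G) * vec_norm2 v"
    proof (rule op_norm_bound)
      have d: "dim_col (amplification k \<pi> G) = n * k"
        using G by (auto simp: amplification_def Mat_iff)
      show "0 \<le> nrm G"
        by (rule nrm_nonneg[OF n G])
      show "vec_norm2 (amplification k \<pi> G *\<^sub>v v) \<le> nrm G * vec_norm2 v"
        if "v \<in> carrier_vec (dim_col (amplification k \<pi> G))" for v
        using that bound[OF n G] unfolding d by blast
      show "v \<in> carrier_vec (dim_col (amplification k \<pi> G))"
        unfolding d by (rule v)
    qed
    finally have le: "r * vec_norm2 v \<le> op_norm (amplification k \<pi> G) * vec_norm2 v" .
    \<comment> \<open>To be cancelled from \<open>le\<close>; a point of F makes the first unit row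
      nonzero for the dominating form Q.\<close>
    have "vec_norm2 v > 0"
    proof -
      obtain x where x: "x \<in> F"
        using F by blast
      have "1 = (cmod (unit_row 0 (0, x)))\<^sup>2"
        by (simp add: unit_row_def)
      also have "\<dots> \<le> (\<Sum>z\<in>Z. (cmod (unit_row 0 z))\<^sup>2)"
        using x n Z by (intro member_le_sum) (auto simp: Z_def)
      also have "\<dots> \<le> Re (Q (unit_row 0) (unit_row 0))"
        by (rule Q_dominates)
      also have "\<dots> \<le> (\<Sum>j<n. Re (Q (unit_row j) (unit_row j)))"
        using n by (intro member_le_sum[of 0 _ "\<lambda>j. Re (Q (unit_row j) (unit_row j))"]) (auto intro: ip_ge_zero)
      also have "\<dots> = (vec_norm2 v)\<^sup>2"
        using \<open>(vec_norm2 v)\<^sup>2 = _\<close> by simp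
      finally show ?thesis
        using vec_norm2_nonneg[of v] by (cases "vec_norm2 v = 0") auto
    qed
    then show ?thesis
      using le by simp
  qed
  show ?thesis
  proof (intro exI[of _ k] exI[of _ \<pi>] conjI allI ballI impI)
    show "\<exists>c. \<forall>f. \<pi> f $$ (a, b) = (\<Sum>z\<in>{..<n} \<times> F. c z * f (snd z))" if "a < k" "b < k" for a b
      using entries[OF that] by (simp only: Z_def)
  qed (rule k hom bound lower; assumption)+
qed

end

section \<open>The weak* topology\<close>

text \<open>Any representing kernel over any coefficient type, with no reference to the kernel
  constructed above.\<close>

locale kernel_representation = function_operator_algebra A nrm
  for A :: "('x \<Rightarrow> complex) set" and nrm +
  fixes C :: "'v::complex_vector set" and ipC K L ipL
  assumes rep: "represented_by_kernel A nrm C ipC K L ipL"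
begin

sublocale C: hilbert C ipC
  using rep by (simp add: represented_by_kernel_def)

sublocale L: hilbert L ipL
  using rep by (simp add: represented_by_kernel_def rkhs_def)

lemma L_apply: "g \<in> L \<Longrightarrow> g x \<in> C"
  and kernel_mem: "v \<in> C \<Longrightarrow> (\<lambda>x. K x y v) \<in> L"
  and reproducing: "v \<in> C \<Longrightarrow> g \<in> L \<Longrightarrow> ipL g (\<lambda>x. K x y v) = ipC (g y) v"
  and A_eq: "A = multipliers L ipL"
  and nrm_eq: "n > 0 \<Longrightarrow> G \<in> Mat A n \<Longrightarrow> nrm G = multiplier_norm L ipL G"
  using rep unfolding represented_by_kernel_def rkhs_def by blast+

text \<open>Otherwise the indicator function of \<open>y\<close> would be a multiplier of norm zero.\<close>

lemma nonvanishing: "\<exists>g\<in>L. g y \<noteq> 0"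
proof (rule ccontr)
  assume "\<not> (\<exists>g\<in>L. g y \<noteq> 0)"
  then have van: "g y = 0" if "g \<in> L" for g
    using that by blast
  define f :: "'x \<Rightarrow> complex" where "f = (\<lambda>x. if x = y then 1 else 0)"
  have zero: "mult_op f g = 0" if "g \<in> L" for g
    using van[OF that] by (auto simp: mult_op_def f_def fun_eq_iff)
  have "mult_op f \<in> bounded_ops L ipL"
    unfolding bounded_ops_def
    by (auto simp: zero L.zero_mem L.add_mem L.scaleC_mem L.ip_norm_zero intro!: exI[of _ 0])
  then have f: "f \<in> A"
    unfolding A_eq multipliers_def by simp
  then have G: "singleton_mat f \<in> Mat A 1"
    by (simp add: singleton_mem_iff)
  have d: "dim_row (singleton_mat f) = 1" "dim_col (singleton_mat f) = 1"
    by (simp_all add: singleton_mat_def)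
  have "L2_set (\<lambda>i. ip_norm ipL (\<Sum>j<1. mult_op (singleton_mat f $$ (i, j)) (g j))) {..<1} = 0"
    if "\<forall>j<1. g j \<in> L" for g :: "nat \<Rightarrow> 'x \<Rightarrow> 'v"
  proof -
    have "L2_set (\<lambda>i. ip_norm ipL (\<Sum>j<1. mult_op (singleton_mat f $$ (i, j)) (g j))) {..<1} =
        L2_set (\<lambda>_. 0) {..<1::nat}"
      using that zero[of "g 0"] by (intro L2_set_cong) (auto simp: singleton_mat_def L.ip_norm_zero)
    then show ?thesis
      by (simp add: L2_set_def)
  qed
  then have "{L2_set (\<lambda>i. ip_norm ipL (\<Sum>j<1. mult_op (singleton_mat f $$ (i, j)) (g j))) {..<1} | g.
      (\<forall>j<1. g j \<in> L) \<and> L2_set (\<lambda>j. ip_norm ipL (g j)) {..<(1::nat)} \<le> 1} \<subseteq> {0}"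
    by blast
  moreover have "L2_set (\<lambda>i. ip_norm ipL (\<Sum>j<1. mult_op (singleton_mat f $$ (i, j)) ((\<lambda>_. 0) j))) {..<1} \<in>
      {L2_set (\<lambda>i. ip_norm ipL (\<Sum>j<1. mult_op (singleton_mat f $$ (i, j)) (g j))) {..<1} | g.
      (\<forall>j<1. g j \<in> L) \<and> L2_set (\<lambda>j. ip_norm ipL (g j)) {..<(1::nat)} \<le> 1}"
    by (intro CollectI exI[of _ "\<lambda>_. 0"] conjI refl) (simp_all add: L.zero_mem L.ip_norm_zero L2_set_def)
  ultimately have "multiplier_norm L ipL (singleton_mat f) = 0"
    unfolding multiplier_norm_def d by (metis (no_types, lifting) cSup_singleton subset_singletonD empty_iff)
  then have "singleton_mat f = 0\<^sub>m 1 1"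
    using nrm_eq[OF _ G] nrm_eq_0[OF _ G] by simp
  then have "singleton_mat f $$ (0, 0) = 0\<^sub>m 1 1 $$ (0, 0)"
    by (rule arg_cong)
  then have "f = 0"
    by (simp add: singleton_mat_def)
  then show False
    by (auto simp: f_def fun_eq_iff split: if_splits)
qed

text \<open>Choose g in L with v = g y nonzero and put c = \<open>ipC v v\<close>. By the
  reproducing property f y is the inner product of f g / c with the kernel function of v at y, hence
  a vector functional of the multiplication operator.\<close>

lemma evaluation_weakstar_continuous:
  "continuous_map (inherited_weakstar A L ipL) euclidean (\<lambda>f. f y)"
proof -
  obtain g where g: "g \<in> L" "g y \<noteq> 0"
    using nonvanishing by blast
  define v where "v = g y"
  have v: "v \<in> C"
    using g L_apply by (simp add: v_def)
  define c where "c = ipC v v"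
  have c: "c \<noteq> 0"
    using C.ip_definite[OF v] g by (auto simp: c_def v_def)
  \<comment> \<open>The vector functional in the form of a series whose only nonzero term has index
    0.\<close>
  define us where "us k = (if k = (0::nat) then (1 / c) *\<^sub>C g else 0)" for k
  define vs where "vs k = (if k = (0::nat) then (\<lambda>x. K x y v) else 0)" for k
  have us: "us k \<in> L" and vs: "vs k \<in> L" for k
    using g v by (auto simp: us_def vs_def L.scaleC_mem L.zero_mem kernel_mem)
  define \<phi> where "\<phi> T = (\<Sum>k. ipL (T (us k)) (vs k))" for T
  have "summable (\<lambda>k. (ip_norm ipL (us k))\<^sup>2)" "summable (\<lambda>k. (ip_norm ipL (vs k))\<^sup>2)"
    by (rule summable_finite[of "{0}"]; simp add: us_def vs_def L.ip_norm_zero)+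
  then have \<phi>: "\<phi> \<in> normal_functionals L ipL"
    unfolding normal_functionals_def \<phi>_def using us vs by blast
  have ops: "mult_op f \<in> bounded_ops L ipL" if "f \<in> A" for f
    using that unfolding A_eq multipliers_def by simp
  have \<phi>_mult: "\<phi> (mult_op f) = f y" if f: "f \<in> A" for f
  proof -
    have mem: "mult_op f u \<in> L" if "u \<in> L" for u
      using ops[OF f] that unfolding bounded_ops_def by blast
    have "\<phi> (mult_op f) = (\<Sum>k\<in>{0}. ipL (mult_op f (us k)) (vs k))"
      unfolding \<phi>_def using mem[OF us] by (intro suminf_finite) (auto simp: vs_def L.ip_zero_right)
    also have "\<dots> = ipC (mult_op f (us 0) y) v"
      using mem[OF us] v by (simp add: vs_def reproducing)
    also have "mult_op f (us 0) y = (f y * (1 / c)) *\<^sub>C v"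
      by (simp add: mult_op_def us_def scaleC_apply scaleC_scaleC v_def)
    also have "ipC \<dots> v = f y"
      using c v by (simp add: C.ip_scaleC_left c_def[symmetric])
    finally show ?thesis .
  qed
  have open_sets: "openin (weakstar_topology L ipL) {T \<in> bounded_ops L ipL. \<phi> T \<in> U}" if "open U" for U
    unfolding weakstar_topology_def using \<phi> that by (intro topology_generated_by_Basis) blast
  show ?thesis
    unfolding continuous_map
  proof (intro conjI allI impI)
    fix U :: "complex set" assume U: "openin euclidean U"
    then have U: "open U"
      by simp
    have preimage: "{f \<in> topspace (inherited_weakstar A L ipL). f y \<in> U} =
        mult_op -` {T \<in> bounded_ops L ipL. \<phi> T \<in> U} \<inter> A"
    proof (intro equalityI subsetI)
      fix f assume "f \<in> {f \<in> topspace (inherited_weakstar A L ipL). f y \<in> U}"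
      then have "f \<in> A" "f y \<in> U"
        by (auto simp: inherited_weakstar_def topspace_pullback_topology)
      then show "f \<in> mult_op -` {T \<in> bounded_ops L ipL. \<phi> T \<in> U} \<inter> A"
        using ops \<phi>_mult by auto
    next
      fix f assume f: "f \<in> mult_op -` {T \<in> bounded_ops L ipL. \<phi> T \<in> U} \<inter> A"
      then have "mult_op f \<in> topspace (weakstar_topology L ipL)"
        using openin_subset[OF open_sets[OF U]] by blast
      then show "f \<in> {f \<in> topspace (inherited_weakstar A L ipL). f y \<in> U}"
        using f \<phi>_mult by (auto simp: inherited_weakstar_def topspace_pullback_topology)
    qed
    show "openin (inherited_weakstar A L ipL) {f \<in> topspace (inherited_weakstar A L ipL). f y \<in> U}"
      unfolding preimage unfolding inherited_weakstar_def openin_pullback_topology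
      using open_sets[OF U] by blast
  qed simp
qed

text \<open>Complete contractivity gives the upper bound. For r below \<open>nrm G\<close>, locality
  provides a finite F whose quotient norm exceeds r, and the module over F a representation of norm
  at least r at G. Its entries are combinations of evaluations, which are weak*-continuous.\<close>

lemma weakstar_RFD:
  assumes loc: "local_algebra A nrm"
  shows "weakstar_RFD A nrm (inherited_weakstar A L ipL)"
  unfolding weakstar_RFD_def
proof (intro allI impI ballI)
  fix n G assume n: "n > (0::nat)" and G: "G \<in> Mat A n"
  let ?\<tau> = "inherited_weakstar A L ipL"
  define S where "S = {op_norm (amplification k \<pi> G) | k \<pi>. k > 0 \<and> algebra_hom A k \<pi> \<and>
    completely_contractive A nrm k \<pi> \<and> weakstar_continuous ?\<tau> k \<pi>}"
  have upper: "x \<le> nrm G" if x: "x \<in> S" for x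
    using x n G unfolding S_def completely_contractive_def by blast
  have bdd: "bdd_above S"
    using upper by (auto simp: bdd_above_def)
  have key: "\<exists>x\<in>S. r \<le> x" if F: "finite F" "F \<noteq> {}" and Q: "rep_form A nrm ({..<n} \<times> F) Q"
    and r: "0 \<le> r" "r\<^sup>2 * (\<Sum>j<n. Re (Q (unit_row j) (unit_row j))) \<le>
      (\<Sum>i<n. Re (Q (fun_mat_act n (\<lambda>i k. G $$ (i, k)) unit_row i)
        (fun_mat_act n (\<lambda>i k. G $$ (i, k)) unit_row i)))" for r F Q
  proof -
    obtain k \<pi> where k: "k > 0" and hom: "algebra_hom A k \<pi>"
      and entries: "\<forall>a<k. \<forall>b<k. \<exists>c. \<forall>f. \<pi> f $$ (a, b) = (\<Sum>z\<in>{..<n} \<times> F. c z * f (snd z))"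
      and bound: "\<forall>m>0. \<forall>G\<in>Mat A m. \<forall>v\<in>carrier_vec (m * k).
        vec_norm2 (amplification k \<pi> G *\<^sub>v v) \<le> nrm G * vec_norm2 v"
      and lower': "\<forall>G\<in>Mat A n. \<forall>r\<ge>0. r\<^sup>2 * (\<Sum>j<n. Re (Q (unit_row j) (unit_row j))) \<le>
        (\<Sum>i<n. Re (Q (fun_mat_act n (\<lambda>i k. G $$ (i, k)) unit_row i)
          (fun_mat_act n (\<lambda>i k. G $$ (i, k)) unit_row i))) \<longrightarrow> r \<le> op_norm (amplification k \<pi> G)"
      using rep_form_representation[OF Q n F] by (elim exE conjE)
    have lower: "r \<le> op_norm (amplification k \<pi> G)"
      by (rule lower'[rule_format, OF G r])
    have "completely_contractive A nrm k \<pi>"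
      unfolding completely_contractive_def
    proof (intro allI impI ballI)
      fix m H assume m: "m > (0::nat)" and H: "H \<in> Mat A m"
      have "dim_col (amplification k \<pi> H) = m * k"
        using H by (auto simp: amplification_def Mat_iff)
      then show "op_norm (amplification k \<pi> H) \<le> nrm H"
        using bound m H nrm_nonneg[OF m H] by (intro op_norm_le) auto
    qed
    moreover have "weakstar_continuous ?\<tau> k \<pi>"
      unfolding weakstar_continuous_def
    proof (intro allI impI)
      fix a b assume "a < k" "b < k"
      then obtain c where c: "\<And>f. \<pi> f $$ (a, b) = (\<Sum>z\<in>{..<n} \<times> F. c z * f (snd z))"
        using entries by blast
      have "continuous_map ?\<tau> euclidean (\<lambda>f. c z * f (snd z))" for z
        using evaluation_weakstar_continuous[of "snd z"] by (simp add: continuous_map_atin tendsto_mult)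
      then show "continuous_map ?\<tau> euclidean (\<lambda>f. \<pi> f $$ (a, b))"
        unfolding c using F by (intro continuous_map_sum) auto
    qed
    ultimately have "op_norm (amplification k \<pi> G) \<in> S"
      unfolding S_def using k hom by blast
    then show ?thesis
      using lower by blast
  qed
  \<comment> \<open>The standard form over an arbitrary single point gives one admissible
    representation. Thus S is nonempty and Sup S >= 0, so that the r chosen later is
    nonnegative.\<close>
  have "\<exists>x\<in>S. 0 \<le> x"
  proof (rule key)
    let ?p = "\<lambda>v w :: nat \<times> 'x \<Rightarrow> complex. \<Sum>z\<in>{..<n} \<times> {undefined}. v z * cnj (w z)"
    show "rep_form A nrm ({..<n} \<times> {undefined}) ?p"
      by (intro rep_form_standard) simp
    have "0 \<le> Re (?p v v)" for v
      by (rule psd_form.ip_ge_zero[OF psd_form_standard]) simp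
    then show "0\<^sup>2 * (\<Sum>j<n. Re (?p (unit_row j) (unit_row j))) \<le>
      (\<Sum>i<n. Re (?p (fun_mat_act n (\<lambda>i k. G $$ (i, k)) unit_row i)
        (fun_mat_act n (\<lambda>i k. G $$ (i, k)) unit_row i)))"
      by (simp only: zero_power2 mult_zero_left sum_nonneg)
  qed auto
  then have ne: "S \<noteq> {}" and Sup_nonneg: "0 \<le> Sup S"
    using cSup_upper2[OF _ _ bdd] by auto
  have "nrm G \<le> Sup S"
  proof (rule ccontr)
    assume less: "\<not> nrm G \<le> Sup S"
    define r where "r = (Sup S + nrm G) / 2"
    have r: "0 \<le> r" "Sup S < r" "r < nrm G"
      using less Sup_nonneg by (auto simp: r_def)
    have "nrm G = (SUP F\<in>{F. finite F}. quotient_norm A nrm F G)"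
      using loc n G by (simp add: local_algebra_def)
    moreover have "bdd_above ((\<lambda>F. quotient_norm A nrm F G) ` {F. finite F})"
      using quotient_norm_le_nrm[OF n G] by (auto simp: bdd_above_def)
    ultimately obtain F where F: "finite F" "r < quotient_norm A nrm F G"
      using r less_cSUP_iff[of "{F. finite F}" "\<lambda>F. quotient_norm A nrm F G" r] by auto
    then have F_ne: "F \<noteq> {}"
      using quotient_norm_empty[OF n G] r by auto
    obtain x where "x \<in> S" "r \<le> x"
      using rep_form_exists[OF n G F(1) r(1) F(2)] key[OF F(1) F_ne _ r(1)] by blast
    then show False
      using cSup_upper[OF _ bdd, of x] r by simp
  qed
  then show "nrm G = Sup {op_norm (amplification k \<pi> G) | k \<pi>. k > 0 \<and> algebra_hom A k \<pi> \<and>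
      completely_contractive A nrm k \<pi> \<and> weakstar_continuous ?\<tau> k \<pi>}"
    unfolding S_def[symmetric] using cSup_least[OF ne upper] by (simp add: order_antisym)
qed

end

text \<open>The first half shows that the weak* topology exists at all, so the second is not
  vacuous; the second holds for every choice of representing kernel.\<close>

theorem theorem3p4:
  fixes A :: "('x \<Rightarrow> complex) set" and nrm :: "('x \<Rightarrow> complex) mat \<Rightarrow> real"
  assumes "operator_algebra_of_functions A nrm"
    and "local_algebra A nrm"
    and "BPW_complete A nrm"
  shows "(\<exists>(C :: ('x kernel_index \<Rightarrow> complex) set) ipC K L ipL.
            represented_by_kernel A nrm C ipC K L ipL) \<and>
         (\<forall>(C :: 'v::complex_vector set) ipC K L ipL.
            represented_by_kernel A nrm C ipC K L ipL \<longrightarrow>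
            weakstar_RFD A nrm (inherited_weakstar A L ipL))"
proof -
  interpret function_operator_algebra A nrm
    by unfold_locales (rule assms(1))
  show ?thesis
  proof (intro conjI allI impI)
    show "\<exists>(C :: ('x kernel_index \<Rightarrow> complex) set) ipC K L ipL. represented_by_kernel A nrm C ipC K L ipL"
      by (rule kernel_representation_exists[OF assms(2,3)])
    fix C :: "'v set" and ipC K L ipL
    assume "represented_by_kernel A nrm C ipC K L ipL"
    then interpret kernel_representation A nrm C ipC K L ipL
      by unfold_locales
    show "weakstar_RFD A nrm (inherited_weakstar A L ipL)"
      by (rule weakstar_RFD[OF assms(2)])
  qed
qed

end
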